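(* A topological space $X$ is homeomorphic to $\mathrm{Spec}(\mathrm{Free}(k))$ for some cardinal $k$ if and only if it is cylinder based.
   Context: An MV-algebra is a structure $(A,\oplus,0,\neg)$ such that $(A,\oplus,0)$ is a commutative monoid, $\neg\neg x=x$, $x\oplus\neg 0=\neg 0$ and $\neg(\neg x\oplus y)\oplus y=\neg(\neg y\oplus x)\oplus x$. It is a lattice with $x\vee y=\neg(\neg x\oplus y)\oplus y$ and $x\wedge y=\neg(\neg x\vee\neg y)$. An ideal is a nonempty downward closed subset closed under $\oplus$; an ideal $P\neq A$ is prime if $x\wedge y\in P$ implies $x\in P$ or $y\in P$. $\mathrm{Spec}(A)$ is the set of prime ideals with the Zariski topology generated by the open sets $O(a)=\{P : a\notin P\}$, $a\in A$. $\mathrm{Free}(k)$ is the free MV-algebra over $k$ generators ($k$ possibly infinite). A topological space is spectral if it is sober (every irreducible closed set is the closure of a unique singleton), compact, and its compact open subsets form a basis of the topology closed under intersections of any two members. $\overset{\circ}{K}(X)$ is the lattice of compact open subsets of $X$. For a finite set $Y$, a rational simplex in $[0,1]^Y$ is the convex envelope of finitely many affinely independent rational points, and a rational polyhedron is a finite union of rational simplexes. For a cardinal $k$, a cylinder rational polyhedron of $[0,1]^k$ is a set $\{f\in[0,1]^k : f|_Y\in P_0\}$ where $Y\subseteq k$ is finite and $P_0\subseteq[0,1]^Y$ is a rational polyhedron. $\mathrm{Cypol}(k)$ is the lattice of these sets, ordered by inclusion. A topological space $X$ is cylinder based if $X$ is spectral and $\overset{\circ}{K}(X)$ is anti-isomorphic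 to $\mathrm{Cypol}(k)$ for some cardinal $k$, possibly infinite. *)

theory Defs
  imports "HOL-Analysis.Analysis" "HOL-Library.Function_Algebras"
begin

section \<open>MV-algebras and their spectra\<close>

record 'a mv_algebra =
  carrier :: "'a set"
  oplus :: "'a \<Rightarrow> 'a \<Rightarrow> 'a" (infixl "\<oplus>\<index>" 65)
  zero :: 'a ("\<zero>\<index>")
  neg :: "'a \<Rightarrow> 'a" ("\<sim>\<index> _" [81] 80)

locale mv_algebra =
  fixes A :: "'a mv_algebra" (structure)
  assumes oplus_closed: "\<lbrakk>x \<in> carrier A; y \<in> carrier A\<rbrakk> \<Longrightarrow> x \<oplus> y \<in> carrier A"
    and zero_closed: "\<zero> \<in> carrier A"
    and neg_closed: "x \<in> carrier A \<Longrightarrow> \<sim> x \<in> carrier A"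
    and oplus_assoc: "\<lbrakk>x \<in> carrier A; y \<in> carrier A; z \<in> carrier A\<rbrakk>
      \<Longrightarrow> (x \<oplus> y) \<oplus> z = x \<oplus> (y \<oplus> z)"
    and oplus_comm: "\<lbrakk>x \<in> carrier A; y \<in> carrier A\<rbrakk> \<Longrightarrow> x \<oplus> y = y \<oplus> x"
    and oplus_zero: "x \<in> carrier A \<Longrightarrow> x \<oplus> \<zero> = x"
    and neg_neg: "x \<in> carrier A \<Longrightarrow> \<sim> (\<sim> x) = x"
    and oplus_one: "x \<in> carrier A \<Longrightarrow> x \<oplus> \<sim> \<zero> = \<sim> \<zero>"
    and lukasiewicz: "\<lbrakk>x \<in> carrier A; y \<in> carrier A\<rbrakk>
      \<Longrightarrow> \<sim> (\<sim> x \<oplus> y) \<oplus> y = \<sim> (\<sim> y \<oplus> x) \<oplus> x"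

definition mv_join :: "'a mv_algebra \<Rightarrow> 'a \<Rightarrow> 'a \<Rightarrow> 'a" where
  "mv_join A x y = \<sim>\<^bsub>A\<^esub> (\<sim>\<^bsub>A\<^esub> x \<oplus>\<^bsub>A\<^esub> y) \<oplus>\<^bsub>A\<^esub> y"

definition mv_meet :: "'a mv_algebra \<Rightarrow> 'a \<Rightarrow> 'a \<Rightarrow> 'a" where
  "mv_meet A x y = \<sim>\<^bsub>A\<^esub> (mv_join A (\<sim>\<^bsub>A\<^esub> x) (\<sim>\<^bsub>A\<^esub> y))"

definition mv_le :: "'a mv_algebra \<Rightarrow> 'a \<Rightarrow> 'a \<Rightarrow> bool" where
  "mv_le A x y \<longleftrightarrow> mv_join A x y = y"

definition mv_ideal :: "'a mv_algebra \<Rightarrow> 'a set \<Rightarrow> bool" where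
  "mv_ideal A I \<longleftrightarrow> I \<subseteq> carrier A \<and> I \<noteq> {} \<and>
    (\<forall>x\<in>I. \<forall>y\<in>carrier A. mv_le A y x \<longrightarrow> y \<in> I) \<and>
    (\<forall>x\<in>I. \<forall>y\<in>I. x \<oplus>\<^bsub>A\<^esub> y \<in> I)"

definition mv_prime_ideal :: "'a mv_algebra \<Rightarrow> 'a set \<Rightarrow> bool" where
  "mv_prime_ideal A P \<longleftrightarrow> mv_ideal A P \<and> P \<noteq> carrier A \<and>
    (\<forall>x\<in>carrier A. \<forall>y\<in>carrier A. mv_meet A x y \<in> P \<longrightarrow> x \<in> P \<or> y \<in> P)"

definition mv_spec :: "'a mv_algebra \<Rightarrow> 'a set topology" where
  "mv_spec A = topology_generated_by ((\<lambda>a. {P. mv_prime_ideal A P \<and> a \<notin> P}) ` carrier A)"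

lemma topspace_mv_spec: "topspace (mv_spec A) = {P. mv_prime_ideal A P}"
proof -
  have "\<exists>a\<in>carrier A. a \<notin> P" if "mv_prime_ideal A P" for P
    using that unfolding mv_prime_ideal_def mv_ideal_def by blast
  then show ?thesis
    by (auto simp: mv_spec_def)
qed


section \<open>Free MV-algebras\<close>

datatype (mv_vars: 'k) mv_term =
    Gen 'k
  | Zero
  | Neg "'k mv_term"
  | Oplus "'k mv_term" "'k mv_term"

inductive mv_equiv :: "'k mv_term \<Rightarrow> 'k mv_term \<Rightarrow> bool" where
  refl: "mv_equiv s s"
| sym: "mv_equiv s t \<Longrightarrow> mv_equiv t s"
| trans: "\<lbrakk>mv_equiv s t; mv_equiv t u\<rbrakk> \<Longrightarrow> mv_equiv s u"
| cong_neg: "mv_equiv s t \<Longrightarrow> mv_equiv (Neg s) (Neg t)"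
| cong_oplus: "\<lbrakk>mv_equiv s t; mv_equiv s' t'\<rbrakk> \<Longrightarrow> mv_equiv (Oplus s s') (Oplus t t')"
| assoc: "mv_equiv (Oplus (Oplus s t) u) (Oplus s (Oplus t u))"
| comm: "mv_equiv (Oplus s t) (Oplus t s)"
| unit: "mv_equiv (Oplus s Zero) s"
| double_neg: "mv_equiv (Neg (Neg s)) s"
| absorb: "mv_equiv (Oplus s (Neg Zero)) (Neg Zero)"
| luk: "mv_equiv (Oplus (Neg (Oplus (Neg s) t)) t) (Oplus (Neg (Oplus (Neg t) s)) s)"

definition mv_term_rel :: "'k set \<Rightarrow> 'k mv_term rel" where
  "mv_term_rel K = {(s, t). mv_vars s \<subseteq> K \<and> mv_vars t \<subseteq> K \<and> mv_equiv s t}"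

definition free_mv :: "'k set \<Rightarrow> 'k mv_term set mv_algebra" where
  "free_mv K = \<lparr>
     carrier = {t. mv_vars t \<subseteq> K} // mv_term_rel K,
     oplus = (\<lambda>C D. \<Union>s\<in>C. \<Union>t\<in>D. mv_term_rel K `` {Oplus s t}),
     zero = mv_term_rel K `` {Zero},
     neg = (\<lambda>C. \<Union>s\<in>C. mv_term_rel K `` {Neg s})\<rparr>"

definition free_mv_gen :: "'k set \<Rightarrow> 'k \<Rightarrow> 'k mv_term set" where
  "free_mv_gen K k = mv_term_rel K `` {Gen k}"

definition mv_hom :: "'a mv_algebra \<Rightarrow> 'b mv_algebra \<Rightarrow> ('a \<Rightarrow> 'b) \<Rightarrow> bool" where
  "mv_hom A B h \<longleftrightarrow> h \<in> carrier A \<rightarrow> carrier B \<and>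
    (\<forall>x\<in>carrier A. \<forall>y\<in>carrier A. h (x \<oplus>\<^bsub>A\<^esub> y) = h x \<oplus>\<^bsub>B\<^esub> h y) \<and>
    h \<zero>\<^bsub>A\<^esub> = \<zero>\<^bsub>B\<^esub> \<and>
    (\<forall>x\<in>carrier A. h (\<sim>\<^bsub>A\<^esub> x) = \<sim>\<^bsub>B\<^esub> h x)"

lemma equiv_mv_term_rel: "equiv {t. mv_vars t \<subseteq> K} (mv_term_rel K)"
  unfolding mv_term_rel_def
  by (rule equivI) (auto intro!: refl_onI symI transI intro: mv_equiv.refl mv_equiv.sym mv_equiv.trans)

lemma free_mv_carrierE:
  assumes "C \<in> carrier (free_mv K)"
  obtains s where "mv_vars s \<subseteq> K" "C = mv_term_rel K `` {s}"
  using assms by (auto simp: free_mv_def quotient_def)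

lemma free_mv_class_closed:
  "mv_vars s \<subseteq> K \<Longrightarrow> mv_term_rel K `` {s} \<in> carrier (free_mv K)"
  by (auto simp: free_mv_def quotient_def)

lemma free_mv_class_eq_iff:
  assumes "mv_vars s \<subseteq> K" "mv_vars t \<subseteq> K"
  shows "mv_term_rel K `` {s} = mv_term_rel K `` {t} \<longleftrightarrow> mv_equiv s t"
  using assms eq_equiv_class_iff[OF equiv_mv_term_rel[of K], of s t]
  by (simp add: mv_term_rel_def)

lemma free_mv_neg_class:
  assumes "mv_vars s \<subseteq> K"
  shows "\<sim>\<^bsub>free_mv K\<^esub> (mv_term_rel K `` {s}) = mv_term_rel K `` {Neg s}"
proof -
  have "mv_term_rel K `` {Neg s'} = mv_term_rel K `` {Neg s}" if "s' \<in> mv_term_rel K `` {s}" for s'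
  proof -
    have "mv_equiv s' s" "mv_vars s' \<subseteq> K"
      using that by (auto simp: mv_term_rel_def intro: mv_equiv.sym)
    then show ?thesis
      using assms by (simp add: free_mv_class_eq_iff mv_equiv.cong_neg)
  qed
  moreover have "s \<in> mv_term_rel K `` {s}"
    using assms by (auto simp: mv_term_rel_def intro: mv_equiv.refl)
  ultimately have "(\<Union>s'\<in>mv_term_rel K `` {s}. mv_term_rel K `` {Neg s'}) = mv_term_rel K `` {Neg s}"
    by (intro UN_constant_eq ballI)
  then show ?thesis
    by (simp add: free_mv_def)
qed

lemma free_mv_oplus_class:
  assumes "mv_vars s \<subseteq> K" "mv_vars t \<subseteq> K"
  shows "mv_term_rel K `` {s} \<oplus>\<^bsub>free_mv K\<^esub> mv_term_rel K `` {t} = mv_term_rel K `` {Oplus s t}"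
proof -
  have "mv_term_rel K `` {Oplus s' t'} = mv_term_rel K `` {Oplus s t}"
    if "s' \<in> mv_term_rel K `` {s}" "t' \<in> mv_term_rel K `` {t}" for s' t'
  proof -
    have "mv_equiv s' s" "mv_equiv t' t" "mv_vars s' \<subseteq> K" "mv_vars t' \<subseteq> K"
      using that by (auto simp: mv_term_rel_def intro: mv_equiv.sym)
    then show ?thesis
      using assms by (simp add: free_mv_class_eq_iff mv_equiv.cong_oplus)
  qed
  moreover have "s \<in> mv_term_rel K `` {s}" "t \<in> mv_term_rel K `` {t}"
    using assms by (auto simp: mv_term_rel_def intro: mv_equiv.refl)
  ultimately have "(\<Union>s'\<in>mv_term_rel K `` {s}. \<Union>t'\<in>mv_term_rel K `` {t}. mv_term_rel K `` {Oplus s' t'}) =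
      mv_term_rel K `` {Oplus s t}"
    by (intro UN_constant_eq ballI)
  then show ?thesis
    by (simp add: free_mv_def)
qed

lemma free_mv_zero_class: "\<zero>\<^bsub>free_mv K\<^esub> = mv_term_rel K `` {Zero}"
  by (simp add: free_mv_def)

lemma mv_algebra_free_mv: "mv_algebra (free_mv K)"
  by unfold_locales
    ((elim free_mv_carrierE)?;
      simp add: free_mv_class_closed free_mv_oplus_class free_mv_neg_class free_mv_zero_class
        free_mv_class_eq_iff mv_equiv.assoc mv_equiv.comm mv_equiv.unit mv_equiv.double_neg
        mv_equiv.absorb mv_equiv.luk)+

primrec mv_eval :: "'a mv_algebra \<Rightarrow> ('k \<Rightarrow> 'a) \<Rightarrow> 'k mv_term \<Rightarrow> 'a" where
  "mv_eval B g (Gen k) = g k"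
| "mv_eval B g Zero = \<zero>\<^bsub>B\<^esub>"
| "mv_eval B g (Neg s) = \<sim>\<^bsub>B\<^esub> (mv_eval B g s)"
| "mv_eval B g (Oplus s t) = mv_eval B g s \<oplus>\<^bsub>B\<^esub> mv_eval B g t"

lemma mv_eval_closed:
  assumes "mv_algebra B" "\<And>k. k \<in> mv_vars s \<Longrightarrow> g k \<in> carrier B"
  shows "mv_eval B g s \<in> carrier B"
proof -
  interpret mv_algebra B by fact
  show ?thesis
    using assms(2) by (induction s) (auto intro: zero_closed neg_closed oplus_closed)
qed

lemma mv_eval_equiv:
  assumes "mv_algebra B" "\<And>k. g k \<in> carrier B" "mv_equiv s t"
  shows "mv_eval B g s = mv_eval B g t"
proof -
  interpret mv_algebra B by fact
  have [simp]: "mv_eval B g u \<in> carrier B" for u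
    using assms(1,2) by (intro mv_eval_closed)
  show ?thesis
    using assms(3)
    by (induction rule: mv_equiv.induct)
      (simp_all add: oplus_assoc oplus_zero neg_neg oplus_one oplus_comm lukasiewicz)
qed

text \<open>\<^const>\<open>free_mv\<close> has the universal property of the free MV-algebra over \<^term>\<open>K\<close>.\<close>

theorem free_mv_universal:
  assumes B: "mv_algebra B" and g: "g \<in> K \<rightarrow> carrier B"
  shows "\<exists>!h. h \<in> extensional (carrier (free_mv K)) \<and> mv_hom (free_mv K) B h \<and>
    (\<forall>k\<in>K. h (free_mv_gen K k) = g k)"
proof (rule ex_ex1I)
  define g' where "g' k = (if k \<in> K then g k else \<zero>\<^bsub>B\<^esub>)" for k
  have g': "g' k \<in> carrier B" for k
    using g mv_algebra.zero_closed[OF B] by (auto simp: g'_def)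
  define h where
    "h = (\<lambda>C\<in>carrier (free_mv K). mv_eval B g' (SOME s. s \<in> C))"
  have h: "h (mv_term_rel K `` {s}) = mv_eval B g' s" if "mv_vars s \<subseteq> K" for s
  proof -
    have "s \<in> mv_term_rel K `` {s}"
      using that by (auto simp: mv_term_rel_def intro: mv_equiv.refl)
    then have "(SOME t. t \<in> mv_term_rel K `` {s}) \<in> mv_term_rel K `` {s}"
      by (rule someI)
    then have "mv_equiv s (SOME t. t \<in> mv_term_rel K `` {s})"
      by (auto simp: mv_term_rel_def)
    then show ?thesis
      using mv_eval_equiv[of B g', OF B g'] that by (simp add: h_def free_mv_class_closed)
  qed
  have "mv_hom (free_mv K) B h"
    unfolding mv_hom_def
    by (auto elim!: free_mv_carrierE
        simp: free_mv_oplus_class free_mv_neg_class free_mv_zero_class h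
        intro!: mv_eval_closed B g')
  moreover have "\<forall>k\<in>K. h (free_mv_gen K k) = g k"
    by (auto simp: free_mv_gen_def h g'_def)
  ultimately show "\<exists>h. h \<in> extensional (carrier (free_mv K)) \<and> mv_hom (free_mv K) B h \<and>
      (\<forall>k\<in>K. h (free_mv_gen K k) = g k)"
    by (auto simp: h_def)
next
  fix h h'
  assume h: "h \<in> extensional (carrier (free_mv K)) \<and> mv_hom (free_mv K) B h \<and>
      (\<forall>k\<in>K. h (free_mv_gen K k) = g k)"
    and h': "h' \<in> extensional (carrier (free_mv K)) \<and> mv_hom (free_mv K) B h' \<and>
      (\<forall>k\<in>K. h' (free_mv_gen K k) = g k)"
  have eval: "f (mv_term_rel K `` {s}) = mv_eval B g s"
    if f: "mv_hom (free_mv K) B f" "\<forall>k\<in>K. f (free_mv_gen K k) = g k" and "mv_vars s \<subseteq> K" for f s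
    using that(3)
  proof (induction s)
    case (Gen k)
    then show ?case using f by (simp add: free_mv_gen_def)
  next
    case Zero
    then show ?case using f by (simp add: mv_hom_def free_mv_zero_class)
  next
    case (Neg s)
    then show ?case
      using f free_mv_class_closed[of s K] by (simp add: mv_hom_def flip: free_mv_neg_class)
  next
    case (Oplus s t)
    then show ?case
      using f free_mv_class_closed[of s K] free_mv_class_closed[of t K]
      by (simp add: mv_hom_def flip: free_mv_oplus_class)
  qed
  show "h = h'"
  proof (rule extensionalityI)
    show "h C = h' C" if "C \<in> carrier (free_mv K)" for C
      using that h h' by (elim free_mv_carrierE) (simp add: eval)
  qed (use h h' in auto)
qed


section \<open>Spectral spaces\<close>

definition irreducible_closedin :: "'a topology \<Rightarrow> 'a set \<Rightarrow> bool" where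
  "irreducible_closedin X C \<longleftrightarrow> closedin X C \<and> C \<noteq> {} \<and>
    (\<forall>D E. closedin X D \<and> closedin X E \<and> C = D \<union> E \<longrightarrow> C = D \<or> C = E)"

definition sober_space :: "'a topology \<Rightarrow> bool" where
  "sober_space X \<longleftrightarrow>
    (\<forall>C. irreducible_closedin X C \<longrightarrow> (\<exists>!x. x \<in> topspace X \<and> C = X closure_of {x}))"

definition compact_opens :: "'a topology \<Rightarrow> 'a set set" where
  "compact_opens X = {U. openin X U \<and> compactin X U}"

definition spectral_space :: "'a topology \<Rightarrow> bool" where
  "spectral_space X \<longleftrightarrow> sober_space X \<and> compact_space X \<and>
    openin X = arbitrary union_of (\<lambda>U. U \<in> compact_opens X) \<and>
    (\<forall>U\<in>compact_opens X. \<forall>V\<in>compact_opens X. U \<inter> V \<in> compact_opens X)"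


section \<open>Cylinder rational polyhedra\<close>

instantiation "fun" :: (type, real_vector) real_vector
begin

definition scaleR_fun :: "real \<Rightarrow> ('a \<Rightarrow> 'b) \<Rightarrow> 'a \<Rightarrow> 'b" where
  "scaleR_fun c f = (\<lambda>x. c *\<^sub>R f x)"

instance
  by standard (simp_all add: scaleR_fun_def fun_eq_iff scaleR_add_left scaleR_add_right)

end

text \<open>
  \<open>[0,1]\<^sup>Y\<close> is \<^term>\<open>Y \<rightarrow>\<^sub>E {0..1::real}\<close>. Affine combinations of extensional functions are again
  extensional, since \<^const>\<open>undefined\<close> is an affine combination of itself; hence
  \<^const>\<open>affine_dependent\<close> and \<open>convex hull\<close> on the function space are those of \<open>[0,1]\<^sup>Y\<close>.
\<close>

definition rational_simplex :: "'k set \<Rightarrow> ('k \<Rightarrow> real) set \<Rightarrow> bool" where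
  "rational_simplex Y S \<longleftrightarrow>
    (\<exists>V. finite V \<and> V \<subseteq> (Y \<rightarrow>\<^sub>E {0..1}) \<and> (\<forall>v\<in>V. \<forall>y\<in>Y. v y \<in> \<rat>) \<and>
      \<not> affine_dependent V \<and> S = convex hull V)"

definition rational_polyhedron :: "'k set \<Rightarrow> ('k \<Rightarrow> real) set \<Rightarrow> bool" where
  "rational_polyhedron Y P \<longleftrightarrow>
    (\<exists>\<S>. finite \<S> \<and> (\<forall>S\<in>\<S>. rational_simplex Y S) \<and> P = \<Union>\<S>)"

definition Cypol :: "'k set \<Rightarrow> ('k \<Rightarrow> real) set set" where
  "Cypol K = {{f \<in> K \<rightarrow>\<^sub>E {0..1}. restrict f Y \<in> P0} | Y P0.
    finite Y \<and> Y \<subseteq> K \<and> rational_polyhedron Y P0}"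


section \<open>Cylinder based spaces\<close>

definition anti_isomorphic :: "'a::order set \<Rightarrow> 'b::order set \<Rightarrow> bool" where
  "anti_isomorphic L M \<longleftrightarrow>
    (\<exists>\<phi>. bij_betw \<phi> L M \<and> (\<forall>x\<in>L. \<forall>y\<in>L. x \<le> y \<longleftrightarrow> \<phi> y \<le> \<phi> x))"

text \<open>
  Cardinals are represented by sets \<^term>\<open>K :: 'k set\<close>. HOL cannot quantify over types, so the type
  \<^typ>\<open>'k\<close> is a parameter; a statement polymorphic in \<^typ>\<open>'k\<close> covers all cardinals.
\<close>

definition cylinder_based :: "'k itself \<Rightarrow> 'a topology \<Rightarrow> bool" where
  "cylinder_based _ X \<longleftrightarrow> spectral_space X \<and>
    (\<exists>K :: 'k set. anti_isomorphic (compact_opens X) (Cypol K))"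

end

theory Submission
  imports "HOL-Algebra.FiniteProduct" Defs
begin

text \<open>
  Two facts connect the two sides. First, the compact open sets of the spectrum of an MV-algebra are
  exactly the basic sets \<open>O(a)\<close>, and a spectral space is determined by its lattice of compact open
  sets. Secondly, sending \<open>O(a)\<close> to the zero set of the McNaughton function of \<open>a\<close> is an
  anti-isomorphism from the compact open sets of \<open>Spec(Free(K))\<close> to the cylinder rational polyhedra.

  For the second fact one needs that \<open>O(s) \<subseteq> O(t)\<close> as soon as \<open>s\<close> vanishes wherever \<open>t\<close> does. If a
  prime ideal contains \<open>t\<close> but not \<open>s\<close>, the quotient is an MV-chain, which embeds into the unit
  interval of its Chang group, a totally ordered abelian group. The finitely many linear inequalities
  that determine the values of all subterms of \<open>s\<close> and \<open>t\<close> hold in that group, hence are solvable in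
  \<open>\<rat>\<close> by Fourier--Motzkin elimination, and the solution is a point of the cube where \<open>t\<close> but not \<open>s\<close>
  vanishes. Fourier--Motzkin elimination also yields the rationality of the vertices of a polytope
  given by integer inequalities, and such inequalities for a given rational simplex.
\<close>

section \<open>Fourier--Motzkin elimination\<close>

text \<open>Points of the cube yield only some of the prime ideals: the quotient by a prime may
  contain infinitesimals, and such a chain does not embed into [0,1], so its values cannot be copied
  to a point. What can be copied is the finite linear system that a valuation satisfies. The forms
  \<open>lin\<close> have integer coefficients, so they make sense in any abelian group, and the
  strong unit is one more coordinate (\<open>None\<close>), so the system is homogeneous; rescaling
  a rational solution restores the value 1 there.

  On the polyhedral side only zero sets matter. Clipped integer affine functions are built as terms;
  sums of terms intersect zero sets and minima unite them, which realizes every rational polyhedron.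
  Conversely a term is affine on each of finitely many polytopes. A rational polyhedron is just a
  finite union of simplexes, which may overlap, so Caratheodory's theorem, applied to the finitely
  many rational vertices, covers each polytope.\<close>

definition lin :: "'v set \<Rightarrow> ('v \<Rightarrow> int) \<Rightarrow> ('v \<Rightarrow> real) \<Rightarrow> real" where
  "lin V c x = (\<Sum>v\<in>V. of_int (c v) * x v)"

text \<open>For \<open>d v < 0 < c v\<close> this is a combination of \<open>c\<close> and
  \<open>d\<close> with the positive weights \<open>- d v\<close> and \<open>c v\<close>, chosen so
  that the coefficient of \<open>v\<close> cancels.\<close>

definition eliminate :: "'v \<Rightarrow> ('v \<Rightarrow> int) \<Rightarrow> ('v \<Rightarrow> int) \<Rightarrow> 'v \<Rightarrow> int" where
  "eliminate v c d = (\<lambda>w. c v * d w - d v * c w)"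

lemma lin_cong: "(\<And>v. v \<in> V \<Longrightarrow> c v = d v) \<Longrightarrow> (\<And>v. v \<in> V \<Longrightarrow> x v = y v) \<Longrightarrow> lin V c x = lin V d y"
  by (simp add: lin_def)

lemma lin_empty [simp]: "lin {} c x = 0"
  by (simp add: lin_def)

lemma lin_zero: "lin V (\<lambda>w. 0) x = 0"
  by (simp add: lin_def)

lemma lin_insert: "finite V \<Longrightarrow> v \<notin> V \<Longrightarrow> lin (insert v V) c x = of_int (c v) * x v + lin V c x"
  by (simp add: lin_def)

lemma lin_upd: "v \<notin> V \<Longrightarrow> lin V c (x(v := z)) = lin V c x"
  by (auto simp: lin_def intro!: sum.cong)

lemma lin_add: "lin V (\<lambda>w. c w + d w) x = lin V c x + lin V d x"
  by (simp add: lin_def sum.distrib algebra_simps)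

lemma lin_diff: "lin V (\<lambda>w. c w - d w) x = lin V c x - lin V d x"
  by (simp add: lin_def sum_subtractf algebra_simps)

lemma lin_neg: "lin V (\<lambda>w. - c w) x = - lin V c x"
  by (simp add: lin_def sum_negf)

lemma lin_scale: "lin V c (\<lambda>w. r * x w) = r * lin V c x"
  by (simp add: lin_def sum_distrib_left algebra_simps)

lemma lin_plus: "lin V c (\<lambda>w. x w + y w) = lin V c x + lin V c y"
  by (simp add: lin_def sum.distrib algebra_simps)

lemma lin_eliminate:
  "lin V (eliminate v c d) x = of_int (c v) * lin V d x - of_int (d v) * lin V c x"
  by (simp add: lin_def eliminate_def sum_subtractf sum_distrib_left algebra_simps)

lemma lin_single: "finite V \<Longrightarrow> v \<in> V \<Longrightarrow> lin V (\<lambda>w. if w = v then k else 0) x = of_int k * x v"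
  by (simp add: lin_def if_distrib[where f = of_int] if_distrib[where f = "\<lambda>a. a * _"] cong: if_cong)

lemma lin_in_Rats: "(\<And>v. v \<in> V \<Longrightarrow> x v \<in> \<rat>) \<Longrightarrow> lin V c x \<in> \<rat>"
  unfolding lin_def by (intro Rats_sum Rats_mult) auto

text \<open>The midpoint of \<open>Max A\<close> and \<open>Min B\<close> works, or one step beyond
  the only nonempty side; this choice is rational when the bounds are. \<open>A'\<close> and
  \<open>B'\<close> mark the bounds that must be strict.\<close>

lemma separating_point:
  fixes A B :: "real set"
  assumes fin: "finite A" "finite B"
    and le: "\<And>a b. a \<in> A \<Longrightarrow> b \<in> B \<Longrightarrow> a \<le> b"
    and less: "\<And>a b. a \<in> A \<Longrightarrow> b \<in> B \<Longrightarrow> a \<in> A' \<or> b \<in> B' \<Longrightarrow> a < b"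
  obtains z where "\<And>a. a \<in> A \<Longrightarrow> a \<le> z" "\<And>a. a \<in> A \<Longrightarrow> a \<in> A' \<Longrightarrow> a < z"
    "\<And>b. b \<in> B \<Longrightarrow> z \<le> b" "\<And>b. b \<in> B \<Longrightarrow> b \<in> B' \<Longrightarrow> z < b"
    "A \<subseteq> \<rat> \<Longrightarrow> B \<subseteq> \<rat> \<Longrightarrow> z \<in> \<rat>"
proof (cases "A = {}")
  case True
  show ?thesis
  proof (cases "B = {}")
    case True
    then show ?thesis using \<open>A = {}\<close> by (intro that[of 0]) auto
  next
    case False
    have "Min B - 1 < b" if "b \<in> B" for b
      using Min_le[OF fin(2) that] by linarith
    moreover have "Min B \<in> B" using False fin by simp
    ultimately show ?thesis using \<open>A = {}\<close>
      by (intro that[of "Min B - 1"]) (auto simp: less_imp_le)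
  qed
next
  case A: False
  have a: "Max A \<in> A" "\<And>a. a \<in> A \<Longrightarrow> a \<le> Max A" using A fin by auto
  show ?thesis
  proof (cases "B = {}")
    case True
    have "a < Max A + 1" if "a \<in> A" for a
      using a(2)[OF that] by linarith
    then show ?thesis using True a(1)
      by (intro that[of "Max A + 1"]) (auto simp: less_imp_le)
  next
    case B: False
    have b: "Min B \<in> B" "\<And>b. b \<in> B \<Longrightarrow> Min B \<le> b" using B fin by auto
    define z where "z = (Max A + Min B) / 2"
    show ?thesis
    proof (rule that[of z])
      show "a \<le> z" if "a \<in> A" for a
        using a(2)[OF that] le[OF that b(1)] by (simp add: z_def)
      show "a < z" if "a \<in> A" "a \<in> A'" for a
        using a(2)[OF that(1)] less[OF that(1) b(1)] that by (simp add: z_def)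
      show "z \<le> c" if "c \<in> B" for c
        using b(2)[OF that] le[OF a(1) that] by (simp add: z_def)
      show "z < c" if "c \<in> B" "c \<in> B'" for c
        using b(2)[OF that(1)] less[OF a(1) that(1)] that by (simp add: z_def)
      show "z \<in> \<rat>" if "A \<subseteq> \<rat>" "B \<subseteq> \<rat>"
        using a(1) b(1) that by (auto simp: z_def intro!: Rats_divide Rats_add)
    qed
  qed
qed

text \<open>A form with positive coefficient at \<open>v\<close> bounds the new value
  \<open>z\<close> from below, one with negative coefficient bounds it from above. The gap between
  two such bounds is the value of the eliminated form divided by a positive number, so nonnegative
  eliminated forms leave room for \<open>z\<close>. \<open>S\<close> collects the strict
  inequalities.\<close>

lemma back_substitution:
  assumes V: "finite V" "v \<notin> V" and T: "finite T"
    and zero: "\<And>c. c \<in> T \<Longrightarrow> c v = 0 \<Longrightarrow> 0 \<le> lin V c x \<and> (c \<in> S \<longrightarrow> 0 < lin V c x)"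
    and elim: "\<And>c d. c \<in> T \<Longrightarrow> d \<in> T \<Longrightarrow> 0 < c v \<Longrightarrow> d v < 0 \<Longrightarrow>
      0 \<le> lin V (eliminate v c d) x \<and> (c \<in> S \<or> d \<in> S \<longrightarrow> 0 < lin V (eliminate v c d) x)"
  obtains z where
    "\<And>c. c \<in> T \<Longrightarrow> 0 \<le> lin (insert v V) c (x(v := z)) \<and> (c \<in> S \<longrightarrow> 0 < lin (insert v V) c (x(v := z)))"
    "(\<And>w. w \<in> V \<Longrightarrow> x w \<in> \<rat>) \<Longrightarrow> z \<in> \<rat>"
proof -
  define b where "b c = - lin V c x / of_int (c v)" for c
  let ?L = "{c \<in> T. 0 < c v}" and ?U = "{c \<in> T. c v < 0}"
  have cmp: "b c \<le> b d \<and> (c \<in> S \<or> d \<in> S \<longrightarrow> b c < b d)" if "c \<in> ?L" "d \<in> ?U" for c d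
  proof -
    have *: "real_of_int (c v) > 0" "real_of_int (d v) < 0"
      using that by auto
    have "b d - b c = (of_int (c v) * lin V d x - of_int (d v) * lin V c x) / (of_int (c v) * - of_int (d v))"
      using * by (simp add: b_def field_simps)
    then have "b d - b c = lin V (eliminate v c d) x / (of_int (c v) * - of_int (d v))"
      by (simp add: lin_eliminate)
    moreover have "of_int (c v) * - real_of_int (d v) > 0"
      using * by (intro mult_pos_pos) auto
    ultimately show ?thesis
      using elim[of c d] that
      by (metis (mono_tags, lifting) diff_gt_0_iff_gt diff_ge_0_iff_ge divide_nonneg_pos divide_pos_pos
          mem_Collect_eq)
  qed
  obtain z where z: "\<And>a. a \<in> b ` ?L \<Longrightarrow> a \<le> z" "\<And>a. a \<in> b ` ?L \<Longrightarrow> a \<in> b ` (?L \<inter> S) \<Longrightarrow> a < z"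
    "\<And>a. a \<in> b ` ?U \<Longrightarrow> z \<le> a" "\<And>a. a \<in> b ` ?U \<Longrightarrow> a \<in> b ` (?U \<inter> S) \<Longrightarrow> z < a"
    "b ` ?L \<subseteq> \<rat> \<Longrightarrow> b ` ?U \<subseteq> \<rat> \<Longrightarrow> z \<in> \<rat>"
  proof (rule separating_point[of "b ` ?L" "b ` ?U" "b ` (?L \<inter> S)" "b ` (?U \<inter> S)"])
    show "finite (b ` ?L)" "finite (b ` ?U)" using T by auto
    show "a \<le> a'" if "a \<in> b ` ?L" "a' \<in> b ` ?U" for a a'
      using that cmp by blast
    show "a < a'" if "a \<in> b ` ?L" "a' \<in> b ` ?U" "a \<in> b ` (?L \<inter> S) \<or> a' \<in> b ` (?U \<inter> S)" for a a'
      using that(3)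
    proof
      assume "a \<in> b ` (?L \<inter> S)"
      with that(2) cmp show ?thesis by blast
    next
      assume "a' \<in> b ` (?U \<inter> S)"
      with that(1) cmp show ?thesis by blast
    qed
  qed blast
  show ?thesis
  proof (rule that[of z])
    fix c assume c: "c \<in> T"
    have eq: "lin (insert v V) c (x(v := z)) = of_int (c v) * z + lin V c x"
      using V by (simp add: lin_insert lin_upd)
    consider "c v = 0" | "0 < c v" | "c v < 0" by linarith
    then show "0 \<le> lin (insert v V) c (x(v := z)) \<and> (c \<in> S \<longrightarrow> 0 < lin (insert v V) c (x(v := z)))"
    proof cases
      case 1
      then show ?thesis using zero[OF c] by (simp add: eq)
    next
      case 2
      then have "b c \<le> z" "c \<in> S \<longrightarrow> b c < z" using z(1,2) c by auto
      then show ?thesis using 2 unfolding eq b_def by (auto simp: field_simps)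
    next
      case 3
      then have "z \<le> b c" "c \<in> S \<longrightarrow> z < b c" using z(3,4) c by auto
      then show ?thesis using 3 unfolding eq b_def by (auto simp: field_simps)
    qed
  next
    assume "\<And>w. w \<in> V \<Longrightarrow> x w \<in> \<rat>"
    then have "b c \<in> \<rat>" for c
      unfolding b_def by (intro Rats_divide) (auto intro: lin_in_Rats)
    then show "z \<in> \<rat>" by (intro z(5)) auto
  qed
qed

text \<open>
  \<open>N\<close> plays the role of the forms that take a nonnegative value at some point of an ordered abelian
  group; the lemma transfers a finite system of homogeneous inequalities from that group to \<open>\<rat>\<close>.
\<close>

lemma rational_solution:
  fixes N :: "('v \<Rightarrow> int) set"
  assumes add: "\<And>c d. c \<in> N \<Longrightarrow> d \<in> N \<Longrightarrow> (\<lambda>w. c w + d w) \<in> N"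
  shows "finite V \<Longrightarrow> finite T \<Longrightarrow> T \<subseteq> N \<Longrightarrow> S \<subseteq> T \<Longrightarrow> (\<And>c. c \<in> S \<Longrightarrow> (\<lambda>w. - c w) \<notin> N) \<Longrightarrow>
    (\<And>c v. c \<in> T \<Longrightarrow> v \<notin> V \<Longrightarrow> c v = 0) \<Longrightarrow>
    \<exists>x. (\<forall>v\<in>V. x v \<in> \<rat>) \<and> (\<forall>c\<in>T. 0 \<le> lin V c x \<and> (c \<in> S \<longrightarrow> 0 < lin V c x))"
proof (induction V arbitrary: T S rule: finite_induct)
  case empty
  \<comment> \<open>With no variables left every form is the zero function, hence equals its own
    negative, which a strict form may not have in \<open>N\<close>.\<close>
  have "c = (\<lambda>w. - c w)" if "c \<in> T" for c
    using empty that by (auto simp: fun_eq_iff)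
  then have "S = {}"
    using empty by (metis equals0I subset_iff)
  then show ?case by simp
next
  case (insert v V)
  \<comment> \<open>Multiples start at one: \<open>N\<close> is only closed under addition and need
    not contain the zero form.\<close>
  have scale: "(\<lambda>w. int (Suc n) * c w) \<in> N" if "c \<in> N" for c n
  proof (induction n)
    case (Suc n)
    then show ?case using add[OF that, of "\<lambda>w. int (Suc n) * c w"] by (simp add: algebra_simps)
  qed (use that in simp)
  have pos_scale: "(\<lambda>w. k * c w) \<in> N" if "c \<in> N" "0 < k" for c k
    using scale[OF that(1), of "nat (k - 1)"] that(2) by simp
  have elim_N: "eliminate v c d \<in> N" if "c \<in> N" "d \<in> N" "0 < c v" "d v < 0" for c d
    using add[OF pos_scale[OF that(2,3)] pos_scale[OF that(1), of "- d v"]] that(4)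
    by (simp add: eliminate_def)
  \<comment> \<open>A positive combination with a strict summand is strict: adding
    \<open>l * d\<close> and then \<open>(k - 1) * c\<close> to its negative would bring
    \<open>- c\<close> into \<open>N\<close>. The case \<open>k = 1\<close> is separate because the
    second summand would be the zero form.\<close>
  have strict: "(\<lambda>w. - (k * c w + l * d w)) \<notin> N" if "c \<in> N" "d \<in> N" "0 < k" "0 < l" "(\<lambda>w. - c w) \<notin> N" for c d k l
  proof
    assume *: "(\<lambda>w. - (k * c w + l * d w)) \<in> N"
    have 1: "(\<lambda>w. - (k * c w)) \<in> N"
      using add[OF * pos_scale[OF that(2,4)]] by (simp add: algebra_simps)
    show False
    proof (cases "k = 1")
      case True
      with 1 that(5) show False by simp
    next
      case False
      have "(\<lambda>w. - (k * c w) + (k - 1) * c w) \<in> N"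
        by (rule add[OF 1 pos_scale[OF that(1)]]) (use False that(3) in linarith)
      then show False using that(5) by (simp add: algebra_simps)
    qed
  qed
  \<comment> \<open>An eliminated form counts as strict as soon as one of its two parents
    does.\<close>
  define E where "E U = {eliminate v c d | c d. c \<in> T \<and> d \<in> T \<and> 0 < c v \<and> d v < 0 \<and> (c \<in> U \<or> d \<in> U)}" for U
  define T' where "T' = {c \<in> T. c v = 0} \<union> E T"
  define S' where "S' = {c \<in> S. c v = 0} \<union> E S"
  have "E T \<subseteq> (\<lambda>(c, d). eliminate v c d) ` (T \<times> T)"
    by (auto simp: E_def)
  then have fin: "finite T'"
    using insert.prems(1) by (auto simp: T'_def intro: finite_subset)
  have "\<exists>x. (\<forall>w\<in>V. x w \<in> \<rat>) \<and> (\<forall>c\<in>T'. 0 \<le> lin V c x \<and> (c \<in> S' \<longrightarrow> 0 < lin V c x))"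
  proof (rule insert.IH[OF fin])
    show "T' \<subseteq> N"
      using insert.prems(2) elim_N by (auto simp: T'_def E_def)
    show "S' \<subseteq> T'"
      using insert.prems(3) by (auto simp: T'_def S'_def E_def)
    show "(\<lambda>w. - c w) \<notin> N" if c: "c \<in> S'" for c
    proof -
      consider "c \<in> S" | d e where "c = eliminate v d e" "d \<in> T" "e \<in> T" "0 < d v" "e v < 0" "d \<in> S \<or> e \<in> S"
        using c unfolding S'_def E_def by blast
      then show ?thesis
      proof cases
        case 1
        then show ?thesis using insert.prems(4) by blast
      next
        case 2
        from 2(6) show ?thesis
        proof
          assume "d \<in> S"
          then show ?thesis
            using strict[of d e "- e v" "d v"] 2 insert.prems(2,4)
            by (auto simp: eliminate_def algebra_simps)
        next
          assume "e \<in> S"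
          then show ?thesis
            using strict[of e d "d v" "- e v"] 2 insert.prems(2,4)
            by (auto simp: eliminate_def algebra_simps)
        qed
      qed
    qed
    show "c w = 0" if c: "c \<in> T'" "w \<notin> V" for c w
    proof -
      consider "c \<in> T" "c v = 0" | d e where "c = eliminate v d e" "d \<in> T" "e \<in> T"
        using c(1) unfolding T'_def E_def by blast
      then show ?thesis
      proof cases
        case 1
        then show ?thesis using insert.prems(5)[of c w] c(2) by (cases "w = v") auto
      next
        case 2
        then show ?thesis using insert.prems(5)[of d w] insert.prems(5)[of e w] c(2)
          by (cases "w = v") (auto simp: eliminate_def)
      qed
    qed
  qed
  then obtain x where x: "\<And>w. w \<in> V \<Longrightarrow> x w \<in> \<rat>"
    "\<And>c. c \<in> T' \<Longrightarrow> 0 \<le> lin V c x \<and> (c \<in> S' \<longrightarrow> 0 < lin V c x)" by blast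
  obtain z where z: "\<And>c. c \<in> T \<Longrightarrow> 0 \<le> lin (insert v V) c (x(v := z)) \<and>
      (c \<in> S \<longrightarrow> 0 < lin (insert v V) c (x(v := z)))" "(\<And>w. w \<in> V \<Longrightarrow> x w \<in> \<rat>) \<Longrightarrow> z \<in> \<rat>"
  proof (rule back_substitution[OF insert.hyps insert.prems(1), of x S])
    show "0 \<le> lin V c x \<and> (c \<in> S \<longrightarrow> 0 < lin V c x)" if "c \<in> T" "c v = 0" for c
      using x(2)[of c] that by (auto simp: T'_def S'_def)
    show "0 \<le> lin V (eliminate v c d) x \<and> (c \<in> S \<or> d \<in> S \<longrightarrow> 0 < lin V (eliminate v c d) x)"
      if "c \<in> T" "d \<in> T" "0 < c v" "d v < 0" for c d
    proof -
      have "eliminate v c d \<in> T'" "c \<in> S \<or> d \<in> S \<longrightarrow> eliminate v c d \<in> S'"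
        using that by (auto simp: T'_def S'_def E_def)
      then show ?thesis using x(2) by blast
    qed
  qed blast
  have "\<forall>w\<in>insert v V. (x(v := z)) w \<in> \<rat>"
    using x(1) z(2) by auto
  with z(1) show ?case by blast
qed

text \<open>Here the remaining coordinates are a parameter and an equivalence is wanted, so that an
  existential quantifier over \<open>v\<close> is traded for inequalities. The easy direction adds
  two given inequalities with weights \<open>c v\<close> and \<open>- d v\<close>.\<close>

lemma projection_step:
  fixes T :: "('v \<Rightarrow> int) set"
  assumes V: "finite V" "v \<notin> V" and T: "finite T"
  obtains T' where "finite T'"
    "\<And>x. (\<forall>c\<in>T'. 0 \<le> lin V c x) \<longleftrightarrow> (\<exists>z. \<forall>c\<in>T. 0 \<le> lin (insert v V) c (x(v := z)))"
proof -
  define E where "E = {eliminate v c d | c d. c \<in> T \<and> d \<in> T \<and> 0 < c v \<and> d v < 0}"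
  show ?thesis
  proof (rule that[of "{c \<in> T. c v = 0} \<union> E"])
    have "E \<subseteq> (\<lambda>(c, d). eliminate v c d) ` (T \<times> T)"
      by (auto simp: E_def)
    then show "finite ({c \<in> T. c v = 0} \<union> E)"
      using T by (auto intro: finite_subset)
    fix x
    show "(\<forall>c\<in>{c \<in> T. c v = 0} \<union> E. 0 \<le> lin V c x) \<longleftrightarrow> (\<exists>z. \<forall>c\<in>T. 0 \<le> lin (insert v V) c (x(v := z)))"
    proof
      assume *: "\<forall>c\<in>{c \<in> T. c v = 0} \<union> E. 0 \<le> lin V c x"
      have "\<exists>z. \<forall>c\<in>T. 0 \<le> lin (insert v V) c (x(v := z))"
        by (rule back_substitution[OF V T, of x "{}"]) (use * in \<open>auto simp: E_def\<close>)
      then show "\<exists>z. \<forall>c\<in>T. 0 \<le> lin (insert v V) c (x(v := z))" .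
    next
      assume "\<exists>z. \<forall>c\<in>T. 0 \<le> lin (insert v V) c (x(v := z))"
      then obtain z where z: "\<And>c. c \<in> T \<Longrightarrow> 0 \<le> of_int (c v) * z + lin V c x"
        using V by (auto simp: lin_insert lin_upd)
      have "0 \<le> lin V (eliminate v c d) x" if "c \<in> T" "d \<in> T" "0 < c v" "d v < 0" for c d
      proof -
        have "0 \<le> of_int (c v) * (of_int (d v) * z + lin V d x)" "0 \<le> of_int (- d v) * (of_int (c v) * z + lin V c x)"
          using z[OF that(1)] z[OF that(2)] that by (intro mult_nonneg_nonneg; simp)+
        then show ?thesis by (simp add: lin_eliminate algebra_simps)
      qed
      then show "\<forall>c\<in>{c \<in> T. c v = 0} \<union> E. 0 \<le> lin V c x"
        using z by (force simp: E_def)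
    qed
  qed
qed

text \<open>\<open>V\<close> is generalized because the variables eliminated later still count as
  remaining ones while the others are projected away.\<close>

lemma projection:
  fixes T :: "('v \<Rightarrow> int) set"
  assumes "finite W"
  shows "finite V \<Longrightarrow> V \<inter> W = {} \<Longrightarrow> finite T \<Longrightarrow> \<exists>T'. finite T' \<and>
    (\<forall>x. (\<forall>c\<in>T'. 0 \<le> lin V c x) \<longleftrightarrow>
      (\<exists>z. \<forall>c\<in>T. 0 \<le> lin (V \<union> W) c (\<lambda>w. if w \<in> W then z w else x w)))"
  using assms
proof (induction W arbitrary: V T rule: finite_induct)
  case empty
  then show ?case by (intro exI[of _ T]) auto
next
  case (insert v W)
  have "finite (insert v V)" "insert v V \<inter> W = {}"
    using insert by auto
  then obtain T1 where T1: "finite T1" "\<And>x. (\<forall>c\<in>T1. 0 \<le> lin (insert v V) c x) \<longleftrightarrow>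
      (\<exists>z. \<forall>c\<in>T. 0 \<le> lin (insert v V \<union> W) c (\<lambda>w. if w \<in> W then z w else x w))"
    using insert.IH[of "insert v V" T] insert.prems by blast
  obtain T2 where T2: "finite T2"
    "\<And>x. (\<forall>c\<in>T2. 0 \<le> lin V c x) \<longleftrightarrow> (\<exists>a. \<forall>c\<in>T1. 0 \<le> lin (insert v V) c (x(v := a)))"
    using projection_step[of V v T1] insert.prems T1(1) by auto
  show ?case
  proof (intro exI[of _ T2] conjI T2(1) allI)
    fix x
    have "(\<forall>c\<in>T2. 0 \<le> lin V c x) \<longleftrightarrow>
      (\<exists>a z. \<forall>c\<in>T. 0 \<le> lin (insert v V \<union> W) c (\<lambda>w. if w \<in> W then z w else (x(v := a)) w))"
      by (simp only: T2(2) T1(2))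
    also have "\<dots> \<longleftrightarrow> (\<exists>z. \<forall>c\<in>T. 0 \<le> lin (V \<union> insert v W) c (\<lambda>w. if w \<in> insert v W then z w else x w))"
    proof (intro iffI; elim exE)
      fix a z assume *: "\<forall>c\<in>T. 0 \<le> lin (insert v V \<union> W) c (\<lambda>w. if w \<in> W then z w else (x(v := a)) w)"
      have "(\<lambda>w. if w \<in> insert v W then (z(v := a)) w else x w) = (\<lambda>w. if w \<in> W then z w else (x(v := a)) w)"
        using insert.hyps by (auto simp: fun_eq_iff)
      then show "\<exists>z. \<forall>c\<in>T. 0 \<le> lin (V \<union> insert v W) c (\<lambda>w. if w \<in> insert v W then z w else x w)"
        using * by (intro exI[of _ "z(v := a)"]) simp
    next
      fix z assume *: "\<forall>c\<in>T. 0 \<le> lin (V \<union> insert v W) c (\<lambda>w. if w \<in> insert v W then z w else x w)"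
      have "(\<lambda>w. if w \<in> insert v W then z w else x w) = (\<lambda>w. if w \<in> W then z w else (x(v := z v)) w)"
        by (auto simp: fun_eq_iff)
      then show "\<exists>a z. \<forall>c\<in>T. 0 \<le> lin (insert v V \<union> W) c (\<lambda>w. if w \<in> W then z w else (x(v := a)) w)"
        using * by (intro exI[of _ "z v"] exI[of _ z]) simp
    qed
    finally show "(\<forall>c\<in>T2. 0 \<le> lin V c x) \<longleftrightarrow>
      (\<exists>z. \<forall>c\<in>T. 0 \<le> lin (V \<union> insert v W) c (\<lambda>w. if w \<in> insert v W then z w else x w))" .
  qed
qed


section \<open>MV-algebras and their prime ideals\<close>

context mv_algebra
begin

abbreviation ord (infix "\<preceq>" 50) where "x \<preceq> y \<equiv> mv_le A x y"

abbreviation dif (infixl "\<ominus>" 65) where "x \<ominus> y \<equiv> \<sim> (\<sim> x \<oplus> y)"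

abbreviation meet (infixl "\<sqinter>" 70) where "x \<sqinter> y \<equiv> mv_meet A x y"

declare oplus_closed [simp] zero_closed [simp] neg_closed [simp] neg_neg [simp] oplus_zero [simp]
  oplus_one [simp]

section \<open>Arithmetic, order, residuation and lattice operations of MV-algebras\<close>

lemma oplus_left_comm:
  "\<lbrakk>x \<in> carrier A; y \<in> carrier A; z \<in> carrier A\<rbrakk> \<Longrightarrow> x \<oplus> (y \<oplus> z) = y \<oplus> (x \<oplus> z)"
  by (metis oplus_assoc oplus_comm)

lemma zero_oplus [simp]: "x \<in> carrier A \<Longrightarrow> \<zero> \<oplus> x = x"
  by (metis oplus_comm oplus_zero zero_closed)

lemma one_oplus [simp]: "x \<in> carrier A \<Longrightarrow> \<sim> \<zero> \<oplus> x = \<sim> \<zero>"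
  by (metis neg_closed oplus_comm oplus_one zero_closed)

lemma neg_oplus [simp]: "x \<in> carrier A \<Longrightarrow> \<sim> x \<oplus> x = \<sim> \<zero>"
  using lukasiewicz[of x "\<sim> \<zero>"] by simp

lemma oplus_neg [simp]: "x \<in> carrier A \<Longrightarrow> x \<oplus> \<sim> x = \<sim> \<zero>"
  by (metis neg_closed neg_oplus oplus_comm)

lemma neg_eq_iff: "\<lbrakk>x \<in> carrier A; y \<in> carrier A\<rbrakk> \<Longrightarrow> \<sim> x = \<sim> y \<longleftrightarrow> x = y"
  by (metis neg_neg)

lemma le_iff:
  assumes "x \<in> carrier A" "y \<in> carrier A"
  shows "x \<preceq> y \<longleftrightarrow> \<sim> x \<oplus> y = \<sim> \<zero>"
proof
  assume "x \<preceq> y"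
  then have "y = (y \<ominus> x) \<oplus> x"
    using lukasiewicz[OF assms] by (simp add: mv_le_def mv_join_def)
  then have "\<sim> x \<oplus> y = (y \<ominus> x) \<oplus> (\<sim> x \<oplus> x)"
    using assms by (metis neg_closed oplus_closed oplus_left_comm)
  then show "\<sim> x \<oplus> y = \<sim> \<zero>"
    using assms by simp
qed (use assms in \<open>simp add: mv_le_def mv_join_def\<close>)

lemma le_refl [simp]: "x \<in> carrier A \<Longrightarrow> x \<preceq> x"
  by (simp add: le_iff)

lemma zero_le [simp]: "x \<in> carrier A \<Longrightarrow> \<zero> \<preceq> x"
  by (simp add: le_iff)

lemma le_one [simp]: "x \<in> carrier A \<Longrightarrow> x \<preceq> \<sim> \<zero>"
  by (simp add: le_iff)

lemma le_antisym: "\<lbrakk>x \<preceq> y; y \<preceq> x; x \<in> carrier A; y \<in> carrier A\<rbrakk> \<Longrightarrow> x = y"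
  using lukasiewicz[of x y] by (simp add: mv_le_def mv_join_def)

lemma dif_oplus_cancel: "\<lbrakk>x \<preceq> y; x \<in> carrier A; y \<in> carrier A\<rbrakk> \<Longrightarrow> (y \<ominus> x) \<oplus> x = y"
  using lukasiewicz[of x y] by (simp add: mv_le_def mv_join_def)

lemma le_oplus [simp]: "\<lbrakk>x \<in> carrier A; y \<in> carrier A\<rbrakk> \<Longrightarrow> x \<preceq> x \<oplus> y"
  by (simp add: le_iff flip: oplus_assoc)

lemma le_oplus' [simp]: "\<lbrakk>x \<in> carrier A; y \<in> carrier A\<rbrakk> \<Longrightarrow> x \<preceq> y \<oplus> x"
  by (metis le_oplus oplus_comm)

lemma le_trans:
  assumes "x \<preceq> y" "y \<preceq> z" "x \<in> carrier A" "y \<in> carrier A" "z \<in> carrier A"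
  shows "x \<preceq> z"
proof -
  have "z = (z \<ominus> y) \<oplus> ((y \<ominus> x) \<oplus> x)"
    using assms by (simp add: dif_oplus_cancel)
  also have "\<dots> = ((z \<ominus> y) \<oplus> (y \<ominus> x)) \<oplus> x"
    using assms by (simp add: oplus_assoc)
  finally show ?thesis
    using assms by (metis le_oplus' neg_closed oplus_closed)
qed

lemma neg_le_iff: "\<lbrakk>x \<in> carrier A; y \<in> carrier A\<rbrakk> \<Longrightarrow> \<sim> x \<preceq> \<sim> y \<longleftrightarrow> y \<preceq> x"
  by (simp add: le_iff) (metis neg_closed oplus_comm)

lemma oplus_mono_right:
  assumes "y \<preceq> z" "x \<in> carrier A" "y \<in> carrier A" "z \<in> carrier A"
  shows "x \<oplus> y \<preceq> x \<oplus> z"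
proof -
  have "x \<oplus> z = (x \<oplus> y) \<oplus> (z \<ominus> y)"
    using assms dif_oplus_cancel[of y z] by (metis neg_closed oplus_assoc oplus_closed oplus_comm)
  then show ?thesis
    using assms by simp
qed

lemma oplus_mono:
  assumes "x \<preceq> x'" "y \<preceq> y'" "x \<in> carrier A" "y \<in> carrier A" "x' \<in> carrier A" "y' \<in> carrier A"
  shows "x \<oplus> y \<preceq> x' \<oplus> y'"
proof -
  have "x \<oplus> y \<preceq> x \<oplus> y'" "x \<oplus> y' \<preceq> x' \<oplus> y'"
    using assms oplus_mono_right[of y y' x] oplus_mono_right[of x x' y'] by (simp_all add: oplus_comm)
  then show ?thesis
    using assms by (auto intro: le_trans)
qed

lemma dif_le_iff:
  "\<lbrakk>x \<in> carrier A; y \<in> carrier A; z \<in> carrier A\<rbrakk> \<Longrightarrow> x \<ominus> y \<preceq> z \<longleftrightarrow> x \<preceq> y \<oplus> z"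
  by (simp add: le_iff oplus_assoc)

lemma le_oplus_dif: "\<lbrakk>x \<in> carrier A; y \<in> carrier A\<rbrakk> \<Longrightarrow> x \<preceq> y \<oplus> (x \<ominus> y)"
  by (simp flip: dif_le_iff)

lemma dif_mono_left:
  "\<lbrakk>x \<preceq> z; x \<in> carrier A; y \<in> carrier A; z \<in> carrier A\<rbrakk> \<Longrightarrow> x \<ominus> y \<preceq> z \<ominus> y"
  by (simp add: dif_le_iff) (meson le_oplus_dif le_trans neg_closed oplus_closed)

lemma join_closed [simp]: "\<lbrakk>x \<in> carrier A; y \<in> carrier A\<rbrakk> \<Longrightarrow> mv_join A x y \<in> carrier A"
  by (simp add: mv_join_def)

lemma join_ge:
  assumes "x \<in> carrier A" "y \<in> carrier A"
  shows "x \<preceq> mv_join A x y" "y \<preceq> mv_join A x y"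
proof -
  show "x \<preceq> mv_join A x y"
    using assms unfolding mv_join_def by (subst lukasiewicz) simp_all
  show "y \<preceq> mv_join A x y"
    using assms by (simp add: mv_join_def)
qed

lemma join_least:
  assumes "x \<preceq> z" "y \<preceq> z" "x \<in> carrier A" "y \<in> carrier A" "z \<in> carrier A"
  shows "mv_join A x y \<preceq> z"
proof -
  have "(x \<ominus> y) \<oplus> y \<preceq> (z \<ominus> y) \<oplus> y"
    using assms by (intro oplus_mono dif_mono_left) auto
  then show ?thesis
    using assms by (simp add: mv_join_def dif_oplus_cancel)
qed

lemma meet_closed [simp]: "\<lbrakk>x \<in> carrier A; y \<in> carrier A\<rbrakk> \<Longrightarrow> x \<sqinter> y \<in> carrier A"
  by (simp add: mv_meet_def)

lemma meet_le:
  assumes "x \<in> carrier A" "y \<in> carrier A"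
  shows "x \<sqinter> y \<preceq> x" "x \<sqinter> y \<preceq> y"
  using assms join_ge[of "\<sim> x" "\<sim> y"] neg_le_iff[of "mv_join A (\<sim> x) (\<sim> y)"]
  by (metis join_closed mv_meet_def neg_closed neg_neg)+

lemma meet_greatest:
  assumes "z \<preceq> x" "z \<preceq> y" "x \<in> carrier A" "y \<in> carrier A" "z \<in> carrier A"
  shows "z \<preceq> x \<sqinter> y"
proof -
  have "mv_join A (\<sim> x) (\<sim> y) \<preceq> \<sim> z"
    using assms by (intro join_least) (auto simp: neg_le_iff)
  then show ?thesis
    using assms neg_le_iff[of "\<sim> z" "mv_join A (\<sim> x) (\<sim> y)"] by (simp add: mv_meet_def)
qed

lemma meet_comm: "\<lbrakk>x \<in> carrier A; y \<in> carrier A\<rbrakk> \<Longrightarrow> x \<sqinter> y = y \<sqinter> x"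
  by (intro le_antisym meet_greatest meet_le) auto

lemma meet_eq: "\<lbrakk>x \<in> carrier A; y \<in> carrier A\<rbrakk> \<Longrightarrow> x \<sqinter> y = (x \<oplus> \<sim> y) \<ominus> \<sim> y"
  by (simp add: mv_meet_def mv_join_def)

lemma meet_absorb: "\<lbrakk>x \<preceq> y; x \<in> carrier A; y \<in> carrier A\<rbrakk> \<Longrightarrow> x \<sqinter> y = x"
  by (intro le_antisym meet_greatest meet_le) auto

text \<open>Adding \<open>x\<close> has the left adjoint that subtracts \<open>x\<close>
  (\<open>dif_le_iff\<close>), hence preserves meets; this is the nontrivial half.\<close>

lemma oplus_meet_greatest:
  assumes "w \<preceq> x \<oplus> y" "w \<preceq> x \<oplus> z" "w \<in> carrier A" "x \<in> carrier A" "y \<in> carrier A" "z \<in> carrier A"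
  shows "w \<preceq> x \<oplus> (y \<sqinter> z)"
proof -
  have "w \<ominus> x \<preceq> y \<sqinter> z"
    using assms by (intro meet_greatest) (simp_all add: dif_le_iff)
  then show ?thesis
    using assms by (simp add: dif_le_iff)
qed

text \<open>Distributing the right side by \<open>oplus_meet_greatest\<close> leaves sums that
  either contain \<open>z\<close> as a summand or are \<open>x \<oplus> y\<close>; all of them bound
  the left side. It makes the elements whose meet with \<open>z\<close> lies in an ideal closed
  under sums.\<close>

lemma meet_oplus_le:
  assumes C: "x \<in> carrier A" "y \<in> carrier A" "z \<in> carrier A"
  shows "(x \<oplus> y) \<sqinter> z \<preceq> (x \<sqinter> z) \<oplus> (y \<sqinter> z)"
proof -
  have *: "(x \<oplus> y) \<sqinter> z \<preceq> w" if "z \<preceq> w" "w \<in> carrier A" for w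
    using that C meet_le(2)[of "x \<oplus> y" z] by (auto intro: le_trans)
  have 1: "(x \<oplus> y) \<sqinter> z \<preceq> u \<oplus> (y \<sqinter> z)" if "(x \<oplus> y) \<sqinter> z \<preceq> u \<oplus> y" "u \<in> carrier A" for u
    by (rule oplus_meet_greatest) (use that C in \<open>auto intro: *\<close>)
  have "(x \<oplus> y) \<sqinter> z \<preceq> (y \<sqinter> z) \<oplus> (x \<sqinter> z)"
  proof (rule oplus_meet_greatest)
    show "(x \<oplus> y) \<sqinter> z \<preceq> (y \<sqinter> z) \<oplus> x"
      using C 1[of x] meet_le(1)[of "x \<oplus> y" z] by (simp add: oplus_comm)
    show "(x \<oplus> y) \<sqinter> z \<preceq> (y \<sqinter> z) \<oplus> z"
      using C by (intro *) auto
  qed (use C in auto)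
  then show ?thesis
    using C by (simp add: oplus_comm)
qed

text \<open>With \<open>w = x \<sqinter> y\<close> and \<open>d = (x \<ominus> y) \<sqinter> (y \<ominus> x)\<close> one has \<open>w \<oplus> d = w\<close> and \<open>d \<preceq> \<sim> w\<close>, so \<open>d = \<zero>\<close>.\<close>

lemma prelinear:
  assumes C: "x \<in> carrier A" "y \<in> carrier A"
  shows "(x \<ominus> y) \<sqinter> (y \<ominus> x) = \<zero>"
proof -
  \<comment> \<open>The meet is \<open>x \<ominus> (x \<ominus> y)\<close>, so adding
    \<open>x \<ominus> y\<close> back gives \<open>x\<close> itself.\<close>
  have x: "w \<oplus> (x \<ominus> y) \<preceq> x" if "w = x \<sqinter> y" "x \<in> carrier A" "y \<in> carrier A" for w x y
  proof -
    have "x \<ominus> y \<preceq> x"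
      using that by (simp add: dif_le_iff)
    moreover have "x \<sqinter> y = x \<ominus> (x \<ominus> y)"
      using that by (metis meet_comm meet_eq neg_closed neg_neg oplus_closed oplus_comm)
    ultimately show ?thesis
      using that by (simp add: dif_oplus_cancel)
  qed
  let ?w = "x \<sqinter> y" and ?d = "(x \<ominus> y) \<sqinter> (y \<ominus> x)"
  have cl: "?w \<in> carrier A" "?d \<in> carrier A" "x \<ominus> y \<in> carrier A" "y \<ominus> x \<in> carrier A"
    using C by simp_all
  have "?w \<oplus> ?d \<preceq> ?w \<oplus> (x \<ominus> y)" "?w \<oplus> ?d \<preceq> ?w \<oplus> (y \<ominus> x)"
    using C by (intro oplus_mono_right meet_le; simp)+
  moreover have "?w \<oplus> (x \<ominus> y) \<preceq> x" "?w \<oplus> (y \<ominus> x) \<preceq> y"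
    using C x[of ?w x y] x[of ?w y x] by (simp_all add: meet_comm)
  ultimately have "?w \<oplus> ?d \<preceq> ?w"
    using C cl by (intro meet_greatest) (blast intro: le_trans oplus_closed)+
  then have wd: "?d \<oplus> ?w = ?w"
    using cl by (intro le_antisym) (auto simp: oplus_comm)
  have "?d \<preceq> \<sim> ?w"
  proof -
    have "?d \<preceq> x \<ominus> y" using cl by (intro meet_le)
    moreover have "x \<ominus> y \<preceq> \<sim> y"
      using C by (simp add: dif_le_iff)
    moreover have "\<sim> y \<preceq> \<sim> ?w"
      using C cl by (simp add: neg_le_iff meet_le)
    ultimately show ?thesis
      using C cl by (meson le_trans neg_closed)
  qed
  \<comment> \<open>Below \<open>\<sim> ?w\<close> the sum with \<open>?w\<close> is not truncated,
    so \<open>?w\<close> can be subtracted again; as the sum is \<open>?w\<close>, nothing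
    remains.\<close>
  then have "?d = (?d \<oplus> ?w) \<ominus> ?w"
    using cl meet_absorb[of ?d "\<sim> ?w"] meet_eq[of ?d "\<sim> ?w"] by simp
  then show ?thesis
    using cl wd by (metis neg_neg neg_oplus zero_closed)
qed

section \<open>Ideals, prime ideals and the quotient by a prime\<close>

lemma zero_in_ideal: "mv_ideal A I \<Longrightarrow> \<zero> \<in> I"
  unfolding mv_ideal_def by (metis equals0I subsetD zero_closed zero_le)

lemma ideal_le: "\<lbrakk>mv_ideal A I; y \<in> I; x \<preceq> y; x \<in> carrier A\<rbrakk> \<Longrightarrow> x \<in> I"
  unfolding mv_ideal_def by blast

lemma ideal_oplus: "\<lbrakk>mv_ideal A I; x \<in> I; y \<in> I\<rbrakk> \<Longrightarrow> x \<oplus> y \<in> I"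
  unfolding mv_ideal_def by blast

lemma ideal_subset: "mv_ideal A I \<Longrightarrow> I \<subseteq> carrier A"
  unfolding mv_ideal_def by blast

lemma ideal_oplus_iff:
  "\<lbrakk>mv_ideal A I; x \<in> carrier A; y \<in> carrier A\<rbrakk> \<Longrightarrow> x \<oplus> y \<in> I \<longleftrightarrow> x \<in> I \<and> y \<in> I"
  by (meson ideal_le ideal_oplus le_oplus le_oplus')

lemma one_notin_prime: "mv_prime_ideal A P \<Longrightarrow> \<sim> \<zero> \<notin> P"
  unfolding mv_prime_ideal_def using ideal_le ideal_subset le_one by (metis subsetI subset_antisym)

lemma prime_meet_iff:
  "\<lbrakk>mv_prime_ideal A P; x \<in> carrier A; y \<in> carrier A\<rbrakk> \<Longrightarrow> x \<sqinter> y \<in> P \<longleftrightarrow> x \<in> P \<or> y \<in> P"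
  unfolding mv_prime_ideal_def by (meson ideal_le meet_closed meet_le)

abbreviation osum :: "'a list \<Rightarrow> 'a" where "osum xs \<equiv> foldr (\<oplus>) xs \<zero>"

lemma osum_closed [simp]: "set xs \<subseteq> carrier A \<Longrightarrow> osum xs \<in> carrier A"
  by (induction xs) auto

lemma osum_append: "\<lbrakk>set xs \<subseteq> carrier A; set ys \<subseteq> carrier A\<rbrakk> \<Longrightarrow> osum (xs @ ys) = osum xs \<oplus> osum ys"
  by (induction xs) (auto simp: oplus_assoc)

text \<open>Lists rather than finite sets: \<open>\<oplus>\<close> is not idempotent, so repeated
  summands matter. The empty list contributes zero.\<close>

definition generated_ideal :: "'a set \<Rightarrow> 'a set" where
  "generated_ideal B = {y \<in> carrier A. \<exists>xs. set xs \<subseteq> B \<and> y \<preceq> osum xs}"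

lemma mv_ideal_generated_ideal:
  assumes B: "B \<subseteq> carrier A"
  shows "mv_ideal A (generated_ideal B)"
  unfolding mv_ideal_def
proof (intro conjI ballI impI)
  have "\<zero> \<in> generated_ideal B"
    by (auto simp: generated_ideal_def intro: exI[of _ "[]"])
  then show "generated_ideal B \<noteq> {}" by blast
next
  fix x y assume "x \<in> generated_ideal B" "y \<in> generated_ideal B"
  then obtain xs ys where *: "x \<in> carrier A" "y \<in> carrier A" "set xs \<subseteq> B" "set ys \<subseteq> B"
    "x \<preceq> osum xs" "y \<preceq> osum ys"
    by (auto simp: generated_ideal_def)
  then have "set xs \<subseteq> carrier A" "set ys \<subseteq> carrier A"
    using B by auto
  with * have "x \<oplus> y \<preceq> osum (xs @ ys)"
    by (simp only: osum_append) (intro oplus_mono; simp)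
  with * show "x \<oplus> y \<in> generated_ideal B"
    by (auto simp: generated_ideal_def intro!: exI[of _ "xs @ ys"])
next
  fix x y assume "x \<in> generated_ideal B" "y \<in> carrier A" "y \<preceq> x"
  then show "y \<in> generated_ideal B"
    using B by (auto simp: generated_ideal_def) (meson le_trans osum_closed subset_trans)
qed (auto simp: generated_ideal_def)

lemma generated_ideal_superset:
  assumes "B \<subseteq> carrier A"
  shows "B \<subseteq> generated_ideal B"
proof
  fix x assume "x \<in> B"
  then show "x \<in> generated_ideal B"
    using assms by (auto simp: generated_ideal_def intro!: exI[of _ "[x]"])
qed

text \<open>Induction along the list by \<open>meet_oplus_le\<close>.\<close>

lemma osum_meet_in_ideal:
  assumes I: "mv_ideal A I" and "set xs \<subseteq> carrier A" "z \<in> carrier A" "\<And>x. x \<in> set xs \<Longrightarrow> x \<sqinter> z \<in> I"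
  shows "osum xs \<sqinter> z \<in> I"
  using assms(2-)
proof (induction xs)
  case Nil
  then show ?case
    by (simp add: meet_absorb zero_in_ideal[OF I])
next
  case (Cons x xs)
  then have "(x \<sqinter> z) \<oplus> (osum xs \<sqinter> z) \<in> I"
    by (intro ideal_oplus[OF I]) auto
  then show ?case
    using Cons.prems by (auto intro: ideal_le[OF I _ meet_oplus_le])
qed

text \<open>Zorn's lemma gives an ideal \<open>M\<close> maximal among those that contain
  \<open>I\<close> and omit \<open>a\<close>. If \<open>x\<close> and \<open>y\<close> lay outside
  \<open>M\<close>, then \<open>a\<close> would be below a sum over \<open>M\<close> and
  \<open>x\<close> and below a sum over \<open>M\<close> and \<open>y\<close>. When the meet of
  \<open>x\<close> and \<open>y\<close> is in \<open>M\<close>, so are all meets of summands, and by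
  \<open>osum_meet_in_ideal\<close>, applied to each list in turn, so is the meet of the two sums,
  which bounds \<open>a\<close>.\<close>

theorem prime_ideal_theorem:
  assumes I: "mv_ideal A I" and a: "a \<in> carrier A" "a \<notin> I"
  obtains P where "mv_prime_ideal A P" "I \<subseteq> P" "a \<notin> P"
proof -
  define F where "F = {J. mv_ideal A J \<and> I \<subseteq> J \<and> a \<notin> J}"
  have "\<exists>M\<in>F. \<forall>X\<in>F. M \<subseteq> X \<longrightarrow> X = M"
  proof (rule subset_Zorn_nonempty)
    show "F \<noteq> {}" using I a by (auto simp: F_def)
    fix \<C> assume \<C>: "\<C> \<noteq> {}" "subset.chain F \<C>"
    then have sub: "\<And>J. J \<in> \<C> \<Longrightarrow> mv_ideal A J \<and> I \<subseteq> J \<and> a \<notin> J"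
      by (auto simp: subset.chain_def F_def)
    have "mv_ideal A (\<Union>\<C>)"
      unfolding mv_ideal_def
    proof (intro conjI ballI impI)
      show "\<Union>\<C> \<subseteq> carrier A" using sub ideal_subset by blast
      show "\<Union>\<C> \<noteq> {}" using \<C>(1) sub zero_in_ideal by blast
      show "y \<in> \<Union>\<C>" if "x \<in> \<Union>\<C>" "y \<in> carrier A" "y \<preceq> x" for x y
        using that sub ideal_le by blast
      fix x y assume "x \<in> \<Union>\<C>" "y \<in> \<Union>\<C>"
      then obtain J J' where J: "x \<in> J" "y \<in> J'" "J \<in> \<C>" "J' \<in> \<C>" by blast
      then have "J \<subseteq> J' \<or> J' \<subseteq> J"
        using \<C>(2) by (auto simp: subset.chain_def)
      then show "x \<oplus> y \<in> \<Union>\<C>"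
        using J sub ideal_oplus by (metis UnionI subsetD)
    qed
    then show "\<Union>\<C> \<in> F"
      using \<C>(1) sub by (auto simp: F_def)
  qed
  then obtain M where M: "mv_ideal A M" "I \<subseteq> M" "a \<notin> M"
    and max: "\<And>J. \<lbrakk>mv_ideal A J; I \<subseteq> J; a \<notin> J; M \<subseteq> J\<rbrakk> \<Longrightarrow> J = M"
    by (auto simp: F_def)
  have MC: "M \<subseteq> carrier A" using M ideal_subset by blast
  have gen: "\<exists>xs. set xs \<subseteq> insert x M \<and> a \<preceq> osum xs" if "x \<in> carrier A" "x \<notin> M" for x
  proof (rule ccontr)
    assume no: "\<not> ?thesis"
    have B: "insert x M \<subseteq> carrier A" using that MC by auto
    have "a \<notin> generated_ideal (insert x M)"
      using no by (auto simp: generated_ideal_def)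
    then have "generated_ideal (insert x M) = M"
      using M(2) generated_ideal_superset[OF B] by (intro max mv_ideal_generated_ideal B) auto
    then show False
      using generated_ideal_superset[OF B] that by auto
  qed
  have "mv_prime_ideal A M"
    unfolding mv_prime_ideal_def
  proof (intro conjI ballI impI M(1))
    show "M \<noteq> carrier A" using M(3) a(1) by blast
    fix x y assume xy: "x \<in> carrier A" "y \<in> carrier A" "x \<sqinter> y \<in> M"
    show "x \<in> M \<or> y \<in> M"
    proof (rule ccontr)
      assume "\<not> ?thesis"
      then obtain xs ys where s: "set xs \<subseteq> insert x M" "a \<preceq> osum xs" "set ys \<subseteq> insert y M" "a \<preceq> osum ys"
        using gen xy by meson
      have C: "set xs \<subseteq> carrier A" "set ys \<subseteq> carrier A"
        using s xy MC by auto
      have "u \<sqinter> v \<in> M" if "u \<in> set xs" "v \<in> set ys" for u v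
      proof -
        have "u \<in> M \<or> v \<in> M \<or> u \<sqinter> v = x \<sqinter> y"
          using that s by blast
        then show ?thesis
          using that C xy meet_le[of u v] ideal_le[OF M(1)] by (metis meet_closed subsetD)
      qed
      then have "v \<sqinter> osum xs \<in> M" if "v \<in> set ys" for v
        using that C osum_meet_in_ideal[OF M(1), of xs v] meet_comm[of v "osum xs"] by (auto simp: subset_iff)
      then have "osum ys \<sqinter> osum xs \<in> M"
        using C by (intro osum_meet_in_ideal[OF M(1)]) auto
      moreover have "a \<preceq> osum ys \<sqinter> osum xs"
        using C s a by (intro meet_greatest) auto
      ultimately show False
        using M a ideal_le by blast
    qed
  qed
  with M that show ?thesis by blast
qed

text \<open>Factor by the congruence that both differences lie in \<open>P\<close>. Linearity holds
  because the meet of the two differences is zero by \<open>prelinear\<close>, so primeness puts one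
  of them into \<open>P\<close>.\<close>

lemma quotient_chain:
  assumes P: "mv_prime_ideal A P"
  obtains B :: "'a mv_algebra" and h where "mv_algebra B" "mv_hom A B h"
    "\<And>x y. \<lbrakk>x \<in> carrier B; y \<in> carrier B\<rbrakk> \<Longrightarrow> mv_le B x y \<or> mv_le B y x"
    "\<And>x. x \<in> carrier A \<Longrightarrow> h x = \<zero>\<^bsub>B\<^esub> \<longleftrightarrow> x \<in> P"
proof -
  have I: "mv_ideal A P" using P by (simp add: mv_prime_ideal_def)
  define eqv where "eqv x y \<longleftrightarrow> x \<in> carrier A \<and> y \<in> carrier A \<and> x \<ominus> y \<in> P \<and> y \<ominus> x \<in> P" for x y
  have eqv_refl: "eqv x x" if "x \<in> carrier A" for x
    using that zero_in_ideal[OF I] by (simp add: eqv_def)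
  have eqv_sym: "eqv y x" if "eqv x y" for x y
    using that by (auto simp: eqv_def)
  \<comment> \<open>The triangle inequality for truncated differences; it gives transitivity of the
    congruence.\<close>
  have triangle: "x \<ominus> z \<preceq> (x \<ominus> y) \<oplus> (y \<ominus> z)" if C: "x \<in> carrier A" "y \<in> carrier A" "z \<in> carrier A" for x y z
  proof -
    have "x \<preceq> (x \<ominus> y) \<oplus> y"
      using C le_oplus_dif[of x y] by (simp add: oplus_comm)
    moreover have "(x \<ominus> y) \<oplus> y \<preceq> (x \<ominus> y) \<oplus> (z \<oplus> (y \<ominus> z))"
      using C by (intro oplus_mono_right le_oplus_dif) auto
    ultimately have "x \<preceq> (x \<ominus> y) \<oplus> (z \<oplus> (y \<ominus> z))"
      using C by (meson le_trans neg_closed oplus_closed)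
    then show ?thesis
      using C by (simp add: dif_le_iff oplus_left_comm)
  qed
  have eqv_trans: "eqv x z" if xy: "eqv x y" and yz: "eqv y z" for x y z
  proof -
    have "(x \<ominus> y) \<oplus> (y \<ominus> z) \<in> P" "(z \<ominus> y) \<oplus> (y \<ominus> x) \<in> P"
      using xy yz by (auto simp: eqv_def intro: ideal_oplus[OF I])
    then show ?thesis
      using xy yz ideal_le[OF I _ triangle] unfolding eqv_def by (meson neg_closed oplus_closed)
  qed
  have eqv_neg: "eqv (\<sim> x) (\<sim> y)" if "eqv x y" for x y
    using that by (simp add: eqv_def) (metis neg_closed oplus_comm)
  have dif_oplus: "(x \<oplus> y) \<ominus> (x' \<oplus> y') \<preceq> (x \<ominus> x') \<oplus> (y \<ominus> y')"
    if C: "x \<in> carrier A" "y \<in> carrier A" "x' \<in> carrier A" "y' \<in> carrier A" for x y x' y'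
  proof -
    have "x \<oplus> y \<preceq> (x' \<oplus> (x \<ominus> x')) \<oplus> (y' \<oplus> (y \<ominus> y'))"
      using C by (intro oplus_mono le_oplus_dif) auto
    then show ?thesis
      using C by (subst dif_le_iff) (simp_all add: oplus_assoc oplus_left_comm)
  qed
  have eqv_oplus: "eqv (x \<oplus> y) (x' \<oplus> y')" if xx: "eqv x x'" and yy: "eqv y y'" for x y x' y'
  proof -
    have "(x \<ominus> x') \<oplus> (y \<ominus> y') \<in> P" "(x' \<ominus> x) \<oplus> (y' \<ominus> y) \<in> P"
      using xx yy by (auto simp: eqv_def intro: ideal_oplus[OF I])
    then show ?thesis
      using xx yy ideal_le[OF I _ dif_oplus] unfolding eqv_def by (meson neg_closed oplus_closed)
  qed
  \<comment> \<open>One representative is chosen per class, so the quotient lives on the same type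
    as the algebra.\<close>
  define r where "r x = (SOME y. eqv x y)" for x
  have r: "eqv x (r x)" if "x \<in> carrier A" for x
    unfolding r_def using eqv_refl[OF that] by (rule someI)
  have r_eq: "r x = r y" if "eqv x y" for x y
  proof -
    have "eqv x = eqv y" using that eqv_sym eqv_trans by blast
    then show ?thesis by (simp add: r_def)
  qed
  have r_closed [simp]: "r x \<in> carrier A" if "x \<in> carrier A" for x
    using r[OF that] by (simp add: eqv_def)
  have r_oplus1 [simp]: "r (r x \<oplus> y) = r (x \<oplus> y)" if "x \<in> carrier A" "y \<in> carrier A" for x y
    using that by (intro r_eq eqv_oplus eqv_refl eqv_sym[OF r])
  have r_oplus2 [simp]: "r (y \<oplus> r x) = r (y \<oplus> x)" if "x \<in> carrier A" "y \<in> carrier A" for x y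
    using that by (intro r_eq eqv_oplus eqv_refl eqv_sym[OF r])
  have r_neg [simp]: "r (\<sim> r x) = r (\<sim> x)" if "x \<in> carrier A" for x
    using that by (intro r_eq eqv_neg eqv_sym[OF r])
  have r_r [simp]: "r (r x) = r x" if "x \<in> carrier A" for x
    using that by (intro r_eq eqv_sym[OF r])
  define B where "B = \<lparr>carrier = r ` carrier A, oplus = (\<lambda>x y. r (x \<oplus> y)), zero = r \<zero>,
    neg = (\<lambda>x. r (\<sim> x))\<rparr>"
  have B_simps [simp]: "carrier B = r ` carrier A" "x \<oplus>\<^bsub>B\<^esub> y = r (x \<oplus> y)" "\<zero>\<^bsub>B\<^esub> = r \<zero>"
    "\<sim>\<^bsub>B\<^esub> x = r (\<sim> x)" for x y
    by (simp_all add: B_def)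
  show ?thesis
  proof (rule that[of B r])
    show alg: "mv_algebra B"
    proof unfold_locales
      fix x y assume "x \<in> carrier B" "y \<in> carrier B"
      then obtain x' y' where [simp]: "x = r x'" "y = r y'" "x' \<in> carrier A" "y' \<in> carrier A" by auto
      show "\<sim>\<^bsub>B\<^esub> (\<sim>\<^bsub>B\<^esub> x \<oplus>\<^bsub>B\<^esub> y) \<oplus>\<^bsub>B\<^esub> y = \<sim>\<^bsub>B\<^esub> (\<sim>\<^bsub>B\<^esub> y \<oplus>\<^bsub>B\<^esub> x) \<oplus>\<^bsub>B\<^esub> x"
        by (simp add: lukasiewicz)
    qed (auto simp: oplus_assoc, metis oplus_comm)
    then interpret B: mv_algebra B .
    show "mv_hom A B r"
      by (auto simp: mv_hom_def)
    show "mv_le B x y \<or> mv_le B y x" if xy: "x \<in> carrier B" "y \<in> carrier B" for x y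
    proof -
      obtain x' y' where *: "x = r x'" "y = r y'" "x' \<in> carrier A" "y' \<in> carrier A"
        using xy by auto
      have le: "mv_le B (r u) (r v)" if "u \<ominus> v \<in> P" "u \<in> carrier A" "v \<in> carrier A" for u v
      proof -
        have "eqv (\<sim> u \<oplus> v) (\<sim> \<zero>)"
          using that by (simp add: eqv_def zero_in_ideal[OF I])
        then show ?thesis
          using that by (simp add: B.le_iff r_eq)
      qed
      have "x' \<ominus> y' \<in> P \<or> y' \<ominus> x' \<in> P"
        using * prime_meet_iff[OF P, of "x' \<ominus> y'" "y' \<ominus> x'"] prelinear[of x' y'] zero_in_ideal[OF I]
        by simp
      then show ?thesis
        using le * by blast
    qed
    show "r x = \<zero>\<^bsub>B\<^esub> \<longleftrightarrow> x \<in> P" if "x \<in> carrier A" for x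
    proof -
      have "r x = r \<zero> \<longleftrightarrow> eqv x \<zero>"
        by (metis eqv_sym eqv_trans r r_eq that zero_closed)
      then show ?thesis
        using that zero_in_ideal[OF I] by (simp add: eqv_def)
    qed
  qed
qed

end


section \<open>The Chang group of an MV-chain\<close>

context mv_algebra
begin

abbreviation times (infixl "\<odot>" 70) where "x \<odot> y \<equiv> \<sim> (\<sim> x \<oplus> \<sim> y)"

lemma times_le: "\<lbrakk>x \<in> carrier A; y \<in> carrier A\<rbrakk> \<Longrightarrow> x \<odot> y \<preceq> x" "\<lbrakk>x \<in> carrier A; y \<in> carrier A\<rbrakk> \<Longrightarrow> x \<odot> y \<preceq> y"
  using neg_le_iff[of "\<sim> x \<oplus> \<sim> y" "\<sim> x"] neg_le_iff[of "\<sim> x \<oplus> \<sim> y" "\<sim> y"] by auto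

lemma one_le_iff: "x \<in> carrier A \<Longrightarrow> \<sim> \<zero> \<preceq> x \<longleftrightarrow> x = \<sim> \<zero>"
  by (simp add: le_iff)

lemma oplus_eq_zero_iff: "\<lbrakk>x \<in> carrier A; y \<in> carrier A\<rbrakk> \<Longrightarrow> x \<oplus> y = \<zero> \<longleftrightarrow> x = \<zero> \<and> y = \<zero>"
  by (metis le_antisym le_oplus oplus_comm zero_closed zero_le zero_oplus)

lemma times_eq_zero_iff: "\<lbrakk>x \<in> carrier A; y \<in> carrier A\<rbrakk> \<Longrightarrow> x \<odot> y = \<zero> \<longleftrightarrow> x \<preceq> \<sim> y"
  by (simp add: le_iff) (metis neg_closed neg_neg oplus_closed zero_closed)

lemma oplus_eq_one_iff: "\<lbrakk>x \<in> carrier A; y \<in> carrier A\<rbrakk> \<Longrightarrow> x \<oplus> y = \<sim> \<zero> \<longleftrightarrow> \<sim> x \<preceq> y"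
  by (simp add: le_iff)

lemma dif_oplus: "\<lbrakk>x \<in> carrier A; y \<in> carrier A; z \<in> carrier A\<rbrakk> \<Longrightarrow> x \<ominus> (y \<oplus> z) = (x \<ominus> y) \<ominus> z"
  by (simp add: oplus_assoc)

text \<open>In terms of numbers, neither \<open>x + y\<close> nor \<open>y + z\<close> exceeds the
  unit, and both sides are \<open>x + y + z - 1\<close> truncated at zero.\<close>

lemma oplus_times_assoc:
  assumes C: "x \<in> carrier A" "y \<in> carrier A" "z \<in> carrier A" and "x \<odot> y = \<zero>" "y \<odot> z = \<zero>"
  shows "(x \<oplus> y) \<odot> z = x \<odot> (y \<oplus> z)"
proof -
  define d where "d = \<sim> z \<ominus> y"
  have d: "d \<in> carrier A" "y \<oplus> d = \<sim> z"
    using assms dif_oplus_cancel[of y "\<sim> z"] by (auto simp: d_def times_eq_zero_iff oplus_comm)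
  have "(x \<oplus> y) \<ominus> y = x"
    using assms meet_eq[of x "\<sim> y"] meet_absorb[of x "\<sim> y"] by (simp add: times_eq_zero_iff)
  then have "(x \<oplus> y) \<ominus> (y \<oplus> d) = x \<ominus> d"
    using C d by (subst dif_oplus) auto
  moreover have "d = \<sim> (y \<oplus> z)"
    using C by (simp add: d_def oplus_comm)
  ultimately show ?thesis
    using d by simp
qed

text \<open>In terms of numbers, \<open>x + y \<le> 1 \<le> y + z\<close>, so both sides are
  \<open>x + y + z - 1\<close>, which already lies between zero and one.\<close>

lemma oplus_times_assoc':
  assumes C: "x \<in> carrier A" "y \<in> carrier A" "z \<in> carrier A" and "x \<odot> y = \<zero>" "y \<oplus> z = \<sim> \<zero>"
  shows "(x \<oplus> y) \<odot> z = x \<oplus> (y \<odot> z)"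
proof -
  define e where "e = y \<odot> z"
  have e: "e \<in> carrier A" "y = e \<oplus> \<sim> z"
    using assms dif_oplus_cancel[of "\<sim> z" y] oplus_eq_one_iff[of z y]
    by (auto simp: e_def oplus_comm)
  have "e \<preceq> z"
    using C by (simp add: e_def times_le)
  then have z: "(z \<ominus> e) \<oplus> e = z"
    using C e(1) by (intro dif_oplus_cancel)
  have "x \<preceq> \<sim> y"
    using assms by (simp add: times_eq_zero_iff)
  also have "\<sim> y = z \<ominus> e"
    using C e by (metis neg_closed oplus_comm)
  finally have "x \<oplus> e \<preceq> (z \<ominus> e) \<oplus> e"
    using C e(1) by (intro oplus_mono) auto
  then have "(x \<oplus> e) \<sqinter> z = x \<oplus> e"
    using C e(1) z by (intro meet_absorb) auto
  then have "((x \<oplus> e) \<oplus> \<sim> z) \<ominus> \<sim> z = x \<oplus> e"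
    using C e(1) by (simp add: meet_eq)
  moreover have "(x \<oplus> e) \<oplus> \<sim> z = x \<oplus> y"
    using C e by (metis neg_closed oplus_assoc)
  ultimately show ?thesis
    by (simp add: e_def)
qed

end

locale mv_chain = mv_algebra +
  assumes total: "\<lbrakk>x \<in> carrier A; y \<in> carrier A\<rbrakk> \<Longrightarrow> x \<preceq> y \<or> y \<preceq> x"
    and zero_neq_one: "\<zero> \<noteq> \<sim> \<zero>"
begin

text \<open>Compare \<open>x\<close> with \<open>\<sim> y\<close>: the sum reaches the unit or stays
  within it. Both alternatives hold when \<open>x = \<sim> y\<close>.\<close>

lemma oplus_eq_one_or_times_eq_zero:
  "\<lbrakk>x \<in> carrier A; y \<in> carrier A\<rbrakk> \<Longrightarrow> x \<oplus> y = \<sim> \<zero> \<or> x \<odot> y = \<zero>"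
  using total[of x "\<sim> y"] neg_le_iff[of x "\<sim> y"]
  by (metis le_iff neg_closed neg_neg oplus_comm times_eq_zero_iff)

definition proper :: "'a set" where
  "proper = carrier A - {\<sim> \<zero>}"

text \<open>Addition of fractional parts as in positional arithmetic. A sum equal to the unit
  already carries, so that fractional parts stay strictly below the unit.\<close>

definition carry :: "'a \<Rightarrow> 'a \<Rightarrow> int" where
  "carry x y = (if x \<oplus> y = \<sim> \<zero> then 1 else 0)"

definition frac_add :: "'a \<Rightarrow> 'a \<Rightarrow> 'a" where
  "frac_add x y = (if x \<oplus> y = \<sim> \<zero> then x \<odot> y else x \<oplus> y)"

text \<open>
  Chang's group: the pair \<open>(m, x)\<close> stands for \<open>m u + x\<close>, where \<open>u\<close> is the strong unit and \<open>x < u\<close>;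
  nonnegative elements are those with \<open>m \<ge> 0\<close>.
\<close>

definition chang_group :: "(int \<times> 'a) monoid" where
  "chang_group = \<lparr>partial_object.carrier = UNIV \<times> proper,
    monoid.mult = (\<lambda>(m, x) (n, y). (m + n + carry x y, frac_add x y)), one = (0, \<zero>)\<rparr>"

lemma times_in_proper: "\<lbrakk>x \<in> proper; y \<in> carrier A\<rbrakk> \<Longrightarrow> x \<odot> y \<in> proper"
  unfolding proper_def using times_le[of x y] one_le_iff[of x] by auto

lemma frac_add_proper: "\<lbrakk>x \<in> proper; y \<in> proper\<rbrakk> \<Longrightarrow> frac_add x y \<in> proper"
  using times_in_proper[of x y] by (auto simp: frac_add_def proper_def)

lemma carry_frac_add_comm:
  "\<lbrakk>x \<in> carrier A; y \<in> carrier A\<rbrakk> \<Longrightarrow> carry x y = carry y x \<and> frac_add x y = frac_add y x"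
  by (simp add: carry_def frac_add_def oplus_comm)

text \<open>Exactly one carry occurs in either bracketing: on the left in the second addition, on
  the right in the first one, because the final sum is a product below \<open>x \<oplus> y\<close>,
  which is not the unit.\<close>

lemma carry_frac_add_assoc_aux:
  assumes p: "x \<in> proper" "y \<in> proper" "z \<in> proper" and "x \<oplus> y \<noteq> \<sim> \<zero>" "y \<oplus> z = \<sim> \<zero>"
  shows "carry x y + carry (frac_add x y) z = carry y z + carry x (frac_add y z) \<and>
    frac_add (frac_add x y) z = frac_add x (frac_add y z)"
proof -
  have C: "x \<in> carrier A" "y \<in> carrier A" "z \<in> carrier A" using p by (auto simp: proper_def)
  have xy: "x \<odot> y = \<zero>" using oplus_eq_one_or_times_eq_zero C assms by blast
  have eq: "(x \<oplus> y) \<odot> z = x \<oplus> (y \<odot> z)"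
    using C xy assms by (intro oplus_times_assoc')
  have "x \<oplus> y \<in> proper" using C assms by (simp add: proper_def)
  then have "(x \<oplus> y) \<odot> z \<in> proper" using C by (intro times_in_proper)
  then have "x \<oplus> (y \<odot> z) \<noteq> \<sim> \<zero>" unfolding eq by (simp add: proper_def)
  moreover have "(x \<oplus> y) \<oplus> z = \<sim> \<zero>"
    using C assms by (simp add: oplus_assoc)
  ultimately show ?thesis
    using assms eq by (simp add: carry_def frac_add_def)
qed

lemma carry_frac_add_assoc:
  assumes p: "x \<in> proper" "y \<in> proper" "z \<in> proper"
  shows "carry x y + carry (frac_add x y) z = carry y z + carry x (frac_add y z) \<and>
    frac_add (frac_add x y) z = frac_add x (frac_add y z)"
proof -
  have C: "x \<in> carrier A" "y \<in> carrier A" "z \<in> carrier A" using p by (auto simp: proper_def)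
  note dich = oplus_eq_one_or_times_eq_zero
  consider "x \<oplus> y \<noteq> \<sim> \<zero>" "y \<oplus> z \<noteq> \<sim> \<zero>" | "x \<oplus> y \<noteq> \<sim> \<zero>" "y \<oplus> z = \<sim> \<zero>"
    | "x \<oplus> y = \<sim> \<zero>" "y \<oplus> z \<noteq> \<sim> \<zero>" | "x \<oplus> y = \<sim> \<zero>" "y \<oplus> z = \<sim> \<zero>" by blast
  then show ?thesis
  proof cases
    case 1
    then have "(x \<oplus> y) \<odot> z = x \<odot> (y \<oplus> z)"
      using C dich[of x y] dich[of y z] by (intro oplus_times_assoc) auto
    with 1 C show ?thesis by (simp add: carry_def frac_add_def oplus_assoc)
  next
    case 2
    with p show ?thesis by (rule carry_frac_add_assoc_aux)
  next
    case 3
    \<comment> \<open>The mirror image of the preceding case, read through commutativity.\<close>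
    then have "z \<oplus> y \<noteq> \<sim> \<zero>" "y \<oplus> x = \<sim> \<zero>" using C by (simp_all add: oplus_comm)
    note * = carry_frac_add_assoc_aux[OF p(3,2,1) this]
    have cl: "frac_add y x \<in> carrier A" "frac_add z y \<in> carrier A"
      using frac_add_proper p by (auto simp: proper_def)
    have "frac_add x y = frac_add y x" "carry x y = carry y x" "frac_add y z = frac_add z y"
      "carry y z = carry z y" "frac_add (frac_add y x) z = frac_add z (frac_add y x)"
      "carry (frac_add y x) z = carry z (frac_add y x)"
      "frac_add x (frac_add z y) = frac_add (frac_add z y) x"
      "carry x (frac_add z y) = carry (frac_add z y) x"
      using C cl carry_frac_add_comm by blast+
    with * show ?thesis by presburger
  next
    case 4
    \<comment> \<open>The dual of the first case: negation exchanges \<open>\<oplus>\<close> and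
      \<open>\<odot>\<close>, and a sum equal to one becomes a product equal to zero.\<close>
    have "(\<sim> x \<oplus> \<sim> y) \<odot> \<sim> z = \<sim> x \<odot> (\<sim> y \<oplus> \<sim> z)"
      using C 4 by (intro oplus_times_assoc) auto
    then have "(x \<odot> y) \<oplus> z = x \<oplus> (y \<odot> z)"
      using C by (simp add: neg_eq_iff)
    moreover have "(x \<odot> y) \<odot> z = x \<odot> (y \<odot> z)"
      using C by (simp add: oplus_assoc)
    ultimately show ?thesis
      using 4 by (simp add: carry_def frac_add_def)
  qed
qed

lemma zero_proper: "\<zero> \<in> proper"
  using zero_neq_one by (simp add: proper_def)

lemma chang_group_simps [simp]:
  "partial_object.carrier chang_group = UNIV \<times> proper"
  "(m, x) \<otimes>\<^bsub>chang_group\<^esub> (n, y) = (m + n + carry x y, frac_add x y)"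
  "\<one>\<^bsub>chang_group\<^esub> = (0, \<zero>)"
  by (simp_all add: chang_group_def)

lemma carry_zero: "x \<in> proper \<Longrightarrow> carry \<zero> x = 0" "x \<in> proper \<Longrightarrow> carry x \<zero> = 0"
  by (auto simp: carry_def proper_def)

lemma frac_add_zero: "x \<in> proper \<Longrightarrow> frac_add \<zero> x = x" "x \<in> proper \<Longrightarrow> frac_add x \<zero> = x"
  by (auto simp: frac_add_def proper_def)

lemma comm_group_chang_group: "comm_group chang_group"
proof (rule comm_groupI)
  fix a assume "a \<in> partial_object.carrier chang_group"
  then obtain m x where a: "a = (m, x)" "x \<in> proper" by auto
  show "\<exists>b\<in>partial_object.carrier chang_group. b \<otimes>\<^bsub>chang_group\<^esub> a = \<one>\<^bsub>chang_group\<^esub>"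
  proof (cases "x = \<zero>")
    case True
    then show ?thesis
      using a by (intro bexI[of _ "(- m, \<zero>)"]) (simp_all add: carry_zero frac_add_zero)
  next
    case False
    then have "\<sim> x \<in> proper"
      using a(2) neg_eq_iff[of x \<zero>] by (simp add: proper_def)
    moreover have "carry (\<sim> x) x = 1" "frac_add (\<sim> x) x = \<zero>"
      using a(2) by (auto simp: carry_def frac_add_def proper_def)
    \<comment> \<open>A fraction and its complement add up to one carry, which the extra
      \<open>- 1\<close> compensates.\<close>
    ultimately show ?thesis
      using a by (intro bexI[of _ "(- m - 1, \<sim> x)"]) simp_all
  qed
next
  fix a b assume "a \<in> partial_object.carrier chang_group" "b \<in> partial_object.carrier chang_group"
  then show "a \<otimes>\<^bsub>chang_group\<^esub> b \<in> partial_object.carrier chang_group"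
    by (auto simp: frac_add_proper)
next
  fix a b c
  assume "a \<in> partial_object.carrier chang_group" "b \<in> partial_object.carrier chang_group"
    "c \<in> partial_object.carrier chang_group"
  then obtain m x n y k z where "a = (m, x)" "b = (n, y)" "c = (k, z)" "x \<in> proper" "y \<in> proper" "z \<in> proper"
    by auto
  then show "a \<otimes>\<^bsub>chang_group\<^esub> b \<otimes>\<^bsub>chang_group\<^esub> c = a \<otimes>\<^bsub>chang_group\<^esub> (b \<otimes>\<^bsub>chang_group\<^esub> c)"
    using carry_frac_add_assoc[of x y z] by simp
next
  fix a b assume "a \<in> partial_object.carrier chang_group" "b \<in> partial_object.carrier chang_group"
  then obtain m x n y where ab: "a = (m, x)" "b = (n, y)" "x \<in> carrier A" "y \<in> carrier A"
    by (auto simp: proper_def)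
  have "carry x y = carry y x" "frac_add x y = frac_add y x"
    using ab carry_frac_add_comm by blast+
  then show "a \<otimes>\<^bsub>chang_group\<^esub> b = b \<otimes>\<^bsub>chang_group\<^esub> a"
    unfolding ab(1,2) chang_group_simps by simp
qed (auto simp: zero_proper carry_zero frac_add_zero)

sublocale chang: comm_group chang_group
  by (rule comm_group_chang_group)

text \<open>The top element is not a fractional part; it becomes the strong unit, one whole with
  fraction zero.\<close>

definition embed :: "'a \<Rightarrow> int \<times> 'a" where
  "embed x = (if x = \<sim> \<zero> then (1, \<zero>) else (0, x))"

lemma embed_closed: "x \<in> carrier A \<Longrightarrow> embed x \<in> UNIV \<times> proper"
  using zero_proper by (auto simp: embed_def proper_def)

lemma fst_embed: "0 \<le> fst (embed x)"
  by (simp add: embed_def)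

lemma embed_eq_one_iff: "embed x = \<one>\<^bsub>chang_group\<^esub> \<longleftrightarrow> x = \<zero>"
  using zero_neq_one by (auto simp: embed_def)

text \<open>The vanishing product says that the truncated sum is the true sum; in the borderline
  case where it equals one, the remaining fraction is that product.\<close>

lemma embed_oplus:
  assumes C: "x \<in> carrier A" "y \<in> carrier A" and "x \<odot> y = \<zero>"
  shows "embed (x \<oplus> y) = embed x \<otimes>\<^bsub>chang_group\<^esub> embed y"
proof -
  consider "x = \<sim> \<zero>" | "y = \<sim> \<zero>" | "x \<in> proper" "y \<in> proper" "x \<noteq> \<sim> \<zero>" "y \<noteq> \<sim> \<zero>"
    using C by (auto simp: proper_def)
  then show ?thesis
  proof cases
    case 1
    with assms have "y = \<zero>" by simp
    with 1 show ?thesis using zero_proper zero_neq_one by (simp add: embed_def carry_zero frac_add_zero)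
  next
    case 2
    with assms have "x = \<zero>" by simp
    with 2 show ?thesis using zero_proper zero_neq_one by (simp add: embed_def carry_zero frac_add_zero)
  next
    case 3
    then show ?thesis using assms by (auto simp: embed_def carry_def frac_add_def)
  qed
qed

lemma embed_oplus_eq_one:
  assumes C: "x \<in> carrier A" "y \<in> carrier A" and "x \<oplus> y = \<sim> \<zero>"
  shows "1 \<le> fst (embed x \<otimes>\<^bsub>chang_group\<^esub> embed y)"
  using assms by (auto simp: embed_def carry_def)

lemma embed_neg:
  assumes "x \<in> carrier A"
  shows "embed x \<otimes>\<^bsub>chang_group\<^esub> embed (\<sim> x) = (1, \<zero>)"
  using assms embed_oplus[of x "\<sim> x"] by (simp add: embed_def)

lemma fst_mult_nonneg:
  assumes "0 \<le> fst a" "0 \<le> fst b"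
  shows "0 \<le> fst (a \<otimes>\<^bsub>chang_group\<^esub> b)"
  using assms by (cases a; cases b) (simp add: carry_def)

text \<open>Antisymmetry of the order: with nonnegative integer parts, a total of zero forbids any
  carry, and then both fractions vanish by \<open>oplus_eq_zero_iff\<close>.\<close>

lemma nonneg_mult_eq_one:
  assumes "a \<in> UNIV \<times> proper" "b \<in> UNIV \<times> proper" "0 \<le> fst a" "0 \<le> fst b"
    "a \<otimes>\<^bsub>chang_group\<^esub> b = \<one>\<^bsub>chang_group\<^esub>"
  shows "a = \<one>\<^bsub>chang_group\<^esub>"
  using assms by (cases a; cases b) (auto simp: carry_def frac_add_def proper_def oplus_eq_zero_iff split: if_splits)

text \<open>The counterpart of \<open>lin\<close> in Chang's group, whose operation is written
  multiplicatively, so integer multiples appear as powers.\<close>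

definition form_value :: "'v set \<Rightarrow> ('v \<Rightarrow> int \<times> 'a) \<Rightarrow> ('v \<Rightarrow> int) \<Rightarrow> int \<times> 'a" where
  "form_value V \<gamma> c = finprod chang_group (\<lambda>v. \<gamma> v [^]\<^bsub>chang_group\<^esub> c v) V"

context
  fixes V :: "'v set" and \<gamma> :: "'v \<Rightarrow> int \<times> 'a"
  assumes \<gamma>: "\<And>v. v \<in> V \<Longrightarrow> \<gamma> v \<in> UNIV \<times> proper" and V: "finite V"
begin

lemma in_chang_group: "v \<in> V \<Longrightarrow> \<gamma> v \<in> partial_object.carrier chang_group"
  using \<gamma> by simp

lemma form_value_closed: "form_value V \<gamma> c \<in> UNIV \<times> proper"
proof -
  have "form_value V \<gamma> c \<in> partial_object.carrier chang_group"
    unfolding form_value_def using \<gamma> by (intro chang.finprod_closed Pi_I chang.int_pow_closed) simp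
  then show ?thesis by simp
qed

lemma form_value_add: "form_value V \<gamma> (\<lambda>w. c w + d w) = form_value V \<gamma> c \<otimes>\<^bsub>chang_group\<^esub> form_value V \<gamma> d"
proof -
  have "form_value V \<gamma> (\<lambda>w. c w + d w) =
      finprod chang_group (\<lambda>v. \<gamma> v [^]\<^bsub>chang_group\<^esub> c v \<otimes>\<^bsub>chang_group\<^esub> \<gamma> v [^]\<^bsub>chang_group\<^esub> d v) V"
    unfolding form_value_def by (intro chang.finprod_cong') (auto simp: chang.int_pow_mult in_chang_group simp del: chang_group_simps)
  also have "\<dots> = form_value V \<gamma> c \<otimes>\<^bsub>chang_group\<^esub> form_value V \<gamma> d"
    unfolding form_value_def using \<gamma> by (intro chang.finprod_multf Pi_I chang.int_pow_closed) simp_all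
  finally show ?thesis .
qed

lemma form_value_zero: "form_value V \<gamma> (\<lambda>w. 0) = \<one>\<^bsub>chang_group\<^esub>"
  by (simp add: form_value_def del: chang_group_simps)

lemma form_value_single:
  assumes "v \<in> V"
  shows "form_value V \<gamma> (\<lambda>w. if w = v then 1 else 0) = \<gamma> v"
proof -
  have "form_value V \<gamma> (\<lambda>w. if w = v then 1 else 0) =
      finprod chang_group (\<lambda>w. if v = w then \<gamma> w else \<one>\<^bsub>chang_group\<^esub>) V"
    unfolding form_value_def by (intro chang.finprod_cong') (auto simp: in_chang_group simp del: chang_group_simps)
  also have "\<dots> = \<gamma> v"
    using \<gamma> assms V by (intro chang.finprod_singleton) auto
  finally show ?thesis .
qed

lemma form_value_cancel:
  assumes "form_value V \<gamma> (\<lambda>w. c w + d w) = a \<otimes>\<^bsub>chang_group\<^esub> form_value V \<gamma> d" "a \<in> UNIV \<times> proper"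
  shows "form_value V \<gamma> c = a"
  using assms form_value_closed form_value_add[of c d]
  by (simp del: chang_group_simps(2,3))

definition nonneg_forms :: "('v \<Rightarrow> int) set" where
  "nonneg_forms = {c. 0 \<le> fst (form_value V \<gamma> c)}"

lemma nonneg_forms_add: "\<lbrakk>c \<in> nonneg_forms; d \<in> nonneg_forms\<rbrakk> \<Longrightarrow> (\<lambda>w. c w + d w) \<in> nonneg_forms"
  by (simp add: nonneg_forms_def form_value_add fst_mult_nonneg)

text \<open>Supplies the strictness condition of \<open>rational_solution\<close>: a nonnegative,
  nonzero value has no nonnegative negative.\<close>

lemma nonneg_forms_strict:
  assumes "c \<in> nonneg_forms" "form_value V \<gamma> c \<noteq> \<one>\<^bsub>chang_group\<^esub>"
  shows "(\<lambda>w. - c w) \<notin> nonneg_forms"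
proof
  assume "(\<lambda>w. - c w) \<in> nonneg_forms"
  moreover have "form_value V \<gamma> c \<otimes>\<^bsub>chang_group\<^esub> form_value V \<gamma> (\<lambda>w. - c w) = \<one>\<^bsub>chang_group\<^esub>"
    using form_value_add[of c "\<lambda>w. - c w"] form_value_zero by simp
  ultimately have "form_value V \<gamma> c = \<one>\<^bsub>chang_group\<^esub>"
    using assms(1) by (intro nonneg_mult_eq_one[OF form_value_closed form_value_closed])
      (auto simp: nonneg_forms_def)
  with assms(2) show False by contradiction
qed

end

end


section \<open>Piecewise linear terms and completeness\<close>

definition unit_mv :: "real mv_algebra" where
  "unit_mv = \<lparr>carrier = {0..1}, oplus = (\<lambda>x y. min 1 (x + y)), zero = 0, neg = (\<lambda>x. 1 - x)\<rparr>"

lemma unit_mv_simps [simp]: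
  "carrier unit_mv = {0..1}" "x \<oplus>\<^bsub>unit_mv\<^esub> y = min 1 (x + y)" "\<zero>\<^bsub>unit_mv\<^esub> = 0" "\<sim>\<^bsub>unit_mv\<^esub> x = 1 - x"
  by (simp_all add: unit_mv_def)

lemma mv_algebra_unit_mv: "mv_algebra unit_mv"
  by unfold_locales (auto simp: min_def)

lemma mv_eval_unit_bounds:
  assumes "\<And>k. k \<in> mv_vars s \<Longrightarrow> v k \<in> {0..1}"
  shows "mv_eval unit_mv v s \<in> {0..1}"
  using mv_eval_closed[OF mv_algebra_unit_mv, of s v] assms by simp

lemma mv_eval_cong: "(\<And>k. k \<in> mv_vars s \<Longrightarrow> g k = g' k) \<Longrightarrow> mv_eval B g s = mv_eval B g' s"
  by (induction s) auto

lemma finite_mv_vars [simp]: "finite (mv_vars s)"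
  by (induction s) auto

section \<open>Terms as piecewise linear functions, over the reals and in Chang's group\<close>

definition unit_form :: "'v \<Rightarrow> 'v \<Rightarrow> int" where
  "unit_form v = (\<lambda>w. if w = v then 1 else 0)"

text \<open>The unit minus \<open>c\<close>. It serves both as the form of a negated term and, when
  required to be nonnegative, as the bound of \<open>c\<close> by the unit.\<close>

definition compl_form :: "('k option \<Rightarrow> int) \<Rightarrow> 'k option \<Rightarrow> int" where
  "compl_form c = (\<lambda>w. unit_form None w - c w)"

definition box_forms :: "'k set \<Rightarrow> ('k option \<Rightarrow> int) set" where
  "box_forms Y = (\<Union>k\<in>Y. {unit_form (Some k), compl_form (unit_form (Some k))})"

text \<open>
  The coordinate \<^const>\<open>None\<close> homogenizes: it stands for the constant \<open>1\<close>, or for the strong unit of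
  Chang's group. A branch \<open>(c, T)\<close> of a term says that the term equals the form \<open>c\<close> wherever the
  forms in \<open>T\<close> are nonnegative.
\<close>

primrec branches :: "'k mv_term \<Rightarrow> (('k option \<Rightarrow> int) \<times> ('k option \<Rightarrow> int) set) set" where
  "branches (Gen k) = {(unit_form (Some k), {})}"
| "branches Zero = {(\<lambda>w. 0, {})}"
| "branches (Neg s) = (\<lambda>(c, T). (compl_form c, T)) ` branches s"
| "branches (Oplus s t) = (\<Union>(c, T)\<in>branches s. \<Union>(d, U)\<in>branches t.
    {(\<lambda>w. c w + d w, insert (compl_form (\<lambda>w. c w + d w)) (T \<union> U)),
     (unit_form None, insert (\<lambda>w. c w + d w - unit_form None w) (T \<union> U))})"

lemma finite_branches: "finite (branches s)"
  by (induction s) (auto split: prod.split)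

lemma finite_branch: "(c, T) \<in> branches s \<Longrightarrow> finite T"
  by (induction s arbitrary: c T) auto

lemma branch_support:
  "(c, T) \<in> branches s \<Longrightarrow> d \<in> insert c T \<Longrightarrow> w \<notin> insert None (Some ` mv_vars s) \<Longrightarrow> d w = 0"
proof (induction s arbitrary: c T d)
  case (Neg s)
  then show ?case by (fastforce simp: compl_form_def unit_form_def)
next
  case (Oplus s t)
  then obtain c1 T1 c2 T2 where *: "(c1, T1) \<in> branches s" "(c2, T2) \<in> branches t"
    "d \<in> T1 \<union> T2 \<union> {\<lambda>w. c1 w + c2 w, compl_form (\<lambda>w. c1 w + c2 w), unit_form None,
      \<lambda>w. c1 w + c2 w - unit_form None w}"
    by auto
  have 1: "e w = 0" if "e \<in> insert c1 T1" for e
    using Oplus.IH(1)[OF *(1) that] Oplus.prems(3) by auto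
  have 2: "e w = 0" if "e \<in> insert c2 T2" for e
    using Oplus.IH(2)[OF *(2) that] Oplus.prems(3) by auto
  show ?case
    using *(3) Oplus.prems(3) 1[of d] 1[of c1] 2[of d] 2[of c2]
    by (auto simp: compl_form_def unit_form_def)
qed (auto simp: unit_form_def)

abbreviation coords :: "'k set \<Rightarrow> 'k option set" where
  "coords Y \<equiv> insert None (Some ` Y)"

lemma lin_unit_form: "finite V \<Longrightarrow> v \<in> V \<Longrightarrow> lin V (unit_form v) x = x v"
  using lin_single[of V v 1 x] by (simp add: unit_form_def)

lemma lin_compl_form: "finite Y \<Longrightarrow> lin (coords Y) (compl_form c) x = x None - lin (coords Y) c x"
  by (simp add: compl_form_def lin_diff lin_unit_form)

lemma branch_eval:
  assumes Y: "finite Y" and x: "x None = 1"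
  shows "mv_vars s \<subseteq> Y \<Longrightarrow> (c, T) \<in> branches s \<Longrightarrow> (\<And>d. d \<in> T \<Longrightarrow> 0 \<le> lin (coords Y) d x) \<Longrightarrow>
    mv_eval unit_mv (\<lambda>k. x (Some k)) s = lin (coords Y) c x"
proof (induction s arbitrary: c T)
  case (Gen k)
  then show ?case using Y by (simp add: lin_unit_form)
next
  case Zero
  then show ?case by (simp add: lin_zero)
next
  case (Neg s)
  then obtain d where d: "(d, T) \<in> branches s" "c = compl_form d" by auto
  have "mv_eval unit_mv (\<lambda>k. x (Some k)) s = lin (coords Y) d x"
    by (rule Neg.IH[OF _ d(1)]) (use Neg.prems in auto)
  then show ?case using d(2) Y x by (simp add: lin_compl_form)
next
  case (Oplus s t)
  then obtain c1 T1 c2 T2 where *: "(c1, T1) \<in> branches s" "(c2, T2) \<in> branches t" "T1 \<subseteq> T" "T2 \<subseteq> T" and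
    "c = (\<lambda>w. c1 w + c2 w) \<and> compl_form (\<lambda>w. c1 w + c2 w) \<in> T \<or>
      c = unit_form None \<and> (\<lambda>w. c1 w + c2 w - unit_form None w) \<in> T"
    by auto
  moreover have "mv_eval unit_mv (\<lambda>k. x (Some k)) s = lin (coords Y) c1 x"
    by (rule Oplus.IH(1)[OF _ *(1)]) (use Oplus.prems * in auto)
  moreover have "mv_eval unit_mv (\<lambda>k. x (Some k)) t = lin (coords Y) c2 x"
    by (rule Oplus.IH(2)[OF _ *(2)]) (use Oplus.prems * in auto)
  ultimately show ?case
    using Oplus.prems(3) Y x by (fastforce simp: lin_compl_form lin_diff lin_add lin_unit_form)
qed

lemma branch_exists:
  assumes Y: "finite Y" and x: "x None = 1"
  shows "\<exists>(c, T)\<in>branches s. \<forall>d\<in>T. 0 \<le> lin (coords Y) d x"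
proof (induction s)
  case (Neg s)
  then show ?case by fastforce
next
  case (Oplus s t)
  then obtain c T d U where *: "(c, T) \<in> branches s" "(d, U) \<in> branches t"
    "\<forall>e\<in>T \<union> U. 0 \<le> lin (coords Y) e x" by fastforce
  show ?case
  proof (cases "lin (coords Y) c x + lin (coords Y) d x \<le> 1")
    case True
    then show ?thesis
      using * Y x by (intro bexI[of _ "(\<lambda>w. c w + d w, insert (compl_form (\<lambda>w. c w + d w)) (T \<union> U))"])
        (auto simp: lin_compl_form lin_add intro!: bexI)
  next
    case False
    then show ?thesis
      using * Y x by (intro bexI[of _ "(unit_form None, insert (\<lambda>w. c w + d w - unit_form None w) (T \<union> U))"])
        (auto simp: lin_diff lin_unit_form lin_add intro!: bexI)
  qed
qed auto

context mv_chain
begin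

context
  fixes Y :: "'k set" and g :: "'k \<Rightarrow> 'a"
  assumes Y: "finite Y" and g: "g \<in> Y \<rightarrow> carrier A"
begin

definition gens :: "'k option \<Rightarrow> int \<times> 'a" where
  "gens = case_option (1, \<zero>) (\<lambda>k. embed (g k))"

lemma gens_simps [simp]: "gens None = (1, \<zero>)" "gens (Some k) = embed (g k)"
  by (simp_all add: gens_def)

lemma gens_closed: "v \<in> coords Y \<Longrightarrow> gens v \<in> UNIV \<times> proper"
  using g zero_proper by (auto intro!: embed_closed simp del: mem_Sigma_iff)

lemma gens_value_closed: "form_value (coords Y) gens c \<in> UNIV \<times> proper"
  by (rule form_value_closed) (use gens_closed Y in auto)

lemma gens_value_add:
  "form_value (coords Y) gens (\<lambda>w. c w + d w) =
    form_value (coords Y) gens c \<otimes>\<^bsub>chang_group\<^esub> form_value (coords Y) gens d"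
  by (rule form_value_add) (use gens_closed Y in auto)

lemma gens_value_zero: "form_value (coords Y) gens (\<lambda>w. 0) = \<one>\<^bsub>chang_group\<^esub>"
  by (rule form_value_zero) (use gens_closed Y in auto)

lemma gens_value_unit: "v \<in> coords Y \<Longrightarrow> form_value (coords Y) gens (unit_form v) = gens v"
  unfolding unit_form_def by (rule form_value_single) (use gens_closed Y in auto)

lemma gens_value_cancel:
  "form_value (coords Y) gens (\<lambda>w. c w + d w) = a \<otimes>\<^bsub>chang_group\<^esub> form_value (coords Y) gens d \<Longrightarrow>
    a \<in> UNIV \<times> proper \<Longrightarrow> form_value (coords Y) gens c = a"
  by (rule form_value_cancel) (use gens_closed Y in auto)

abbreviation nonneg :: "('k option \<Rightarrow> int) set" where
  "nonneg \<equiv> nonneg_forms (coords Y) gens"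

lemma nonneg_iff: "c \<in> nonneg \<longleftrightarrow> 0 \<le> fst (form_value (coords Y) gens c)"
  by (subst nonneg_forms_def) (use gens_closed Y in auto)

lemma nonneg_add: "\<lbrakk>c \<in> nonneg; d \<in> nonneg\<rbrakk> \<Longrightarrow> (\<lambda>w. c w + d w) \<in> nonneg"
  by (rule nonneg_forms_add) (use gens_closed Y in auto)

lemma nonneg_strict:
  "\<lbrakk>c \<in> nonneg; form_value (coords Y) gens c \<noteq> \<one>\<^bsub>chang_group\<^esub>\<rbrakk> \<Longrightarrow> (\<lambda>w. - c w) \<notin> nonneg"
  by (rule nonneg_forms_strict) (use gens_closed Y in auto)

lemma value_unit_None: "form_value (coords Y) gens (unit_form None) = (1, \<zero>)"
  by (simp add: gens_value_unit)

lemma value_unit_Some: "k \<in> Y \<Longrightarrow> form_value (coords Y) gens (unit_form (Some k)) = embed (g k)"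
  by (simp add: gens_value_unit)

lemma value_compl_form:
  assumes "form_value (coords Y) gens c = embed x" "x \<in> carrier A"
  shows "form_value (coords Y) gens (compl_form c) = embed (\<sim> x)"
proof (rule gens_value_cancel)
  show "form_value (coords Y) gens (\<lambda>w. compl_form c w + c w) =
      embed (\<sim> x) \<otimes>\<^bsub>chang_group\<^esub> form_value (coords Y) gens c"
    using embed_neg[of "\<sim> x"] assms value_unit_None by (simp add: compl_form_def)
qed (use assms embed_closed in auto)

text \<open>The valuation in the chain selects the branch: at each sum the truncated or the
  untruncated alternative, according to whether the product of the two values vanishes. All guards
  of the selected branch are then nonnegative in the group.\<close>

lemma branch_value:
  "mv_vars s \<subseteq> Y \<Longrightarrow> \<exists>(c, T)\<in>branches s. T \<subseteq> nonneg \<and>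
    form_value (coords Y) gens c = embed (mv_eval A g s)"
proof (induction s)
  case (Gen k)
  then show ?case by (simp add: value_unit_Some)
next
  case Zero
  then show ?case using gens_value_zero zero_neq_one by (simp add: embed_def)
next
  case (Neg s)
  then obtain c T where *: "(c, T) \<in> branches s" "T \<subseteq> nonneg"
    "form_value (coords Y) gens c = embed (mv_eval A g s)" by auto
  have "mv_eval A g s \<in> carrier A"
    using Neg.prems g by (intro mv_eval_closed mv_algebra_axioms) auto
  then show ?case
    using * value_compl_form by (intro bexI[of _ "(compl_form c, T)"]) (auto intro!: image_eqI)
next
  case (Oplus s t)
  then obtain c T d U where *: "(c, T) \<in> branches s" "(d, U) \<in> branches t"
    "T \<union> U \<subseteq> nonneg"
    "form_value (coords Y) gens c = embed (mv_eval A g s)"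
    "form_value (coords Y) gens d = embed (mv_eval A g t)" by auto
  have cl: "mv_eval A g s \<in> carrier A" "mv_eval A g t \<in> carrier A"
    using Oplus.prems g by (auto intro!: mv_eval_closed mv_algebra_axioms)
  show ?case
  proof (cases "mv_eval A g s \<odot> mv_eval A g t = \<zero>")
    case True
    then have sum: "form_value (coords Y) gens (\<lambda>w. c w + d w) = embed (mv_eval A g (Oplus s t))"
      using gens_value_add[of c d] * cl by (simp add: embed_oplus del: chang_group_simps)
    have "compl_form (\<lambda>w. c w + d w) \<in> nonneg"
      using value_compl_form[OF sum] cl fst_embed nonneg_iff by simp
    then show ?thesis
      using * sum by (intro bexI[of _ "(\<lambda>w. c w + d w, insert (compl_form (\<lambda>w. c w + d w)) (T \<union> U))"])
        (auto intro!: bexI)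
  next
    case False
    then have one: "mv_eval A g s \<oplus> mv_eval A g t = \<sim> \<zero>"
      using oplus_eq_one_or_times_eq_zero cl by blast
    have sum: "form_value (coords Y) gens (\<lambda>w. c w + d w) = embed (mv_eval A g s) \<otimes>\<^bsub>chang_group\<^esub> embed (mv_eval A g t)"
      using gens_value_add[of c d] * by simp
    obtain m z where mz: "form_value (coords Y) gens (\<lambda>w. c w + d w) = (m, z)" by fastforce
    have z: "z \<in> proper"
      using gens_value_closed[of "\<lambda>w. c w + d w"] mz by simp
    have m: "1 \<le> m"
      using embed_oplus_eq_one[OF cl one] sum mz by (metis fst_conv)
    \<comment> \<open>Removing the strong unit lowers the integer part by one, which stays
      nonnegative since the sum reached the unit.\<close>
    have "form_value (coords Y) gens (\<lambda>w. c w + d w - unit_form None w) = (m - 1, z)"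
    proof (rule gens_value_cancel)
      show "form_value (coords Y) gens (\<lambda>w. (c w + d w - unit_form None w) + unit_form None w) =
          (m - 1, z) \<otimes>\<^bsub>chang_group\<^esub> form_value (coords Y) gens (unit_form None)"
        using mz z by (simp add: value_unit_None carry_zero frac_add_zero)
    qed (use z in auto)
    then have "(\<lambda>w. c w + d w - unit_form None w) \<in> nonneg"
      using m nonneg_iff by simp
    moreover have "form_value (coords Y) gens (unit_form None) = embed (mv_eval A g (Oplus s t))"
      using one by (simp add: value_unit_None embed_def)
    ultimately show ?thesis
      using * by (intro bexI[of _ "(unit_form None, insert (\<lambda>w. c w + d w - unit_form None w) (T \<union> U))"])
        (auto intro!: bexI)
  qed
qed

text \<open>The system to transfer consists of the guards of the branches selected for
  \<open>s\<close> and \<open>t\<close>, the bounds of the cube, and \<open>- d \<ge> 0\<close>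
  since \<open>t\<close> vanishes; the form \<open>c\<close> of \<open>s\<close> and the unit are
  required to be strictly positive. It holds in Chang's group, so \<open>rational_solution\<close>
  solves it, and division by the value at \<open>None\<close> puts the solution into the
  cube.\<close>

lemma unit_valuation:
  assumes s: "mv_vars s \<subseteq> Y" "mv_eval A g s \<noteq> \<zero>" and t: "mv_vars t \<subseteq> Y" "mv_eval A g t = \<zero>"
  obtains v :: "'k \<Rightarrow> real" where "range v \<subseteq> {0..1}" "mv_eval unit_mv v t = 0" "mv_eval unit_mv v s \<noteq> 0"
proof -
  let ?V = "coords Y"
  obtain c T where c: "(c, T) \<in> branches s" "T \<subseteq> nonneg" "form_value ?V gens c = embed (mv_eval A g s)"
    using branch_value[OF s(1)] by auto
  obtain d U where d: "(d, U) \<in> branches t" "U \<subseteq> nonneg" "form_value ?V gens d = embed (mv_eval A g t)"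
    using branch_value[OF t(1)] by auto
  define neg_d where "neg_d = (\<lambda>w. - d w)"
  have d0: "form_value ?V gens d = \<one>\<^bsub>chang_group\<^esub>"
    using d(3) t(2) by (metis embed_eq_one_iff)
  have neg_d: "neg_d \<in> nonneg"
  proof (rule ccontr)
    assume "neg_d \<notin> nonneg"
    moreover have "form_value ?V gens neg_d = \<one>\<^bsub>chang_group\<^esub>"
      using d0 gens_value_zero zero_proper
      by (intro gens_value_cancel[of neg_d d]) (simp_all add: neg_d_def carry_zero frac_add_zero)
    ultimately show False by (simp add: nonneg_iff)
  qed
  have cN: "c \<in> nonneg" "form_value ?V gens c \<noteq> \<one>\<^bsub>chang_group\<^esub>"
    using c(3) s(2) by (simp add: nonneg_iff fst_embed, metis embed_eq_one_iff)
  define S where "S = {c, unit_form None}"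
  define F where "F = T \<union> U \<union> box_forms Y \<union> {neg_d} \<union> S"
  have "\<exists>x. (\<forall>v\<in>?V. x v \<in> \<rat>) \<and> (\<forall>c\<in>F. 0 \<le> lin ?V c x \<and> (c \<in> S \<longrightarrow> 0 < lin ?V c x))"
  proof (rule rational_solution)
    show "(\<lambda>w. c w + d w) \<in> nonneg" if "c \<in> nonneg" "d \<in> nonneg" for c d
      using that by (rule nonneg_add)
    show "finite ?V" using Y by simp
    show "finite F"
      using finite_branch[OF c(1)] finite_branch[OF d(1)] Y by (auto simp: F_def S_def box_forms_def)
    have "unit_form (Some k) \<in> nonneg" "compl_form (unit_form (Some k)) \<in> nonneg" if "k \<in> Y" for k
    proof -
      have "form_value ?V gens (compl_form (unit_form (Some k))) = embed (\<sim> g k)"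
        using g that by (intro value_compl_form value_unit_Some) auto
      then show "unit_form (Some k) \<in> nonneg" "compl_form (unit_form (Some k)) \<in> nonneg"
        using that by (simp_all add: nonneg_iff value_unit_Some fst_embed)
    qed
    then have "box_forms Y \<subseteq> nonneg"
      by (auto simp: box_forms_def)
    then show "F \<subseteq> nonneg"
      using c d cN neg_d by (auto simp: F_def S_def nonneg_iff value_unit_None)
    show "S \<subseteq> F" by (auto simp: F_def)
    show "(\<lambda>w. - e w) \<notin> nonneg" if "e \<in> S" for e
      using that nonneg_strict[OF cN] nonneg_strict[of "unit_form None"] by (auto simp: S_def nonneg_iff value_unit_None)
    show "e w = 0" if e: "e \<in> F" and w: "w \<notin> ?V" for e w
    proof -
      have "w \<notin> coords (mv_vars s)" "w \<notin> coords (mv_vars t)"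
        using w s(1) t(1) by auto
      then have cd: "f w = 0" if "f \<in> insert c T \<union> insert d U" for f
        using branch_support[OF c(1)] branch_support[OF d(1)] that by blast
      consider "e \<in> insert c T \<union> insert d U" | "e = neg_d" | "e = unit_form None"
        | k where "k \<in> Y" "e = unit_form (Some k) \<or> e = compl_form (unit_form (Some k))"
        using e unfolding F_def S_def box_forms_def by blast
      then show ?thesis
      proof cases
        case 2
        then show ?thesis using cd[of d] by (simp add: neg_d_def)
      next
        case 4
        then show ?thesis using w by (auto simp: compl_form_def unit_form_def)
      qed (use cd w in \<open>auto simp: unit_form_def\<close>)
    qed
  qed
  moreover have "S \<subseteq> F" by (auto simp: F_def)
  ultimately obtain x where x: "\<And>e. e \<in> F \<Longrightarrow> 0 \<le> lin ?V e x" "\<And>e. e \<in> S \<Longrightarrow> 0 < lin ?V e x"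
    by (meson subsetD)
  have pos: "0 < x None"
    using x(2)[of "unit_form None"] Y by (simp add: S_def lin_unit_form)
  \<comment> \<open>Coordinates outside \<open>Y\<close> are set to zero, so that the valuation
    stays in [0,1] at every variable and not only at those in \<open>Y\<close>.\<close>
  define y where "y w = (1 / x None) * (if w \<in> ?V then x w else 0)" for w
  have lin_y: "lin ?V e y = lin ?V e x / x None" for e
  proof -
    have "lin ?V e y = 1 / x None * lin ?V e (\<lambda>w. if w \<in> ?V then x w else 0)"
      unfolding y_def by (rule lin_scale)
    also have "lin ?V e (\<lambda>w. if w \<in> ?V then x w else 0) = lin ?V e x"
      by (rule lin_cong) auto
    finally show ?thesis by simp
  qed
  have y_None: "y None = 1" using pos by (simp add: y_def)
  have y: "0 \<le> lin ?V e y" if "e \<in> F" for e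
    using x(1)[OF that] pos by (simp add: lin_y)
  show ?thesis
  proof (rule that[of "\<lambda>k. y (Some k)"])
    have "y (Some k) \<in> {0..1}" if "k \<in> Y" for k
    proof -
      have "unit_form (Some k) \<in> F" "compl_form (unit_form (Some k)) \<in> F"
        using that by (auto simp: F_def box_forms_def)
      then show ?thesis
        using y[of "unit_form (Some k)"] y[of "compl_form (unit_form (Some k))"] that Y y_None
        by (simp add: lin_unit_form lin_compl_form)
    qed
    then have rng: "y (Some k) \<in> {0..1}" for k
      by (cases "k \<in> Y") (auto simp: y_def)
    then show "range (\<lambda>k. y (Some k)) \<subseteq> {0..1}" by blast
    have "mv_eval unit_mv (\<lambda>k. y (Some k)) t = lin ?V d y"
      by (rule branch_eval[where x = y, OF Y y_None t(1) d(1)]) (use y in \<open>auto simp: F_def\<close>)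
    moreover have "lin ?V d y \<le> 0"
      using y[of neg_d] by (simp add: F_def neg_d_def lin_neg)
    moreover have "0 \<le> mv_eval unit_mv (\<lambda>k. y (Some k)) t"
      using mv_eval_unit_bounds[of t "\<lambda>k. y (Some k)"] rng by auto
    ultimately show "mv_eval unit_mv (\<lambda>k. y (Some k)) t = 0" by linarith
    have "mv_eval unit_mv (\<lambda>k. y (Some k)) s = lin ?V c y"
      by (rule branch_eval[where x = y, OF Y y_None s(1) c(1)]) (use y in \<open>auto simp: F_def\<close>)
    moreover have "0 < lin ?V c y"
      using x(2)[of c] pos by (simp add: lin_y S_def)
    ultimately show "mv_eval unit_mv (\<lambda>k. y (Some k)) s \<noteq> 0" by linarith
  qed
qed

end

end

section \<open>Prime ideals of the free algebra against points of the cube\<close>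

lemma mv_hom_eval:
  assumes A: "mv_algebra A" and h: "mv_hom A B h" and g: "\<And>k. k \<in> mv_vars s \<Longrightarrow> g k \<in> carrier A"
  shows "h (mv_eval A g s) = mv_eval B (\<lambda>k. h (g k)) s"
  using g
proof (induction s)
  case (Neg s)
  then show ?case using h mv_eval_closed[OF A, of s g] by (simp add: mv_hom_def)
next
  case (Oplus s t)
  then show ?case using h mv_eval_closed[OF A, of s g] mv_eval_closed[OF A, of t g] by (simp add: mv_hom_def)
qed (use h in \<open>auto simp: mv_hom_def\<close>)

lemma free_mv_gen_closed: "k \<in> K \<Longrightarrow> free_mv_gen K k \<in> carrier (free_mv K)"
  by (simp add: free_mv_gen_def free_mv_class_closed)

lemma mv_eval_free_mv:
  "mv_vars s \<subseteq> K \<Longrightarrow> mv_eval (free_mv K) (free_mv_gen K) s = mv_term_rel K `` {s}"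
  by (induction s) (auto simp: free_mv_gen_def free_mv_zero_class free_mv_neg_class free_mv_oplus_class)

text \<open>Such a homomorphism sends meets to minima of real numbers, and a minimum is zero only if
  one of its arguments is.\<close>

lemma mv_prime_ideal_kernel:
  assumes A: "mv_algebra A" and h: "mv_hom A unit_mv h"
  shows "mv_prime_ideal A {x \<in> carrier A. h x = 0}"
proof -
  interpret mv_algebra A by fact
  have h_bounds: "0 \<le> h x" "h x \<le> 1" if "x \<in> carrier A" for x
    using h that by (auto simp: mv_hom_def)
  have h_oplus [simp]: "h (x \<oplus>\<^bsub>A\<^esub> y) = min 1 (h x + h y)" if "x \<in> carrier A" "y \<in> carrier A" for x y
    using h that by (auto simp: mv_hom_def)
  have h_neg [simp]: "h (\<sim>\<^bsub>A\<^esub> x) = 1 - h x" if "x \<in> carrier A" for x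
    using h that by (auto simp: mv_hom_def)
  have h_zero: "h \<zero>\<^bsub>A\<^esub> = 0"
    using h by (simp add: mv_hom_def)
  have h_le: "h x \<le> h y" if "mv_le A x y" "x \<in> carrier A" "y \<in> carrier A" for x y
  proof -
    have "h (\<sim>\<^bsub>A\<^esub> x \<oplus>\<^bsub>A\<^esub> y) = h (\<sim>\<^bsub>A\<^esub> \<zero>\<^bsub>A\<^esub>)" using that le_iff by simp
    then show ?thesis using that h_zero by (simp split: if_splits add: min_def)
  qed
  have h_meet: "h (mv_meet A x y) = min (h x) (h y)" if "x \<in> carrier A" "y \<in> carrier A" for x y
    using that h_bounds[OF that(1)] h_bounds[OF that(2)] by (simp add: meet_eq min_def)
  show ?thesis
    unfolding mv_prime_ideal_def mv_ideal_def
  proof (intro conjI ballI impI)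
    show "{x \<in> carrier A. h x = 0} \<noteq> {}"
      using h_zero zero_closed by (metis (mono_tags, lifting) empty_iff mem_Collect_eq)
    have "h (\<sim>\<^bsub>A\<^esub> \<zero>\<^bsub>A\<^esub>) = 1" using h_zero by simp
    then show "{x \<in> carrier A. h x = 0} \<noteq> carrier A" using neg_closed[OF zero_closed]
      by (metis (mono_tags, lifting) mem_Collect_eq zero_neq_one)
    show "y \<in> {x \<in> carrier A. h x = 0}" if "x \<in> {x \<in> carrier A. h x = 0}" "y \<in> carrier A" "mv_le A y x" for x y
      using that h_le[of y x] h_bounds[of y] by auto
  qed (auto simp: h_meet min_def split: if_splits)
qed

text \<open>A point of the cube is tested by the kernel of evaluation at it. Conversely, a prime
  separating \<open>s\<close> from \<open>t\<close> is turned into a point by passing to the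
  quotient chain and \<open>unit_valuation\<close>.\<close>

theorem free_mv_prime_ideals_iff:
  assumes s: "mv_vars s \<subseteq> K" and t: "mv_vars t \<subseteq> K"
  shows "(\<forall>P. mv_prime_ideal (free_mv K) P \<longrightarrow> mv_term_rel K `` {t} \<in> P \<longrightarrow> mv_term_rel K `` {s} \<in> P) \<longleftrightarrow>
    (\<forall>v. range v \<subseteq> {0..1} \<longrightarrow> mv_eval unit_mv v t = 0 \<longrightarrow> mv_eval unit_mv v s = 0)" (is "?L \<longleftrightarrow> ?R")
proof
  interpret free: mv_algebra "free_mv K" by (rule mv_algebra_free_mv)
  assume L: ?L
  show ?R
  proof (intro allI impI)
    fix v :: "'a \<Rightarrow> real" assume v: "range v \<subseteq> {0..1}" "mv_eval unit_mv v t = 0"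
    then have "v \<in> K \<rightarrow> carrier unit_mv" by auto
    from free_mv_universal[OF mv_algebra_unit_mv this]
    obtain h where h: "mv_hom (free_mv K) unit_mv h" "\<And>k. k \<in> K \<Longrightarrow> h (free_mv_gen K k) = v k" by auto
    have eval: "h (mv_term_rel K `` {u}) = mv_eval unit_mv v u" if "mv_vars u \<subseteq> K" for u
    proof -
      have "h (mv_eval (free_mv K) (free_mv_gen K) u) = mv_eval unit_mv (\<lambda>k. h (free_mv_gen K k)) u"
        using that by (intro mv_hom_eval mv_algebra_free_mv h(1) free_mv_gen_closed) auto
      also have "\<dots> = mv_eval unit_mv v u"
        using that h(2) by (intro mv_eval_cong) auto
      finally show ?thesis using that by (simp add: mv_eval_free_mv)
    qed
    have "mv_term_rel K `` {s} \<in> {C \<in> carrier (free_mv K). h C = 0}"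
      using L mv_prime_ideal_kernel[OF mv_algebra_free_mv h(1)] v(2) t eval free_mv_class_closed by fastforce
    then show "mv_eval unit_mv v s = 0" using eval[OF s] by simp
  qed
next
  interpret free: mv_algebra "free_mv K" by (rule mv_algebra_free_mv)
  assume R: ?R
  show ?L
  proof (intro allI impI; rule ccontr)
    fix P assume P: "mv_prime_ideal (free_mv K) P" "mv_term_rel K `` {t} \<in> P" "mv_term_rel K `` {s} \<notin> P"
    obtain B :: "'a mv_term set mv_algebra" and h where B: "mv_algebra B" "mv_hom (free_mv K) B h"
      "\<And>x y. \<lbrakk>x \<in> carrier B; y \<in> carrier B\<rbrakk> \<Longrightarrow> mv_le B x y \<or> mv_le B y x"
      "\<And>x. x \<in> carrier (free_mv K) \<Longrightarrow> h x = \<zero>\<^bsub>B\<^esub> \<longleftrightarrow> x \<in> P"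
      using free.quotient_chain[OF P(1)] by blast
    have "\<sim>\<^bsub>B\<^esub> \<zero>\<^bsub>B\<^esub> = h (\<sim>\<^bsub>free_mv K\<^esub> \<zero>\<^bsub>free_mv K\<^esub>)"
      using B(2) free.zero_closed by (simp add: mv_hom_def)
    then have "\<zero>\<^bsub>B\<^esub> \<noteq> \<sim>\<^bsub>B\<^esub> \<zero>\<^bsub>B\<^esub>"
      using B(4)[of "\<sim>\<^bsub>free_mv K\<^esub> \<zero>\<^bsub>free_mv K\<^esub>"] free.one_notin_prime[OF P(1)] by auto
    then interpret B: mv_chain B
      using B(1,3) by (simp add: mv_chain_def mv_chain_axioms_def)
    define Y where "Y = mv_vars s \<union> mv_vars t"
    define g where "g k = h (free_mv_gen K k)" for k
    have Y: "finite Y" "Y \<subseteq> K" using s t by (auto simp: Y_def)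
    have g: "g \<in> Y \<rightarrow> carrier B"
    proof (rule Pi_I)
      fix k assume "k \<in> Y"
      then have "free_mv_gen K k \<in> carrier (free_mv K)"
        using Y by (intro free_mv_gen_closed) auto
      then show "g k \<in> carrier B"
        using B(2) by (simp add: g_def mv_hom_def Pi_iff)
    qed
    have eval: "mv_eval B g u = h (mv_term_rel K `` {u})" if "mv_vars u \<subseteq> K" for u
    proof -
      have "h (mv_eval (free_mv K) (free_mv_gen K) u) = mv_eval B (\<lambda>k. h (free_mv_gen K k)) u"
        using that by (intro mv_hom_eval mv_algebra_free_mv B(2) free_mv_gen_closed) auto
      then show ?thesis using that by (simp add: mv_eval_free_mv g_def[abs_def])
    qed
    have "mv_eval B g s \<noteq> \<zero>\<^bsub>B\<^esub>" "mv_eval B g t = \<zero>\<^bsub>B\<^esub>"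
      using eval s t B(4) free_mv_class_closed P by metis+
    then obtain v :: "'a \<Rightarrow> real" where "range v \<subseteq> {0..1}" "mv_eval unit_mv v t = 0" "mv_eval unit_mv v s \<noteq> 0"
      using B.unit_valuation[OF Y(1) g, of s t] by (auto simp: Y_def)
    with R show False by blast
  qed
qed


section \<open>Polytopes with integer inequalities\<close>

text \<open>Take a subset of least cardinality whose hull contains \<open>p\<close>. An affine
  dependence in it would allow the weights to be shifted until one of them vanishes, giving a
  smaller subset.\<close>

lemma caratheodory_independent:
  fixes W :: "'a::real_vector set"
  assumes W: "finite W" and p: "p \<in> convex hull W"
  obtains V where "V \<subseteq> W" "\<not> affine_dependent V" "p \<in> convex hull V"
proof -
  define \<V> where "\<V> = {V. V \<subseteq> W \<and> p \<in> convex hull V}"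
  have "W \<in> \<V>" using p by (simp add: \<V>_def)
  then obtain V where V: "V \<in> \<V>" and min: "\<And>V'. V' \<in> \<V> \<Longrightarrow> card V \<le> card V'"
    using ex_has_least_nat[of "\<lambda>V. V \<in> \<V>" W card] by blast
  have fin: "finite V" using V W by (auto simp: \<V>_def intro: finite_subset)
  have "\<not> affine_dependent V"
  proof
    assume "affine_dependent V"
    then obtain U v0 where U: "sum U V = 0" "v0 \<in> V" "U v0 \<noteq> 0" "(\<Sum>v\<in>V. U v *\<^sub>R v) = 0"
      using affine_dependent_explicit_finite[OF fin] by blast
    obtain u where u: "\<And>v. v \<in> V \<Longrightarrow> 0 \<le> u v" "sum u V = 1" "(\<Sum>v\<in>V. u v *\<^sub>R v) = p"
      using V fin by (auto simp: \<V>_def convex_hull_finite)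
    define Neg where "Neg = {v \<in> V. U v < 0}"
    have "Neg \<noteq> {}"
    proof
      assume "Neg = {}"
      then have "\<And>v. v \<in> V \<Longrightarrow> 0 \<le> U v" by (force simp: Neg_def)
      then have "\<forall>v\<in>V. U v = 0" using U(1) fin by (simp add: sum_nonneg_eq_0_iff)
      then show False using U by blast
    qed
    \<comment> \<open>The longest shift along the dependence that keeps all weights nonnegative; the
      weight attaining the minimum drops to zero.\<close>
    define t where "t = Min ((\<lambda>v. u v / - U v) ` Neg)"
    have finN: "finite ((\<lambda>v. u v / - U v) ` Neg)" using fin by (simp add: Neg_def)
    obtain a where a: "a \<in> Neg" "t = u a / - U a"
      using Min_in[OF finN] \<open>Neg \<noteq> {}\<close> by (auto simp: t_def)
    have t0: "0 \<le> t"
      unfolding a(2) using a(1) u(1) by (intro divide_nonneg_nonneg) (auto simp: Neg_def)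
    define w where "w v = u v + t * U v" for v
    have w0: "0 \<le> w v" if "v \<in> V" for v
    proof (cases "U v < 0")
      case True
      then have "t \<le> u v / - U v"
        unfolding t_def using that by (intro Min_le finN) (auto simp: Neg_def)
      then have "t * - U v \<le> u v"
        using True by (simp only: pos_le_divide_eq neg_0_less_iff_less)
      then show ?thesis by (simp add: w_def)
    next
      case False
      then show ?thesis using that u(1) t0 by (simp add: w_def)
    qed
    have wa: "w a = 0" "a \<in> V" using a by (auto simp: w_def Neg_def)
    have "sum w V = 1" using u U by (simp add: w_def sum.distrib flip: sum_distrib_left)
    moreover have "(\<Sum>v\<in>V. w v *\<^sub>R v) = p"
      using u U by (simp add: w_def scaleR_add_left sum.distrib flip: scaleR_sum_right scaleR_scaleR)
    ultimately have "sum w (V - {a}) = 1" "(\<Sum>v\<in>V - {a}. w v *\<^sub>R v) = p"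
      using wa fin by (simp_all add: sum_diff1)
    then have "p \<in> convex hull (V - {a})"
      using fin w0 by (auto simp: convex_hull_finite)
    then have "V - {a} \<in> \<V>" using V by (auto simp: \<V>_def)
    then show False
      using min[of "V - {a}"] card_Diff1_less[OF fin wa(2)] by simp
  qed
  then show ?thesis using V that by (auto simp: \<V>_def)
qed

definition homog :: "('k \<Rightarrow> real) \<Rightarrow> 'k option \<Rightarrow> real" where
  "homog f = case_option 1 f"

lemma homog_simps [simp]: "homog f None = 1" "homog f (Some k) = f k"
  by (simp_all add: homog_def)

definition form_polytope :: "'k set \<Rightarrow> ('k option \<Rightarrow> int) set \<Rightarrow> ('k \<Rightarrow> real) set" where
  "form_polytope Y T = {f \<in> Y \<rightarrow>\<^sub>E {0..1}. \<forall>c\<in>T. 0 \<le> lin (coords Y) c (homog f)}"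

lemma lin_homog_affine:
  assumes "\<And>k. k \<in> Y \<Longrightarrow> r k = (1 - t) * p k + t * q k"
  shows "lin (coords Y) c (homog r) = (1 - t) * lin (coords Y) c (homog p) + t * lin (coords Y) c (homog q)"
proof -
  have "lin (coords Y) c (homog r) = lin (coords Y) c (\<lambda>w. (1 - t) * homog p w + t * homog q w)"
    using assms by (intro lin_cong) auto
  then show ?thesis by (simp only: lin_plus lin_scale)
qed

lemma box_forms_iff:
  assumes "finite Y" "k \<in> Y"
  shows "(\<forall>c\<in>box_forms {k}. 0 \<le> lin (coords Y) c (homog f)) \<longleftrightarrow> f k \<in> {0..1}"
  using assms by (auto simp: box_forms_def lin_unit_form lin_compl_form)

locale rational_polytope =
  fixes Y :: "'k set" and T :: "('k option \<Rightarrow> int) set"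
  assumes Y: "finite Y" and T: "finite T"
    and support: "\<And>c w. c \<in> T \<Longrightarrow> w \<notin> coords Y \<Longrightarrow> c w = 0"
begin

text \<open>The bounds of the cube are added as forms, so that the polytope is described by forms
  alone and its faces by sets of vanishing forms.\<close>

definition T' :: "('k option \<Rightarrow> int) set" where
  "T' = T \<union> box_forms Y"

abbreviation Q :: "('k \<Rightarrow> real) set" where "Q \<equiv> form_polytope Y T"

abbreviation L :: "('k option \<Rightarrow> int) \<Rightarrow> ('k \<Rightarrow> real) \<Rightarrow> real" where
  "L c p \<equiv> lin (coords Y) c (homog p)"

lemma finite_T': "finite T'"
  using T Y by (simp add: T'_def box_forms_def)

lemma Q_iff: "p \<in> Q \<longleftrightarrow> p \<in> extensional Y \<and> (\<forall>c\<in>T'. 0 \<le> L c p)"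
proof -
  have "(\<forall>c\<in>box_forms Y. 0 \<le> L c p) \<longleftrightarrow> (\<forall>k\<in>Y. p k \<in> {0..1})"
  proof -
    have "box_forms Y = (\<Union>k\<in>Y. box_forms {k})" by (auto simp: box_forms_def)
    then have "(\<forall>c\<in>box_forms Y. 0 \<le> L c p) \<longleftrightarrow> (\<forall>k\<in>Y. \<forall>c\<in>box_forms {k}. 0 \<le> L c p)"
      by (simp only: ball_UN)
    also have "\<dots> \<longleftrightarrow> (\<forall>k\<in>Y. p k \<in> {0..1})"
      by (rule ball_cong[OF HOL.refl box_forms_iff[OF Y]])
    finally show ?thesis .
  qed
  then show ?thesis by (auto simp: form_polytope_def T'_def PiE_iff)
qed

definition active :: "('k \<Rightarrow> real) \<Rightarrow> ('k option \<Rightarrow> int) set" where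
  "active p = {c \<in> T'. L c p = 0}"

text \<open>A vertex is the only solution of its active equations among all points, also those
  outside the polytope. Hence the active set determines the vertex, which gives finiteness, and any
  rational solution of the equations must be the vertex itself.\<close>

definition vertices :: "('k \<Rightarrow> real) set" where
  "vertices = {p \<in> Q. \<forall>q\<in>extensional Y. (\<forall>c\<in>active p. L c q = 0) \<longrightarrow> q = p}"

lemma finite_vertices: "finite vertices"
proof (rule finite_imageD)
  show "finite (active ` vertices)"
    by (rule finite_subset[of _ "Pow T'"]) (auto simp: active_def finite_T')
  show "inj_on active vertices"
  proof (rule inj_onI)
    fix p q assume "p \<in> vertices" "q \<in> vertices" "active p = active q"
    moreover from this have "q \<in> extensional Y" "\<forall>c\<in>active p. L c q = 0"
      by (simp_all add: vertices_def Q_iff) (simp add: active_def)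
    ultimately show "p = q"
      unfolding vertices_def by blast
  qed
qed

text \<open>Write the active equations as pairs of inequalities. They are solvable at
  \<open>p\<close>, so with \<open>N\<close> the forms nonnegative at \<open>p\<close> they have a
  rational solution with positive value at \<open>None\<close>; normalized, it equals
  \<open>p\<close> by uniqueness.\<close>

lemma vertex_rational:
  assumes p: "p \<in> vertices" and k: "k \<in> Y"
  shows "p k \<in> \<rat>"
proof -
  let ?N = "{c. 0 \<le> L c p}"
  define F where "F = insert (unit_form None) (active p \<union> (\<lambda>c w. - c w) ` active p)"
  have supp: "c w = 0" if "c \<in> T'" "w \<notin> coords Y" for c w
    using that support by (auto simp: T'_def box_forms_def unit_form_def compl_form_def)
  have "\<exists>x. (\<forall>v\<in>coords Y. x v \<in> \<rat>) \<and> (\<forall>c\<in>F. 0 \<le> lin (coords Y) c x \<and> (c \<in> {unit_form None} \<longrightarrow> 0 < lin (coords Y) c x))"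
  proof (rule rational_solution[of ?N])
    show "finite F" using finite_T' by (simp add: F_def active_def)
    show "F \<subseteq> ?N" using Y by (auto simp: F_def active_def lin_neg lin_unit_form)
    show "c w = 0" if "c \<in> F" "w \<notin> coords Y" for c w
      using that supp by (auto simp: F_def active_def unit_form_def)
    show "(\<lambda>w. c w + d w) \<in> ?N" if "c \<in> ?N" "d \<in> ?N" for c d
      using that by (simp add: lin_add)
    show "(\<lambda>w. - c w) \<notin> ?N" if "c \<in> {unit_form None}" for c
      using that Y by (simp add: lin_neg lin_unit_form)
  qed (use Y in \<open>simp_all add: F_def\<close>)
  moreover have "unit_form None \<in> F" by (simp add: F_def)
  ultimately obtain x where x: "\<And>v. v \<in> coords Y \<Longrightarrow> x v \<in> \<rat>" "\<And>c. c \<in> F \<Longrightarrow> 0 \<le> lin (coords Y) c x"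
    "0 < lin (coords Y) (unit_form None) x"
    by blast
  have pos: "0 < x None" using x(3) Y by (simp add: lin_unit_form)
  define q where "q = (\<lambda>k\<in>Y. (1 / x None) * x (Some k))"
  have "L c q = 0" if "c \<in> active p" for c
  proof -
    have "L c q = lin (coords Y) c (\<lambda>w. (1 / x None) * x w)"
      using pos by (intro lin_cong) (auto simp: q_def)
    also have "\<dots> = 1 / x None * lin (coords Y) c x" by (rule lin_scale)
    also have "lin (coords Y) c x = 0"
      using x(2)[of c] x(2)[of "\<lambda>w. - c w"] that by (simp add: F_def lin_neg)
    finally show ?thesis by simp
  qed
  then have "q = p"
    using p restrict_extensional[of _ Y] unfolding vertices_def q_def by blast
  moreover have "q k \<in> \<rat>"
    using k x(1) by (auto simp: q_def intro!: Rats_divide)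
  ultimately show ?thesis by simp
qed

text \<open>Follow the ray from \<open>p\<close> through \<open>q\<close> until the first constraint
  becomes tight. The equations active at \<open>p\<close> hold along the whole line, so the active
  set grows. The point \<open>q\<close> may lie outside the polytope, and \<open>t\<close> may
  exceed one.\<close>

lemma move_to_face:
  assumes p: "p \<in> Q" and q: "q \<in> extensional Y" "q \<noteq> p" "\<And>c. c \<in> active p \<Longrightarrow> L c q = 0"
  obtains t where "0 < t" "(\<lambda>k\<in>Y. (1 - t) * p k + t * q k) \<in> Q"
    "active p \<subset> active (\<lambda>k\<in>Y. (1 - t) * p k + t * q k)"
proof -
  define D where "D = {c \<in> T'. L c q < L c p}"
  have pT: "0 \<le> L c p" if "c \<in> T'" for c using p that by (simp add: Q_iff)
  have D_pos: "0 < L c p" if "c \<in> D" for c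
  proof -
    have "c \<notin> active p" using q(3)[of c] that by (auto simp: D_def active_def)
    then show ?thesis using that pT[of c] by (auto simp: D_def active_def)
  qed
  \<comment> \<open>Boundedness enters here: where \<open>q\<close> differs from \<open>p\<close> in
    a coordinate, one of the two bounds on that coordinate decreases towards
    \<open>q\<close>.\<close>
  have "D \<noteq> {}"
  proof -
    obtain k where k: "k \<in> Y" "q k \<noteq> p k"
      using q(1,2) p extensionalityI[of q Y p] by (auto simp: Q_iff)
    have "unit_form (Some k) \<in> T'" "compl_form (unit_form (Some k)) \<in> T'"
      using k by (auto simp: T'_def box_forms_def)
    then show ?thesis
      using k Y by (cases "q k < p k") (force simp: D_def lin_unit_form lin_compl_form)+
  qed
  \<comment> \<open>The ratio test: each quotient is the time at which a decreasing constraint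
    reaches zero.\<close>
  define t where "t = Min ((\<lambda>c. L c p / (L c p - L c q)) ` D)"
  have finD: "finite ((\<lambda>c. L c p / (L c p - L c q)) ` D)" using finite_T' by (simp add: D_def)
  obtain a where a: "a \<in> D" "t = L a p / (L a p - L a q)"
    using Min_in[OF finD] \<open>D \<noteq> {}\<close> by (auto simp: t_def)
  have t: "0 < t" unfolding a(2) using a(1) D_pos by (intro divide_pos_pos) (auto simp: D_def)
  define r where "r = (\<lambda>k\<in>Y. (1 - t) * p k + t * q k)"
  have Lr: "L c r = (1 - t) * L c p + t * L c q" for c
    by (rule lin_homog_affine) (simp add: r_def)
  have Lr': "L c r = L c p - t * (L c p - L c q)" for c
    by (simp add: Lr algebra_simps)
  have "r \<in> Q"
    unfolding Q_iff
  proof (intro conjI ballI)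
    show "r \<in> extensional Y" by (simp add: r_def)
    fix c assume c: "c \<in> T'"
    show "0 \<le> L c r"
    proof (cases "c \<in> D")
      case True
      then have "t \<le> L c p / (L c p - L c q)"
        unfolding t_def by (intro Min_le finD) auto
      then have "t * (L c p - L c q) \<le> L c p"
        using True by (simp add: D_def le_divide_eq)
      then show ?thesis by (simp add: Lr')
    next
      case False
      then have "t * (L c p - L c q) \<le> 0"
        using c t by (simp add: D_def mult_le_0_iff)
      then show ?thesis using pT[OF c] by (simp add: Lr')
    qed
  qed
  moreover have "active p \<subset> active r"
  proof
    show "active p \<subseteq> active r"
    proof
      fix c assume "c \<in> active p"
      then show "c \<in> active r" using q(3)[of c] by (simp add: active_def Lr)
    qed
    have "a \<notin> active p" using D_pos[OF a(1)] by (auto simp: active_def)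
    moreover have "t * (L a p - L a q) = L a p"
      using a by (simp add: D_def)
    then have "a \<in> active r" using a(1) by (simp add: active_def Lr' D_def)
    ultimately show "active p \<noteq> active r" by blast
  qed
  ultimately show ?thesis using t that unfolding r_def by blast
qed

text \<open>A point that is not a vertex can be moved along a line in both directions until more
  constraints are active. It lies between the two end points, which are in the hull by induction on
  the number of inactive constraints.\<close>

lemma in_hull_vertices: "p \<in> Q \<Longrightarrow> p \<in> convex hull vertices"
proof (induction "card (T' - active p)" arbitrary: p rule: less_induct)
  case less
  have measure: "card (T' - active r) < card (T' - active p)" if "active p \<subset> active r" for r
  proof (rule psubset_card_mono)
    show "T' - active r \<subset> T' - active p" using that by (auto simp: active_def)
  qed (simp add: finite_T')
  show ?case
  proof (cases "p \<in> vertices")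
    case True
    then show ?thesis by (rule hull_inc)
  next
    case False
    then obtain q where q: "q \<in> extensional Y" "q \<noteq> p" "\<And>c. c \<in> active p \<Longrightarrow> L c q = 0"
      using less.prems by (auto simp: vertices_def)
    obtain k where k: "k \<in> Y" "q k \<noteq> p k"
      using q(1,2) less.prems extensionalityI[of q Y p] by (auto simp: Q_iff)
    \<comment> \<open>The reflection of \<open>q\<close> in \<open>p\<close>, written as an affine
      combination with parameter -1 to fit \<open>lin_homog_affine\<close>.\<close>
    define q' where "q' = (\<lambda>k\<in>Y. (1 - (-1)) * p k + (-1) * q k)"
    have "q' \<in> extensional Y" by (simp add: q'_def)
    moreover have "q' k \<noteq> p k" using k by (simp add: q'_def)
    then have "q' \<noteq> p" by blast
    moreover have "L c q' = 0" if "c \<in> active p" for c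
    proof -
      have "L c q' = (1 - (-1)) * L c p + (-1) * L c q"
        by (rule lin_homog_affine) (simp add: q'_def)
      then show ?thesis using q(3)[OF that] that by (simp add: active_def)
    qed
    ultimately have q': "q' \<in> extensional Y" "q' \<noteq> p" "\<And>c. c \<in> active p \<Longrightarrow> L c q' = 0"
      by blast+
    obtain s where s: "0 < s" "(\<lambda>k\<in>Y. (1 - s) * p k + s * q k) \<in> Q"
      "active p \<subset> active (\<lambda>k\<in>Y. (1 - s) * p k + s * q k)"
      using move_to_face[OF less.prems q] by blast
    obtain t where t: "0 < t" "(\<lambda>k\<in>Y. (1 - t) * p k + t * q' k) \<in> Q"
      "active p \<subset> active (\<lambda>k\<in>Y. (1 - t) * p k + t * q' k)"
      using move_to_face[OF less.prems q'] by blast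
    define r where "r = (\<lambda>k\<in>Y. (1 - s) * p k + s * q k)"
    define r' where "r' = (\<lambda>k\<in>Y. (1 - t) * p k + t * q' k)"
    have rr': "r \<in> convex hull vertices" "r' \<in> convex hull vertices"
      using s t less.hyps measure unfolding r_def r'_def by blast+
    have ext: "p \<in> extensional Y" using less.prems by (simp add: Q_iff)
    have "p = (t / (s + t)) *\<^sub>R r + (s / (s + t)) *\<^sub>R r'"
    proof
      fix i
      have st: "t / (s + t) = 1 - s / (s + t)"
        using s(1) t(1) by (simp add: field_simps)
      show "p i = ((t / (s + t)) *\<^sub>R r + (s / (s + t)) *\<^sub>R r') i"
      proof (cases "i \<in> Y")
        case True
        have "((t / (s + t)) *\<^sub>R r + (s / (s + t)) *\<^sub>R r') i =
            (t * ((1 - s) * p i + s * q i) + s * ((1 - t) * p i + t * (2 * p i - q i))) / (s + t)"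
          using True by (simp add: scaleR_fun_def r_def r'_def q'_def add_divide_distrib)
        also have "\<dots> = ((s + t) * p i) / (s + t)" by (simp add: algebra_simps)
        also have "\<dots> = p i" using s(1) t(1) by simp
        finally show ?thesis by simp
      next
        \<comment> \<open>Outside \<open>Y\<close> all points take the value
          \<open>undefined\<close>, which the combination preserves because its weights add up to
          one.\<close>
        case False
        then show ?thesis
          unfolding st using ext by (simp add: scaleR_fun_def r_def r'_def extensional_def algebra_simps)
      qed
    qed
    moreover have "(t / (s + t)) *\<^sub>R r + (s / (s + t)) *\<^sub>R r' \<in> convex hull vertices"
    proof (rule convexD[OF convex_convex_hull rr'])
      have "t / (s + t) + s / (s + t) = (s + t) / (s + t)"
        by (metis add.commute add_divide_distrib)
      then show "t / (s + t) + s / (s + t) = 1" using s(1) t(1) by simp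
    qed (use s(1) t(1) in simp_all)
    ultimately show ?thesis by simp
  qed
qed

lemma convex_Q: "convex Q"
proof (rule convexI)
  fix p q u v assume *: "p \<in> Q" "q \<in> Q" "0 \<le> u" "0 \<le> v" "u + v = (1::real)"
  let ?r = "u *\<^sub>R p + v *\<^sub>R q"
  have u: "u = 1 - v" using *(5) by simp
  show "?r \<in> Q"
    unfolding Q_iff
  proof (intro conjI ballI)
    have "?r k = undefined" if "k \<notin> Y" for k
    proof -
      have "p k = undefined" "q k = undefined" using *(1,2) that by (auto simp: Q_iff extensional_def)
      then show ?thesis by (simp add: scaleR_fun_def u algebra_simps)
    qed
    then show "?r \<in> extensional Y" by (simp add: extensional_def)
    fix c assume "c \<in> T'"
    then have "0 \<le> u * L c p + v * L c q"
      using * by (intro add_nonneg_nonneg mult_nonneg_nonneg) (simp_all add: Q_iff)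
    also have "\<dots> = L c ?r"
      unfolding u by (rule lin_homog_affine[symmetric]) (simp add: scaleR_fun_def)
    finally show "0 \<le> L c ?r" .
  qed
qed

text \<open>The simplexes are the hulls of all affinely independent sets of vertices; they overlap,
  and \<open>caratheodory_independent\<close> shows that they cover.\<close>

lemma rational_polyhedron_Q: "rational_polyhedron Y Q"
  unfolding rational_polyhedron_def
proof (intro exI conjI ballI)
  let ?S = "(hull) convex ` {V. V \<subseteq> vertices \<and> \<not> affine_dependent V}"
  have "{V. V \<subseteq> vertices \<and> \<not> affine_dependent V} \<subseteq> Pow vertices" by blast
  moreover have "finite (Pow vertices)" by (simp add: finite_vertices)
  ultimately show "finite ?S" by (intro finite_imageI) (rule finite_subset)
  show "rational_simplex Y S" if S: "S \<in> ?S" for S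
  proof -
    obtain V where V: "V \<subseteq> vertices" "\<not> affine_dependent V" "S = convex hull V"
      using S by blast
    have "V \<subseteq> Y \<rightarrow>\<^sub>E {0..1}" using V(1) unfolding vertices_def form_polytope_def by blast
    moreover have "finite V" using V(1) finite_vertices by (rule finite_subset)
    moreover have "\<forall>v\<in>V. \<forall>y\<in>Y. v y \<in> \<rat>" using V(1) vertex_rational by blast
    ultimately show ?thesis
      unfolding rational_simplex_def using V(2,3) by blast
  qed
  show "Q = \<Union>?S"
  proof
    show "Q \<subseteq> \<Union>?S"
    proof
      fix p assume "p \<in> Q"
      obtain V where "V \<subseteq> vertices" "\<not> affine_dependent V" "p \<in> convex hull V"
        using caratheodory_independent[OF finite_vertices in_hull_vertices[OF \<open>p \<in> Q\<close>]] .
      then show "p \<in> \<Union>?S" by blast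
    qed
    have "convex hull V \<subseteq> Q" if "V \<subseteq> vertices" for V
    proof (rule hull_minimal)
      show "V \<subseteq> Q" using that unfolding vertices_def by blast
    qed (rule convex_Q)
    then show "\<Union>?S \<subseteq> Q" by blast
  qed
qed

end

lemma rational_polyhedron_UN:
  assumes "finite I" "\<And>i. i \<in> I \<Longrightarrow> rational_polyhedron Y (P i)"
  shows "rational_polyhedron Y (\<Union>i\<in>I. P i)"
proof -
  have "\<forall>i\<in>I. \<exists>\<S>. finite \<S> \<and> (\<forall>S\<in>\<S>. rational_simplex Y S) \<and> P i = \<Union>\<S>"
    using assms(2) by (simp add: rational_polyhedron_def)
  then obtain \<S> where "\<forall>i\<in>I. finite (\<S> i) \<and> (\<forall>S\<in>\<S> i. rational_simplex Y S) \<and> P i = \<Union>(\<S> i)"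
    by metis
  then show ?thesis
    unfolding rational_polyhedron_def using assms(1) by (intro exI[of _ "\<Union>i\<in>I. \<S> i"]) auto
qed

text \<open>On each branch the term is a single form \<open>c\<close>. Since values of terms are
  nonnegative, vanishing amounts to \<open>- c \<ge> 0\<close>, one more inequality, so the zero set
  is a finite union of polytopes.\<close>

lemma rational_polyhedron_zero_set:
  assumes Y: "finite Y" and s: "mv_vars s \<subseteq> Y"
  shows "rational_polyhedron Y {f \<in> Y \<rightarrow>\<^sub>E {0..1}. mv_eval unit_mv f s = 0}"
proof -
  define P where "P b = (case b of (c, T) \<Rightarrow> form_polytope Y (insert (\<lambda>w. - c w) T))" for b
  have "rational_polyhedron Y (P b)" if "b \<in> branches s" for b
  proof -
    obtain c T where b: "b = (c, T)" by fastforce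
    interpret rational_polytope Y "insert (\<lambda>w. - c w) T"
      using that finite_branch[of c T s] branch_support[of c T s] Y s
      by unfold_locales (auto simp: b subset_iff image_iff)
    show ?thesis using rational_polyhedron_Q by (simp add: P_def b)
  qed
  then have "rational_polyhedron Y (\<Union>b\<in>branches s. P b)"
    by (intro rational_polyhedron_UN finite_branches)
  moreover have "{f \<in> Y \<rightarrow>\<^sub>E {0..1}. mv_eval unit_mv f s = 0} = (\<Union>b\<in>branches s. P b)"
  proof (rule Set.set_eqI, rule iffI)
    fix f assume "f \<in> {f \<in> Y \<rightarrow>\<^sub>E {0..1}. mv_eval unit_mv f s = 0}"
    then have f: "f \<in> Y \<rightarrow>\<^sub>E {0..1}" "mv_eval unit_mv f s = 0" by auto
    obtain c T where cT: "(c, T) \<in> branches s" "\<forall>d\<in>T. 0 \<le> lin (coords Y) d (homog f)"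
      using branch_exists[OF Y, of "homog f" s] by auto
    have "mv_eval unit_mv f s = lin (coords Y) c (homog f)"
      using branch_eval[where x = "homog f", OF Y _ s cT(1)] cT(2) by simp
    then show "f \<in> (\<Union>b\<in>branches s. P b)"
      using f cT by (intro UN_I[OF cT(1)]) (simp add: P_def form_polytope_def lin_neg)
  next
    fix f assume "f \<in> (\<Union>b\<in>branches s. P b)"
    then obtain c T where cT: "(c, T) \<in> branches s" "f \<in> Y \<rightarrow>\<^sub>E {0..1}"
      "\<forall>d\<in>T. 0 \<le> lin (coords Y) d (homog f)" "lin (coords Y) c (homog f) \<le> 0"
      by (auto simp: P_def form_polytope_def lin_neg)
    have "mv_eval unit_mv f s = lin (coords Y) c (homog f)"
      using branch_eval[where x = "homog f", OF Y _ s cT(1)] cT(3) by simp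
    moreover have "0 \<le> mv_eval unit_mv f s"
      using mv_eval_unit_bounds[of s f] s cT(2) by (auto simp: PiE_iff)
    ultimately show "f \<in> {f \<in> Y \<rightarrow>\<^sub>E {0..1}. mv_eval unit_mv f s = 0}"
      using cT by simp
  qed
  ultimately show ?thesis by simp
qed


section \<open>Zero sets of terms\<close>

lemma sum_fun_apply: "(\<Sum>v\<in>V. f v) k = (\<Sum>v\<in>V. f v k :: real)"
  by (induction V rule: infinite_finite_induct) (auto simp: zero_fun_def)

lemma common_denominator:
  fixes A :: "real set"
  assumes "finite A" "A \<subseteq> \<rat>"
  obtains D :: int where "0 < D" "\<And>a. a \<in> A \<Longrightarrow> of_int D * a \<in> \<int>"
proof -
  have "\<exists>D::int. 0 < D \<and> (\<forall>a\<in>A. of_int D * a \<in> \<int>)"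
    using assms
  proof (induction A rule: finite_induct)
    case empty
    then show ?case by (intro exI[of _ 1]) simp
  next
    case (insert a A)
    then obtain D :: int where D: "0 < D" "\<And>b. b \<in> A \<Longrightarrow> of_int D * b \<in> \<int>" by auto
    from insert.prems obtain p q :: int where a: "0 < q" "a = of_int p / of_int q"
      by (auto elim: Rats_cases')
    have "of_int (D * q) * b \<in> \<int>" if "b \<in> insert a A" for b
    proof (cases "b = a")
      case True
      then have "of_int (D * q) * b = of_int (D * p)" using a by simp
      then show ?thesis by (simp only: Ints_of_int)
    next
      case False
      then have "of_int D * b \<in> \<int>" using that D(2) by blast
      then have "of_int q * (of_int D * b) \<in> \<int>" by (rule Ints_mult[OF Ints_of_int])
      then show ?thesis by (simp add: mult.assoc mult.left_commute)
    qed
    then show ?case using D(1) a(1) by (intro exI[of _ "D * q"]) simp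
  qed
  with that show ?thesis by blast
qed

text \<open>
  A point \<open>f\<close> lies in the hull of \<open>V\<close> iff some weights on \<open>V\<close> solve a linear system with integer
  coefficients (after clearing denominators); the weights are eliminated by projection.
\<close>

lemma rational_simplex_form_polytope:
  assumes Y: "finite Y" and S: "rational_simplex Y S"
  obtains T where "finite T" "S = form_polytope Y T"
proof -
  obtain V where V: "finite V" "V \<subseteq> Y \<rightarrow>\<^sub>E {0..1}" "\<And>v y. v \<in> V \<Longrightarrow> y \<in> Y \<Longrightarrow> v y \<in> \<rat>" "S = convex hull V"
    using S unfolding rational_simplex_def by blast
  let ?C = "(\<lambda>(v, y). v y) ` (V \<times> Y)"
  have "finite ?C" using V(1) Y by simp
  moreover have "?C \<subseteq> \<rat>" using V(3) by force
  ultimately obtain D :: int where D: "0 < D" "\<And>a. a \<in> ?C \<Longrightarrow> of_int D * a \<in> \<int>"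
    using common_denominator[of ?C] by metis
  have Dv: "real_of_int \<lfloor>of_int D * v y\<rfloor> = of_int D * v y" if "v \<in> V" "y \<in> Y" for v y
  proof (rule of_int_floor)
    have "v y \<in> ?C" using that by force
    then show "of_int D * v y \<in> \<int>" by (rule D(2))
  qed
  \<comment> \<open>\<open>Inl\<close> indexes the coordinates of the point, \<open>Inr\<close> the
    weights on \<open>V\<close>. The equation of coordinate \<open>y\<close> is multiplied by
    \<open>D\<close>; the floor only casts \<open>D * v y\<close>, already integral, to an
    integer.\<close>
  define eqn :: "'a \<Rightarrow> 'a option + ('a \<Rightarrow> real) \<Rightarrow> int" where
    "eqn y = case_sum (\<lambda>w. if w = Some y then D else 0) (\<lambda>v. - \<lfloor>of_int D * v y\<rfloor>)" for y
  define total :: "'a option + ('a \<Rightarrow> real) \<Rightarrow> int" where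
    "total = case_sum (\<lambda>w. if w = None then 1 else 0) (\<lambda>v. - 1)"
  define weight :: "('a \<Rightarrow> real) \<Rightarrow> 'a option + ('a \<Rightarrow> real) \<Rightarrow> int" where
    "weight v = case_sum (\<lambda>w. 0) (\<lambda>u. if u = v then 1 else 0)" for v
  define E where "E = insert total (eqn ` Y)"
  define T0 where "T0 = E \<union> (\<lambda>c w. - c w) ` E \<union> weight ` V"
  let ?A = "Inl ` coords Y :: ('a option + ('a \<Rightarrow> real)) set"
  let ?B = "Inr ` V :: ('a option + ('a \<Rightarrow> real)) set"
  have finT0: "finite T0" using V Y by (simp add: T0_def E_def)
  have "\<exists>T'. finite T' \<and> (\<forall>x. (\<forall>c\<in>T'. 0 \<le> lin ?A c x) \<longleftrightarrow>
      (\<exists>z. \<forall>c\<in>T0. 0 \<le> lin (?A \<union> ?B) c (\<lambda>w. if w \<in> ?B then z w else x w)))"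
    using V Y finT0 by (intro projection) auto
  then obtain T' where T': "finite T'" "\<And>x. (\<forall>c\<in>T'. 0 \<le> lin ?A c x) \<longleftrightarrow>
      (\<exists>z. \<forall>c\<in>T0. 0 \<le> lin (?A \<union> ?B) c (\<lambda>w. if w \<in> ?B then z w else x w))"
    by blast
  have lin_split: "lin (?A \<union> ?B) c (\<lambda>w. if w \<in> ?B then z w else case_sum (homog f) g w) =
      lin (coords Y) (\<lambda>w. c (Inl w)) (homog f) + (\<Sum>v\<in>V. of_int (c (Inr v)) * z (Inr v))" for c f g z
  proof -
    have "lin (?A \<union> ?B) c (\<lambda>w. if w \<in> ?B then z w else case_sum (homog f) g w) =
        (\<Sum>w\<in>?A. of_int (c w) * (if w \<in> ?B then z w else case_sum (homog f) g w)) +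
        (\<Sum>w\<in>?B. of_int (c w) * (if w \<in> ?B then z w else case_sum (homog f) g w))"
      unfolding lin_def using V Y by (intro sum.union_disjoint) auto
    also have "(\<Sum>w\<in>?A. of_int (c w) * (if w \<in> ?B then z w else case_sum (homog f) g w)) =
        lin (coords Y) (\<lambda>w. c (Inl w)) (homog f)"
      unfolding lin_def by (subst sum.reindex) (auto intro!: sum.cong)
    also have "(\<Sum>w\<in>?B. of_int (c w) * (if w \<in> ?B then z w else case_sum (homog f) g w)) =
        (\<Sum>v\<in>V. of_int (c (Inr v)) * z (Inr v))"
      by (subst sum.reindex) (auto intro!: sum.cong)
    finally show ?thesis .
  qed
  have T0_iff: "(\<forall>c\<in>T0. 0 \<le> lin (?A \<union> ?B) c (\<lambda>w. if w \<in> ?B then z w else case_sum (homog f) g w)) \<longleftrightarrow>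
      (\<forall>v\<in>V. 0 \<le> z (Inr v)) \<and> (\<Sum>v\<in>V. z (Inr v)) = 1 \<and> (\<forall>y\<in>Y. f y = (\<Sum>v\<in>V. z (Inr v) * v y))"
    (is "(\<forall>c\<in>T0. 0 \<le> ?lin c) \<longleftrightarrow> _") for f g z
  proof -
    have w: "?lin (weight v) = z (Inr v)" if "v \<in> V" for v
      unfolding lin_split using that V(1) by (simp add: weight_def lin_zero if_distrib[where f = of_int]
          if_distrib[where f = "\<lambda>a. a * _"] cong: if_cong)
    have tot: "?lin total = 1 - (\<Sum>v\<in>V. z (Inr v))"
      unfolding lin_split using lin_single[of "coords Y" None 1 "homog f"] Y
      by (simp add: total_def sum_negf)
    have eq: "?lin (eqn y) = of_int D * (f y - (\<Sum>v\<in>V. z (Inr v) * v y))" if "y \<in> Y" for y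
    proof -
      have "(\<Sum>v\<in>V. of_int (eqn y (Inr v)) * z (Inr v)) = (\<Sum>v\<in>V. - (of_int D * (z (Inr v) * v y)))"
        using Dv that by (intro sum.cong) (auto simp: eqn_def)
      then show ?thesis
        unfolding lin_split using lin_single[of "coords Y" "Some y" D "homog f"] Y that
        by (simp add: eqn_def sum_negf right_diff_distrib flip: sum_distrib_left)
    qed
    have "(\<forall>c\<in>T0. 0 \<le> ?lin c) \<longleftrightarrow> (\<forall>c\<in>E. ?lin c = 0) \<and> (\<forall>v\<in>V. 0 \<le> ?lin (weight v))"
    proof -
      have "(\<forall>c\<in>T0. 0 \<le> ?lin c) \<longleftrightarrow> (\<forall>c\<in>E. 0 \<le> ?lin c \<and> 0 \<le> ?lin (\<lambda>w. - c w)) \<and> (\<forall>v\<in>V. 0 \<le> ?lin (weight v))"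
        unfolding T0_def by blast
      moreover have "0 \<le> a \<and> 0 \<le> - a \<longleftrightarrow> a = 0" for a :: real by auto
      ultimately show ?thesis by (simp only: lin_neg)
    qed
    also have "\<dots> \<longleftrightarrow> ?lin total = 0 \<and> (\<forall>y\<in>Y. ?lin (eqn y) = 0) \<and> (\<forall>v\<in>V. 0 \<le> ?lin (weight v))"
      unfolding E_def by blast
    also have "\<dots> \<longleftrightarrow> (\<Sum>v\<in>V. z (Inr v)) = 1 \<and> (\<forall>y\<in>Y. f y = (\<Sum>v\<in>V. z (Inr v) * v y)) \<and> (\<forall>v\<in>V. 0 \<le> z (Inr v))"
    proof -
      have "?lin total = 0 \<longleftrightarrow> (\<Sum>v\<in>V. z (Inr v)) = 1" unfolding tot by auto
      moreover have "(\<forall>y\<in>Y. ?lin (eqn y) = 0) \<longleftrightarrow> (\<forall>y\<in>Y. f y = (\<Sum>v\<in>V. z (Inr v) * v y))"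
        using D(1) by (intro ball_cong HOL.refl) (simp add: eq del: Un_insert_left image_insert)
      moreover have "(\<forall>v\<in>V. 0 \<le> ?lin (weight v)) \<longleftrightarrow> (\<forall>v\<in>V. 0 \<le> z (Inr v))"
        by (intro ball_cong HOL.refl) (simp only: w)
      ultimately show ?thesis by blast
    qed
    finally show ?thesis by blast
  qed
  have hull: "f \<in> convex hull V \<longleftrightarrow>
      (\<exists>u. (\<forall>v\<in>V. 0 \<le> u v) \<and> sum u V = 1 \<and> (\<forall>y\<in>Y. f y = (\<Sum>v\<in>V. u v * v y)))"
    if f: "f \<in> Y \<rightarrow>\<^sub>E {0..1}" for f
  proof -
    have "(\<Sum>v\<in>V. u v *\<^sub>R v) = f \<longleftrightarrow> (\<forall>y\<in>Y. f y = (\<Sum>v\<in>V. u v * v y))" if u: "sum u V = 1" for u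
    proof -
      \<comment> \<open>Equality of functions also concerns points outside \<open>Y\<close>, where
        every vertex takes the value \<open>undefined\<close> and the weights add up to one.\<close>
      have "(\<Sum>v\<in>V. u v * v y) = f y" if "y \<notin> Y" for y
      proof -
        have "(\<Sum>v\<in>V. u v * v y) = (\<Sum>v\<in>V. u v * undefined)"
          using V(2) that by (intro sum.cong) (auto simp: PiE_iff extensional_def)
        also have "\<dots> = undefined" using u by (simp flip: sum_distrib_right)
        also have "\<dots> = f y" using f that by (auto simp: PiE_iff extensional_def)
        finally show ?thesis .
      qed
      then show ?thesis
        by (simp add: fun_eq_iff sum_fun_apply scaleR_fun_def) metis
    qed
    then show ?thesis
      using V(1) unfolding convex_hull_finite[OF V(1)] by auto
  qed
  show ?thesis
  proof (rule that[of "(\<lambda>c w. c (Inl w)) ` T'"])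
    show "finite ((\<lambda>c w. c (Inl w)) ` T')" using T'(1) by simp
    have lin_Inl: "lin ?A c (case_sum (homog f) g) = lin (coords Y) (\<lambda>w. c (Inl w)) (homog f)" for c f g
      unfolding lin_def by (subst sum.reindex) auto
    have "f \<in> convex hull V \<longleftrightarrow> (\<forall>c\<in>T'. 0 \<le> lin (coords Y) (\<lambda>w. c (Inl w)) (homog f))"
      if f: "f \<in> Y \<rightarrow>\<^sub>E {0..1}" for f
    proof -
      have "(\<forall>c\<in>T'. 0 \<le> lin (coords Y) (\<lambda>w. c (Inl w)) (homog f)) \<longleftrightarrow>
          (\<exists>z :: 'a option + ('a \<Rightarrow> real) \<Rightarrow> real. (\<forall>v\<in>V. 0 \<le> z (Inr v)) \<and>
            (\<Sum>v\<in>V. z (Inr v)) = 1 \<and> (\<forall>y\<in>Y. f y = (\<Sum>v\<in>V. z (Inr v) * v y)))"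
        using T'(2)[of "case_sum (homog f) (\<lambda>_. 0)"] unfolding lin_Inl T0_iff .
      also have "\<dots> \<longleftrightarrow> f \<in> convex hull V"
        unfolding hull[OF f]
      proof
        assume "\<exists>u. (\<forall>v\<in>V. 0 \<le> u v) \<and> sum u V = 1 \<and> (\<forall>y\<in>Y. f y = (\<Sum>v\<in>V. u v * v y))"
        then obtain u where u: "\<forall>v\<in>V. 0 \<le> u v" "sum u V = 1" "\<forall>y\<in>Y. f y = (\<Sum>v\<in>V. u v * v y)" by blast
        then show "\<exists>z :: 'a option + ('a \<Rightarrow> real) \<Rightarrow> real. (\<forall>v\<in>V. 0 \<le> z (Inr v)) \<and>
            (\<Sum>v\<in>V. z (Inr v)) = 1 \<and> (\<forall>y\<in>Y. f y = (\<Sum>v\<in>V. z (Inr v) * v y))"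
          by (intro exI[of _ "case_sum (\<lambda>_. 0) u"]) simp
      next
        assume "\<exists>z :: 'a option + ('a \<Rightarrow> real) \<Rightarrow> real. (\<forall>v\<in>V. 0 \<le> z (Inr v)) \<and>
            (\<Sum>v\<in>V. z (Inr v)) = 1 \<and> (\<forall>y\<in>Y. f y = (\<Sum>v\<in>V. z (Inr v) * v y))"
        then obtain z :: "'a option + ('a \<Rightarrow> real) \<Rightarrow> real" where "\<forall>v\<in>V. 0 \<le> z (Inr v)"
          "(\<Sum>v\<in>V. z (Inr v)) = 1" "\<forall>y\<in>Y. f y = (\<Sum>v\<in>V. z (Inr v) * v y)" by blast
        then show "\<exists>u. (\<forall>v\<in>V. 0 \<le> u v) \<and> sum u V = 1 \<and> (\<forall>y\<in>Y. f y = (\<Sum>v\<in>V. u v * v y))"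
          by (intro exI[of _ "\<lambda>v. z (Inr v)"]) simp
      qed
      finally show ?thesis by (rule HOL.sym)
    qed
    moreover have "convex hull V \<subseteq> Y \<rightarrow>\<^sub>E {0..1}"
    proof (rule hull_minimal[OF V(2)])
      interpret rational_polytope Y "{}" by unfold_locales (use Y in auto)
      show "convex (Y \<rightarrow>\<^sub>E {0..1::real})" using convex_Q by (simp add: form_polytope_def)
    qed
    ultimately show "S = form_polytope Y ((\<lambda>c w. c (Inl w)) ` T')"
      unfolding V(4) form_polytope_def ball_simps by blast
  qed
qed

section \<open>Rational polyhedra as zero sets of terms\<close>

abbreviation clip :: "real \<Rightarrow> real" where "clip a \<equiv> max 0 (min 1 a)"

definition represents :: "'k set \<Rightarrow> 'k mv_term \<Rightarrow> (('k \<Rightarrow> real) \<Rightarrow> real) \<Rightarrow> bool" where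
  "represents Y s F \<longleftrightarrow> mv_vars s \<subseteq> Y \<and> (\<forall>v. (\<forall>k\<in>Y. v k \<in> {0..1}) \<longrightarrow> mv_eval unit_mv v s = F v)"

text \<open>
  The induction rests on \<open>clip (a + x) = (clip a \<oplus> x) \<odot> clip (a + 1)\<close> for \<open>0 \<le> x \<le> 1\<close>, and on
  \<open>clip (1 - a) = 1 - clip a\<close> to exchange positive and negative coefficients.
\<close>

lemma clip_represented:
  fixes c :: "'k option \<Rightarrow> int"
  assumes Y: "finite Y"
  shows "\<exists>s. represents Y s (\<lambda>v. clip (lin (coords Y) c (homog v)))"
proof (induction "\<Sum>k\<in>Y. nat \<bar>c (Some k)\<bar>" arbitrary: c rule: less_induct)
  case less
  have lin_eq: "lin (coords Y) c (homog v) = of_int (c None) + (\<Sum>k\<in>Y. of_int (c (Some k)) * v k)"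
    for c and v :: "'k \<Rightarrow> real"
    using Y by (simp add: lin_def sum.reindex)
  have pos: "\<exists>s. represents Y s (\<lambda>v. clip (lin (coords Y) d (homog v)))"
    if k: "k \<in> Y" "0 < d (Some k)" and d: "(\<Sum>k\<in>Y. nat \<bar>d (Some k)\<bar>) = (\<Sum>k\<in>Y. nat \<bar>c (Some k)\<bar>)" for k d
  proof -
    \<comment> \<open>The measure omits the constant coefficient, so the shift by one in
      \<open>e1\<close> is free and the induction hypothesis covers both \<open>e\<close> and
      \<open>e1\<close>.\<close>
    define e where "e = d(Some k := d (Some k) - 1)"
    define e1 where "e1 = e(None := e None + 1)"
    have "(\<Sum>j\<in>Y. nat \<bar>e (Some j)\<bar>) < (\<Sum>j\<in>Y. nat \<bar>d (Some j)\<bar>)"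
      using Y k by (intro sum_strict_mono_ex1) (auto simp: e_def intro!: bexI[of _ k])
    then have e: "(\<Sum>j\<in>Y. nat \<bar>e (Some j)\<bar>) < (\<Sum>k\<in>Y. nat \<bar>c (Some k)\<bar>)" using d by simp
    obtain s where s: "represents Y s (\<lambda>v. clip (lin (coords Y) e (homog v)))"
      using less.hyps[OF e] by blast
    obtain s1 where s1: "represents Y s1 (\<lambda>v. clip (lin (coords Y) e1 (homog v)))"
      using less.hyps[of e1] e by (auto simp: e1_def)
    have lin_d: "lin (coords Y) d (homog v) = lin (coords Y) e (homog v) + v k"
      and lin_e1: "lin (coords Y) e1 (homog v) = lin (coords Y) e (homog v) + 1" for v :: "'k \<Rightarrow> real"
    proof -
      have "(\<Sum>j\<in>Y. of_int (d (Some j)) * v j) = (\<Sum>j\<in>Y. of_int (e (Some j)) * v j) + v k"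
        using Y k(1) by (simp add: sum.remove[OF Y k(1)] e_def algebra_simps)
      then show "lin (coords Y) d (homog v) = lin (coords Y) e (homog v) + v k"
        by (simp add: lin_eq e_def)
      show "lin (coords Y) e1 (homog v) = lin (coords Y) e (homog v) + 1"
        by (simp add: lin_eq e1_def)
    qed
    have "represents Y (Neg (Oplus (Neg (Oplus s (Gen k))) (Neg s1)))
        (\<lambda>v. clip (lin (coords Y) d (homog v)))"
      unfolding represents_def
    proof (intro conjI allI impI)
      show "mv_vars (Neg (Oplus (Neg (Oplus s (Gen k))) (Neg s1))) \<subseteq> Y"
        using s s1 k(1) by (simp add: represents_def)
      fix v :: "'k \<Rightarrow> real" assume v: "\<forall>k\<in>Y. v k \<in> {0..1}"
      let ?a = "lin (coords Y) e (homog v)"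
      have "mv_eval unit_mv v s = clip ?a" "mv_eval unit_mv v s1 = clip (?a + 1)"
        using s s1 v by (simp_all add: represents_def lin_e1)
      moreover have "0 \<le> v k" "v k \<le> 1" using v k(1) by auto
      then have "1 - min 1 ((1 - min 1 (clip ?a + v k)) + (1 - clip (?a + 1))) = clip (?a + v k)"
        by linarith
      ultimately show "mv_eval unit_mv v (Neg (Oplus (Neg (Oplus s (Gen k))) (Neg s1))) =
          clip (lin (coords Y) d (homog v))"
        by (simp only: mv_eval.simps unit_mv_simps lin_d)
    qed
    then show ?thesis by blast
  qed
  show ?case
  proof (cases "\<exists>k\<in>Y. c (Some k) \<noteq> 0")
    case False
    have "represents Y (if c None \<le> 0 then Zero else Neg Zero) (\<lambda>v. clip (lin (coords Y) c (homog v)))"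
    proof -
      have "lin (coords Y) c (homog v) = of_int (c None)" for v :: "'k \<Rightarrow> real"
        unfolding lin_eq using False by simp
      then show ?thesis by (auto simp: represents_def)
    qed
    then show ?thesis by blast
  next
    case True
    then obtain k where k: "k \<in> Y" "c (Some k) \<noteq> 0" by blast
    show ?thesis
    proof (cases "0 < c (Some k)")
      case True
      then show ?thesis using pos[where k = k and d = c] k(1) True by simp
    next
      case neg: False
      \<comment> \<open>Complementing flips the signs of all variable coefficients and so keeps the
        measure; \<open>pos\<close> is stated for any form of the same measure to admit this
        one.\<close>
      have "0 < compl_form c (Some k)" using neg k(2) by (simp add: compl_form_def unit_form_def)
      moreover have "(\<Sum>k\<in>Y. nat \<bar>compl_form c (Some k)\<bar>) = (\<Sum>k\<in>Y. nat \<bar>c (Some k)\<bar>)"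
        by (simp add: compl_form_def unit_form_def)
      ultimately obtain s where s: "represents Y s (\<lambda>v. clip (lin (coords Y) (compl_form c) (homog v)))"
        using pos[where k = k and d = "compl_form c"] k(1) by blast
      have "1 - clip (1 - a) = clip a" for a :: real
        by linarith
      then have "represents Y (Neg s) (\<lambda>v. clip (lin (coords Y) c (homog v)))"
        using s unfolding represents_def lin_compl_form[OF Y] by simp
      then show ?thesis by blast
    qed
  qed
qed

text \<open>The inequality \<open>c \<ge> 0\<close> is the vanishing of the clipped form
  \<open>- c\<close>, and a sum of nonnegative values vanishes iff both summands do.\<close>

lemma form_polytope_zero_set:
  assumes Y: "finite Y" and T: "finite T"
  shows "\<exists>s. mv_vars s \<subseteq> Y \<and> (\<forall>f\<in>Y \<rightarrow>\<^sub>E {0..1}. mv_eval unit_mv f s = 0 \<longleftrightarrow> f \<in> form_polytope Y T)"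
  using T
proof (induction T rule: finite_induct)
  case empty
  then show ?case by (intro exI[of _ Zero]) (auto simp: form_polytope_def)
next
  case (insert c T)
  then obtain s where s: "mv_vars s \<subseteq> Y"
    "\<And>f. f \<in> Y \<rightarrow>\<^sub>E {0..1} \<Longrightarrow> mv_eval unit_mv f s = 0 \<longleftrightarrow> f \<in> form_polytope Y T" by blast
  obtain t where t: "represents Y t (\<lambda>v. clip (lin (coords Y) (\<lambda>w. - c w) (homog v)))"
    using clip_represented[OF Y] by blast
  have "mv_eval unit_mv f (Oplus s t) = 0 \<longleftrightarrow> f \<in> form_polytope Y (insert c T)" if f: "f \<in> Y \<rightarrow>\<^sub>E {0..1}" for f
  proof -
    have f': "\<forall>k\<in>Y. f k \<in> {0..1}" using f by auto
    have "0 \<le> mv_eval unit_mv f s" using mv_eval_unit_bounds[of s f] s(1) f' by auto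
    moreover have "mv_eval unit_mv f t = clip (- lin (coords Y) c (homog f))"
      using t f' by (simp add: represents_def lin_neg)
    ultimately have "mv_eval unit_mv f (Oplus s t) = 0 \<longleftrightarrow>
        mv_eval unit_mv f s = 0 \<and> 0 \<le> lin (coords Y) c (homog f)"
      by (auto simp: min_def max_def)
    also have "\<dots> \<longleftrightarrow> f \<in> form_polytope Y (insert c T)"
      unfolding s(2)[OF f] by (auto simp: form_polytope_def)
    finally show ?thesis .
  qed
  moreover have "mv_vars (Oplus s t) \<subseteq> Y" using s t by (simp add: represents_def)
  ultimately show ?case by blast
qed

text \<open>Each simplex is a zero set by its inequalities, and a union of zero sets is the zero set
  of a minimum; the empty union is that of the constant one.\<close>

lemma rational_polyhedron_is_zero_set:
  assumes Y: "finite Y" and P: "rational_polyhedron Y P"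
  obtains s where "mv_vars s \<subseteq> Y" "\<And>f. f \<in> Y \<rightarrow>\<^sub>E {0..1} \<Longrightarrow> mv_eval unit_mv f s = 0 \<longleftrightarrow> f \<in> P"
proof -
  obtain \<S> where \<S>: "finite \<S>" "\<And>S. S \<in> \<S> \<Longrightarrow> rational_simplex Y S" "P = \<Union>\<S>"
    using P by (auto simp: rational_polyhedron_def)
  have "\<exists>s. mv_vars s \<subseteq> Y \<and> (\<forall>f\<in>Y \<rightarrow>\<^sub>E {0..1}. mv_eval unit_mv f s = 0 \<longleftrightarrow> f \<in> \<Union>\<S>)"
    using \<S>(1,2)
  proof (induction \<S> rule: finite_induct)
    case empty
    then show ?case by (intro exI[of _ "Neg Zero"]) simp
  next
    case (insert S \<S>)
    then obtain s where s: "mv_vars s \<subseteq> Y"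
      "\<And>f. f \<in> Y \<rightarrow>\<^sub>E {0..1} \<Longrightarrow> mv_eval unit_mv f s = 0 \<longleftrightarrow> f \<in> \<Union>\<S>" by auto
    obtain T where T: "finite T" "S = form_polytope Y T"
      using rational_simplex_form_polytope[OF Y] insert.prems by blast
    obtain t where t: "mv_vars t \<subseteq> Y"
      "\<And>f. f \<in> Y \<rightarrow>\<^sub>E {0..1} \<Longrightarrow> mv_eval unit_mv f t = 0 \<longleftrightarrow> f \<in> S"
      using form_polytope_zero_set[OF Y T(1)] T(2) by blast
    \<comment> \<open>this term evaluates to the minimum of \<open>s\<close> and \<open>t\<close>\<close>
    define u where "u = Neg (Oplus (Neg s) (Neg (Oplus (Neg s) t)))"
    have "mv_eval unit_mv f u = 0 \<longleftrightarrow> f \<in> \<Union>(insert S \<S>)" if f: "f \<in> Y \<rightarrow>\<^sub>E {0..1}" for f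
    proof -
      have "mv_eval unit_mv f s \<in> {0..1}" "mv_eval unit_mv f t \<in> {0..1}"
        using mv_eval_unit_bounds[of _ f] s(1) t(1) f by (auto simp: subset_iff PiE_iff)
      then have "mv_eval unit_mv f u = 0 \<longleftrightarrow> mv_eval unit_mv f s = 0 \<or> mv_eval unit_mv f t = 0"
        by (auto simp: u_def min_def)
      then show ?thesis using s(2)[OF f] t(2)[OF f] by auto
    qed
    moreover have "mv_vars u \<subseteq> Y" using s t by (simp add: u_def)
    ultimately show ?case by blast
  qed
  with that \<S>(3) show ?thesis by blast
qed

definition zero_set :: "'k set \<Rightarrow> 'k mv_term \<Rightarrow> ('k \<Rightarrow> real) set" where
  "zero_set K s = {f \<in> K \<rightarrow>\<^sub>E {0..1}. mv_eval unit_mv f s = 0}"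

text \<open>A term has finitely many variables, so even for infinite \<open>K\<close> its zero set
  is a cylinder over the finite cube on them.\<close>

theorem Cypol_eq_zero_sets: "Cypol K = zero_set K ` {s. mv_vars s \<subseteq> K}"
proof
  have eval: "mv_eval unit_mv (restrict f Y) s = mv_eval unit_mv f s" if "mv_vars s \<subseteq> Y"
    for f :: "'a \<Rightarrow> real" and Y s
    using that by (intro mv_eval_cong) auto
  show "Cypol K \<subseteq> zero_set K ` {s. mv_vars s \<subseteq> K}"
  proof
    fix P assume "P \<in> Cypol K"
    then obtain Y P0 where *: "finite Y" "Y \<subseteq> K" "rational_polyhedron Y P0"
      "P = {f \<in> K \<rightarrow>\<^sub>E {0..1}. restrict f Y \<in> P0}"
      unfolding Cypol_def by blast
    obtain s where s: "mv_vars s \<subseteq> Y" "\<And>f. f \<in> Y \<rightarrow>\<^sub>E {0..1} \<Longrightarrow> mv_eval unit_mv f s = 0 \<longleftrightarrow> f \<in> P0"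
      using rational_polyhedron_is_zero_set[OF *(1,3)] by blast
    have "restrict f Y \<in> P0 \<longleftrightarrow> mv_eval unit_mv f s = 0" if "f \<in> K \<rightarrow>\<^sub>E {0..1}" for f
    proof -
      have "restrict f Y \<in> Y \<rightarrow>\<^sub>E {0..1}" 
        unfolding restrict_PiE_iff using that *(2) by (meson PiE_mem subsetD)
      then have "mv_eval unit_mv (restrict f Y) s = 0 \<longleftrightarrow> restrict f Y \<in> P0" by (rule s(2))
      then show ?thesis unfolding eval[OF s(1)] by blast
    qed
    then have "P = zero_set K s" unfolding *(4) zero_set_def by blast
    then show "P \<in> zero_set K ` {s. mv_vars s \<subseteq> K}" using s(1) *(2) by blast
  qed
  show "zero_set K ` {s. mv_vars s \<subseteq> K} \<subseteq> Cypol K"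
  proof clarify
    fix s :: "'a mv_term" assume s: "mv_vars s \<subseteq> K"
    let ?P0 = "{f \<in> mv_vars s \<rightarrow>\<^sub>E {0..1}. mv_eval unit_mv f s = 0}"
    have "restrict f (mv_vars s) \<in> ?P0 \<longleftrightarrow> mv_eval unit_mv f s = 0" if "f \<in> K \<rightarrow>\<^sub>E {0..1}" for f
    proof -
      have "restrict f (mv_vars s) \<in> mv_vars s \<rightarrow>\<^sub>E {0..1}"
        unfolding restrict_PiE_iff using that s by (meson PiE_mem subsetD)
      then show ?thesis by (simp add: eval)
    qed
    then have "zero_set K s = {f \<in> K \<rightarrow>\<^sub>E {0..1}. restrict f (mv_vars s) \<in> ?P0}"
      unfolding zero_set_def by blast
    moreover have "rational_polyhedron (mv_vars s) ?P0"
      by (rule rational_polyhedron_zero_set[OF finite_mv_vars order.refl])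
    ultimately have "zero_set K s = {f \<in> K \<rightarrow>\<^sub>E {0..1}. restrict f (mv_vars s) \<in> ?P0} \<and>
        finite (mv_vars s) \<and> mv_vars s \<subseteq> K \<and> rational_polyhedron (mv_vars s) ?P0"
      using s finite_mv_vars by (intro conjI)
    then show "zero_set K s \<in> Cypol K"
      unfolding Cypol_def by (intro CollectI exI)
  qed
qed


section \<open>Spectral spaces\<close>

lemma compact_opens_openin: "U \<in> compact_opens X \<Longrightarrow> openin X U"
  by (simp add: compact_opens_def)

lemma compact_opens_subset: "U \<in> compact_opens X \<Longrightarrow> U \<subseteq> topspace X"
  by (simp add: compact_opens_def openin_subset)

lemma compact_opens_Union: "finite F \<Longrightarrow> F \<subseteq> compact_opens X \<Longrightarrow> \<Union>F \<in> compact_opens X"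
  unfolding compact_opens_def by (blast intro: compactin_Union openin_Union)

lemma spectral_space_basis:
  assumes "spectral_space X" "openin X U" "x \<in> U"
  obtains V where "V \<in> compact_opens X" "x \<in> V" "V \<subseteq> U"
proof -
  have "openin X = arbitrary union_of (\<lambda>U. U \<in> compact_opens X)"
    using assms(1) unfolding spectral_space_def by blast
  then have "(arbitrary union_of (\<lambda>U. U \<in> compact_opens X)) U"
    using assms(2) by (simp only:)
  then show ?thesis using that assms(3) unfolding arbitrary_union_of_alt by blast
qed

lemma irreducible_closedin_closure:
  assumes "x \<in> topspace X"
  shows "irreducible_closedin X (X closure_of {x})"
  unfolding irreducible_closedin_def
proof (intro conjI allI impI)
  have x: "x \<in> X closure_of {x}" using assms by (simp add: in_closure_of)
  then show "X closure_of {x} \<noteq> {}" by blast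
  fix D E assume *: "closedin X D \<and> closedin X E \<and> X closure_of {x} = D \<union> E"
  then have "x \<in> D \<or> x \<in> E" using x by blast
  then show "X closure_of {x} = D \<or> X closure_of {x} = E"
    using * closure_of_minimal[of "{x}" D X] closure_of_minimal[of "{x}" E X] by blast
qed simp

text \<open>Compact open sets form a basis, so the two points lie in the same open sets and have the
  same closure; generic points are unique by sobriety.\<close>

lemma spectral_space_eqI:
  assumes X: "spectral_space X" and xy: "x \<in> topspace X" "y \<in> topspace X"
    and eq: "\<And>U. U \<in> compact_opens X \<Longrightarrow> x \<in> U \<longleftrightarrow> y \<in> U"
  shows "x = y"
proof -
  have open_eq: "x \<in> U \<longleftrightarrow> y \<in> U" if "openin X U" for U
    using spectral_space_basis[OF X that] eq by (metis subsetD)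
  have "X closure_of {x} = X closure_of {y}"
    using open_eq by (auto simp: in_closure_of)
  moreover have "\<exists>!z. z \<in> topspace X \<and> X closure_of {x} = X closure_of {z}"
    using X irreducible_closedin_closure[OF xy(1)] unfolding spectral_space_def sober_space_def by blast
  ultimately show ?thesis using xy by blast
qed

text \<open>
  The image of \<open>x\<close> is the generic point of the complement of the union of all \<open>\<phi> U\<close> with \<open>x \<notin> U\<close>.
\<close>

lemma generic_point:
  assumes X: "spectral_space X" and S: "spectral_space S"
    and \<phi>: "bij_betw \<phi> (compact_opens X) (compact_opens S)"
    and mono: "\<And>U V. \<lbrakk>U \<in> compact_opens X; V \<in> compact_opens X\<rbrakk> \<Longrightarrow> U \<subseteq> V \<longleftrightarrow> \<phi> U \<subseteq> \<phi> V"
    and x: "x \<in> topspace X"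
  shows "\<exists>y\<in>topspace S. \<forall>U\<in>compact_opens X. y \<in> \<phi> U \<longleftrightarrow> x \<in> U"
proof -
  let ?KX = "compact_opens X" and ?KS = "compact_opens S"
  have \<phi>K: "\<phi> U \<in> ?KS" if "U \<in> ?KX" for U
    using bij_betwE[OF \<phi>] that by blast
  define W where "W = \<Union>(\<phi> ` {U \<in> ?KX. x \<notin> U})"
  define C where "C = topspace S - W"
  \<comment> \<open>Compactness puts \<phi> V below finitely many \<phi> U with x not in U, hence
    below the image of their union, again a compact open set omitting x; now the order can be
    reflected.\<close>
  have key: "\<phi> V \<subseteq> W \<longleftrightarrow> x \<notin> V" if V: "V \<in> ?KX" for V
  proof
    assume sub: "\<phi> V \<subseteq> W"
    have "compactin S (\<phi> V)" using \<phi>K[OF V] by (simp add: compact_opens_def)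
    then have "\<exists>F. finite F \<and> F \<subseteq> \<phi> ` {U \<in> ?KX. x \<notin> U} \<and> \<phi> V \<subseteq> \<Union>F"
    proof (rule compactinD)
      show "openin S U" if "U \<in> \<phi> ` {U \<in> ?KX. x \<notin> U}" for U
        using that \<phi>K compact_opens_openin by blast
    qed (use sub W_def in simp)
    then obtain F where F: "finite F" "F \<subseteq> \<phi> ` {U \<in> ?KX. x \<notin> U}" "\<phi> V \<subseteq> \<Union>F" by blast
    obtain G where G: "G \<subseteq> {U \<in> ?KX. x \<notin> U}" "finite G" "F = \<phi> ` G"
      using finite_subset_image[OF F(1,2)] by blast
    have GK: "\<Union>G \<in> ?KX"
      by (rule compact_opens_Union[OF G(2)]) (use G(1) in blast)
    have "\<phi> U \<subseteq> \<phi> (\<Union>G)" if "U \<in> G" for U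
      using that G(1) mono[OF _ GK, of U] by blast
    then have "\<phi> V \<subseteq> \<phi> (\<Union>G)" using F(3) G(3) by blast
    then have "V \<subseteq> \<Union>G" using mono[OF V GK] by blast
    then show "x \<notin> V" using G(1) by blast
  next
    assume "x \<notin> V"
    then show "\<phi> V \<subseteq> W" using V unfolding W_def by blast
  qed
  have meets: "\<phi> V \<inter> C \<noteq> {} \<longleftrightarrow> x \<in> V" if V: "V \<in> ?KX" for V
    using key[OF V] compact_opens_subset[OF \<phi>K[OF V]] unfolding C_def by blast
  have "irreducible_closedin S C"
    unfolding irreducible_closedin_def
  proof (intro conjI allI impI)
    have "openin S W"
      unfolding W_def
    proof (rule openin_Union)
      fix U assume "U \<in> \<phi> ` {U \<in> ?KX. x \<notin> U}"
      then show "openin S U" using \<phi>K compact_opens_openin by blast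
    qed
    then show "closedin S C" unfolding C_def by (intro closedin_diff closedin_topspace)
    obtain V where V: "V \<in> ?KX" "x \<in> V" "V \<subseteq> topspace X"
      by (rule spectral_space_basis[OF X openin_topspace x])
    show "C \<noteq> {}" using meets[OF V(1)] V(2) by blast
    fix D E assume DE: "closedin S D \<and> closedin S E \<and> C = D \<union> E"
    \<comment> \<open>For irreducibility: if \<open>C\<close> were contained neither in
      \<open>D\<close> nor in \<open>E\<close>, this would give two compact open neighbourhoods of
      \<open>x\<close>. The image of their intersection would miss \<open>D\<close> and
      \<open>E\<close>, hence \<open>C\<close>, although the intersection contains
      \<open>x\<close>.\<close>
    have nbh: "\<exists>V\<in>?KX. x \<in> V \<and> \<phi> V \<inter> D = {}" if D: "closedin S D" and c: "c \<in> C" "c \<notin> D" for D c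
    proof -
      have "openin S (topspace S - D)" by (rule openin_diff[OF openin_topspace D])
      moreover have "c \<in> topspace S - D" using c by (simp add: C_def)
      ultimately obtain V' where V': "V' \<in> ?KS" "c \<in> V'" "V' \<subseteq> topspace S - D"
        by (rule spectral_space_basis[OF S])
      have "V' \<in> \<phi> ` ?KX" unfolding bij_betw_imp_surj_on[OF \<phi>] by (rule V'(1))
      then obtain V where V: "V \<in> ?KX" "V' = \<phi> V" by blast
      have "x \<in> V" using meets[OF V(1)] V' c(1) V(2) by blast
      then show ?thesis using V V' by blast
    qed
    show "C = D \<or> C = E"
    proof (rule ccontr)
      assume "\<not> ?thesis"
      then obtain c d where "c \<in> C" "c \<notin> D" "d \<in> C" "d \<notin> E" using DE by blast
      with nbh[of D c] nbh[of E d] DE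
      obtain V1 V2 where V: "V1 \<in> ?KX" "x \<in> V1" "\<phi> V1 \<inter> D = {}" "V2 \<in> ?KX" "x \<in> V2" "\<phi> V2 \<inter> E = {}"
        by metis
      then have V12: "V1 \<inter> V2 \<in> ?KX" using X unfolding spectral_space_def by blast
      then have "\<phi> (V1 \<inter> V2) \<inter> C \<noteq> {}" using meets V by blast
      moreover have "\<phi> (V1 \<inter> V2) \<subseteq> \<phi> V1" "\<phi> (V1 \<inter> V2) \<subseteq> \<phi> V2"
        using mono[OF V12 V(1)] mono[OF V12 V(4)] by blast+
      ultimately show False using V(3,6) DE by blast
    qed
  qed
  then obtain y where y: "y \<in> topspace S" "C = S closure_of {y}"
    using S unfolding spectral_space_def sober_space_def by blast
  show ?thesis
  proof (rule bexI[OF _ y(1)], rule ballI)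
    fix U assume U: "U \<in> ?KX"
    have "\<phi> U \<inter> C = {} \<longleftrightarrow> \<phi> U \<inter> {y} = {}"
      unfolding y(2) using \<phi>K[OF U] by (intro openin_Int_closure_of_eq_empty compact_opens_openin)
    then show "y \<in> \<phi> U \<longleftrightarrow> x \<in> U" using meets[OF U] by blast
  qed
qed

text \<open>The preimage of the basic set \<phi> U is U.\<close>

lemma continuous_map_compact_opens:
  assumes S: "spectral_space S" and h: "h \<in> topspace X \<rightarrow> topspace S"
    and \<phi>: "\<phi> ` compact_opens X = compact_opens S"
    and pre: "\<And>x U. x \<in> topspace X \<Longrightarrow> U \<in> compact_opens X \<Longrightarrow> h x \<in> \<phi> U \<longleftrightarrow> x \<in> U"
  shows "continuous_map X S h"
  unfolding continuous_map_def
proof (intro conjI allI impI h)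
  fix W assume W: "openin S W"
  show "openin X {x \<in> topspace X. h x \<in> W}"
  proof (subst openin_subopen, intro ballI)
    fix x assume "x \<in> {x \<in> topspace X. h x \<in> W}"
    then have x: "x \<in> topspace X" "h x \<in> W" by auto
    obtain V where V: "V \<in> compact_opens S" "h x \<in> V" "V \<subseteq> W"
      by (rule spectral_space_basis[OF S W x(2)])
    from V(1) obtain U where U: "U \<in> compact_opens X" "V = \<phi> U"
      unfolding \<phi>[symmetric] by (rule imageE)
    have "U \<subseteq> {x \<in> topspace X. h x \<in> W}"
    proof
      fix z assume "z \<in> U"
      moreover from this have "z \<in> topspace X" using compact_opens_subset[OF U(1)] by blast
      ultimately show "z \<in> {x \<in> topspace X. h x \<in> W}"
        using pre[of z U] U V(3) by blast
    qed
    moreover have "x \<in> U" using pre[OF x(1) U(1)] V(2) U(2) by simp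
    ultimately show "\<exists>T. openin X T \<and> x \<in> T \<and> T \<subseteq> {x \<in> topspace X. h x \<in> W}"
      using compact_opens_openin[OF U(1)] by blast
  qed
qed

text \<open>\<open>generic_point\<close> applied to \<phi> and to its inverse gives maps in both
  directions; they are mutually inverse because compact open sets separate points.\<close>

theorem spectral_spaces_homeomorphic:
  assumes X: "spectral_space X" and S: "spectral_space S"
    and \<phi>: "bij_betw \<phi> (compact_opens X) (compact_opens S)"
    and mono: "\<And>U V. \<lbrakk>U \<in> compact_opens X; V \<in> compact_opens X\<rbrakk> \<Longrightarrow> U \<subseteq> V \<longleftrightarrow> \<phi> U \<subseteq> \<phi> V"
  shows "X homeomorphic_space S"
proof -
  let ?KX = "compact_opens X" and ?KS = "compact_opens S"
  define \<psi> where "\<psi> = inv_into ?KX \<phi>"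
  have \<psi>: "bij_betw \<psi> ?KS ?KX"
    unfolding \<psi>_def by (rule bij_betw_inv_into[OF \<phi>])
  have \<psi>\<phi>: "\<psi> (\<phi> U) = U" if "U \<in> ?KX" for U
    using that \<phi> by (simp add: \<psi>_def bij_betw_def)
  have \<phi>\<psi>: "\<phi> (\<psi> V) = V" if "V \<in> ?KS" for V
    using that \<phi> by (simp add: \<psi>_def bij_betw_def f_inv_into_f)
  have \<phi>K: "\<phi> ` ?KX = ?KS" and \<psi>K: "\<psi> ` ?KS = ?KX"
    using \<phi> \<psi> by (simp_all add: bij_betw_def)
  have mono': "U \<subseteq> V \<longleftrightarrow> \<psi> U \<subseteq> \<psi> V" if "U \<in> ?KS" "V \<in> ?KS" for U V
  proof -
    have "\<psi> U \<in> ?KX" "\<psi> V \<in> ?KX" using that \<psi>K by blast+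
    then show ?thesis using mono[of "\<psi> U" "\<psi> V"] \<phi>\<psi>[OF that(1)] \<phi>\<psi>[OF that(2)] by simp
  qed
  have "\<forall>x\<in>topspace X. \<exists>y\<in>topspace S. \<forall>U\<in>?KX. y \<in> \<phi> U \<longleftrightarrow> x \<in> U"
    by (intro ballI generic_point[OF X S \<phi> mono])
  then obtain h where h: "\<And>x. x \<in> topspace X \<Longrightarrow> h x \<in> topspace S"
    "\<And>x U. x \<in> topspace X \<Longrightarrow> U \<in> ?KX \<Longrightarrow> h x \<in> \<phi> U \<longleftrightarrow> x \<in> U"
    by metis
  have "\<forall>y\<in>topspace S. \<exists>x\<in>topspace X. \<forall>V\<in>?KS. x \<in> \<psi> V \<longleftrightarrow> y \<in> V"
    by (intro ballI generic_point[OF S X \<psi> mono'])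
  then obtain k where k: "\<And>y. y \<in> topspace S \<Longrightarrow> k y \<in> topspace X"
    "\<And>y V. y \<in> topspace S \<Longrightarrow> V \<in> ?KS \<Longrightarrow> k y \<in> \<psi> V \<longleftrightarrow> y \<in> V"
    by metis
  have "k (h x) = x" if "x \<in> topspace X" for x
  proof (rule spectral_space_eqI[OF X])
    fix U assume U: "U \<in> ?KX"
    then have "\<phi> U \<in> ?KS" using \<phi>K by blast
    then show "k (h x) \<in> U \<longleftrightarrow> x \<in> U"
      using k(2)[OF h(1)[OF that], of "\<phi> U"] h(2)[OF that U] \<psi>\<phi>[OF U] by simp
  qed (use that h(1) k(1) in blast)+
  moreover have "h (k y) = y" if "y \<in> topspace S" for y
  proof (rule spectral_space_eqI[OF S])
    fix V assume V: "V \<in> ?KS"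
    then have "\<psi> V \<in> ?KX" using \<psi>K by blast
    then show "h (k y) \<in> V \<longleftrightarrow> y \<in> V"
      using h(2)[OF k(1)[OF that], of "\<psi> V"] k(2)[OF that V] \<phi>\<psi>[OF V] by simp
  qed (use that h(1) k(1) in blast)+
  moreover have "continuous_map X S h"
    by (rule continuous_map_compact_opens[OF S _ \<phi>K h(2)]) (use h(1) in blast)
  moreover have "continuous_map S X k"
    by (rule continuous_map_compact_opens[OF X _ \<psi>K k(2)]) (use k(1) in blast)
  ultimately have "homeomorphic_maps X S h k"
    by (simp add: homeomorphic_maps_def)
  then show ?thesis by (rule homeomorphic_maps_imp_homeomorphic_space)
qed

lemma compact_opens_homeomorphic:
  assumes f: "homeomorphic_map X S f"
  shows "bij_betw ((`) f) (compact_opens X) (compact_opens S)"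
    "\<And>U V. \<lbrakk>U \<in> compact_opens X; V \<in> compact_opens X\<rbrakk> \<Longrightarrow> U \<subseteq> V \<longleftrightarrow> f ` U \<subseteq> f ` V"
proof -
  have inj: "inj_on f (topspace X)" and surj: "f ` topspace X = topspace S"
    using f by (simp_all add: homeomorphic_imp_injective_map homeomorphic_imp_surjective_map)
  have iff: "f ` U \<in> compact_opens S \<longleftrightarrow> U \<in> compact_opens X" if "U \<subseteq> topspace X" for U
    using that homeomorphic_map_openness[OF f that] homeomorphic_map_compactness[OF f that]
    by (simp add: compact_opens_def)
  show le: "U \<subseteq> V \<longleftrightarrow> f ` U \<subseteq> f ` V" if "U \<in> compact_opens X" "V \<in> compact_opens X" for U V
    using inj_on_image_subset_iff[OF inj, of U V] compact_opens_subset that by blast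
  show "bij_betw ((`) f) (compact_opens X) (compact_opens S)"
    unfolding bij_betw_def
  proof
    show "inj_on ((`) f) (compact_opens X)"
      using le by (intro inj_onI) (metis order.refl subset_antisym)
    show "(`) f ` compact_opens X = compact_opens S"
    proof
      show "(`) f ` compact_opens X \<subseteq> compact_opens S"
        using iff compact_opens_subset by blast
      show "compact_opens S \<subseteq> (`) f ` compact_opens X"
      proof
        fix V assume V: "V \<in> compact_opens S"
        then have "V \<subseteq> f ` topspace X" using compact_opens_subset surj by blast
        then obtain U where "U \<subseteq> topspace X" "V = f ` U" by (auto simp: subset_image_iff)
        then show "V \<in> (`) f ` compact_opens X" using V iff by blast
      qed
    qed
  qed
qed

lemma spectral_space_homeomorphic:
  assumes XS: "X homeomorphic_space S" and S: "spectral_space S"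
  shows "spectral_space X"
proof -
  obtain f where f: "homeomorphic_map X S f"
    using XS homeomorphic_space by blast
  have inj: "inj_on f (topspace X)" and surj: "f ` topspace X = topspace S"
    using f by (simp_all add: homeomorphic_imp_injective_map homeomorphic_imp_surjective_map)
  have inj_sub: "A = B" if "f ` A = f ` B" "A \<subseteq> topspace X" "B \<subseteq> topspace X" for A B
    using that inj by (simp add: inj_on_image_eq_iff)
  note bij = compact_opens_homeomorphic(1)[OF f]
  have KO: "f ` U \<in> compact_opens S" if "U \<in> compact_opens X" for U
    using bij_betwE[OF bij] that by blast
  have "sober_space X"
    unfolding sober_space_def
  proof (intro allI impI)
    fix C assume C: "irreducible_closedin X C"
    then have CX: "C \<subseteq> topspace X" by (simp add: irreducible_closedin_def closedin_subset)
    have "irreducible_closedin S (f ` C)"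
      unfolding irreducible_closedin_def
    proof (intro conjI allI impI)
      show "closedin S (f ` C)"
        using C homeomorphic_map_closedness[OF f CX] by (simp add: irreducible_closedin_def)
      show "f ` C \<noteq> {}" using C by (simp add: irreducible_closedin_def)
      fix D E assume DE: "closedin S D \<and> closedin S E \<and> f ` C = D \<union> E"
      have pre: "\<exists>D'. D' \<subseteq> topspace X \<and> D = f ` D' \<and> closedin X D'" if "closedin S D" for D
      proof -
        have "D \<subseteq> f ` topspace X" using that closedin_subset surj by blast
        then obtain D' where "D' \<subseteq> topspace X" "D = f ` D'" by (auto simp: subset_image_iff)
        then show ?thesis using that homeomorphic_map_closedness[OF f] by blast
      qed
      obtain D' E' where D': "D' \<subseteq> topspace X" "D = f ` D'" "closedin X D'"
        and E': "E' \<subseteq> topspace X" "E = f ` E'" "closedin X E'"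
        using pre DE by meson
      have "f ` C = f ` (D' \<union> E')" using DE D' E' by blast
      then have "C = D' \<union> E'" using inj_sub CX D' E' by blast
      then show "f ` C = D \<or> f ` C = E"
        using C D' E' unfolding irreducible_closedin_def by blast
    qed
    then have ex1: "\<exists>!y. y \<in> topspace S \<and> f ` C = S closure_of {y}"
      using S unfolding spectral_space_def sober_space_def by blast
    have iff: "f ` C = S closure_of {f x} \<longleftrightarrow> C = X closure_of {x}" if "x \<in> topspace X" for x
    proof -
      have "S closure_of {f x} = f ` (X closure_of {x})"
        using homeomorphic_map_closure_of[OF f, of "{x}"] that by simp
      then show ?thesis using inj_sub[of C "X closure_of {x}"] CX closure_of_subset_topspace by metis
    qed
    show "\<exists>!x. x \<in> topspace X \<and> C = X closure_of {x}"
    proof (rule ex_ex1I)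
      show "\<exists>x. x \<in> topspace X \<and> C = X closure_of {x}"
        using ex1 iff surj by (metis imageE)
      fix x x' assume *: "x \<in> topspace X \<and> C = X closure_of {x}" "x' \<in> topspace X \<and> C = X closure_of {x'}"
      then have "f x = f x'" using ex1 iff surj by (metis imageI)
      then show "x = x'" using * inj by (meson inj_onD)
    qed
  qed
  moreover have "compact_space X"
    using S homeomorphic_compact_space[OF XS] by (simp add: spectral_space_def)
  moreover have "openin X U \<longleftrightarrow> (arbitrary union_of (\<lambda>U. U \<in> compact_opens X)) U" for U
  proof
    assume U: "openin X U"
    show "(arbitrary union_of (\<lambda>U. U \<in> compact_opens X)) U"
      unfolding arbitrary_union_of_alt
    proof
      fix x assume x: "x \<in> U"
      have UX: "U \<subseteq> topspace X" using U by (rule openin_subset)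
      have "openin S (f ` U)" using U homeomorphic_map_openness[OF f UX] by blast
      then obtain V where V: "V \<in> compact_opens S" "f x \<in> V" "V \<subseteq> f ` U"
        using spectral_space_basis[OF S, of "f ` U" "f x"] x by blast
      have "V \<in> (`) f ` compact_opens X" unfolding bij_betw_imp_surj_on[OF bij] by (rule V(1))
      then obtain W where W: "W \<in> compact_opens X" "V = f ` W" by blast
      have "W \<subseteq> U"
        using inj_on_image_subset_iff[OF inj compact_opens_subset[OF W(1)] UX] V W by blast
      moreover have "x \<in> W"
        using V(2) W x UX inj compact_opens_subset[OF W(1)] by (metis inj_on_image_mem_iff subsetD)
      ultimately show "\<exists>V. V \<in> compact_opens X \<and> x \<in> V \<and> V \<subseteq> U" using W by blast
    qed
  next
    assume "(arbitrary union_of (\<lambda>U. U \<in> compact_opens X)) U"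
    then show "openin X U"
      unfolding arbitrary_union_of_alt by (subst openin_subopen) (meson compact_opens_openin)
  qed
  moreover have "U \<inter> V \<in> compact_opens X" if U: "U \<in> compact_opens X" and V: "V \<in> compact_opens X" for U V
  proof -
    have "f ` (U \<inter> V) = f ` U \<inter> f ` V"
      using inj_on_image_Int[OF inj] compact_opens_subset U V by blast
    moreover have "f ` U \<inter> f ` V \<in> compact_opens S"
      using KO U V S unfolding spectral_space_def by blast
    ultimately have "f ` (U \<inter> V) \<in> compact_opens S" by simp
    then have "f ` (U \<inter> V) \<in> (`) f ` compact_opens X" unfolding bij_betw_imp_surj_on[OF bij] .
    then obtain W where W: "W \<in> compact_opens X" "f ` (U \<inter> V) = f ` W" by blast
    have "U \<inter> V \<subseteq> topspace X" using compact_opens_subset[OF U] by blast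
    then have "U \<inter> V = W" by (rule inj_sub[OF W(2) _ compact_opens_subset[OF W(1)]])
    then show ?thesis using W(1) by simp
  qed
  ultimately show ?thesis unfolding spectral_space_def by blast
qed

section \<open>The spectrum of an MV-algebra is a spectral space\<close>

context mv_algebra
begin

definition spec_open :: "'a \<Rightarrow> 'a set set" where
  "spec_open a = {P. mv_prime_ideal A P \<and> a \<notin> P}"

lemma spec_open_meet:
  "\<lbrakk>a \<in> carrier A; b \<in> carrier A\<rbrakk> \<Longrightarrow> spec_open (a \<sqinter> b) = spec_open a \<inter> spec_open b"
  by (auto simp: spec_open_def prime_meet_iff)

lemma spec_open_oplus:
  "\<lbrakk>a \<in> carrier A; b \<in> carrier A\<rbrakk> \<Longrightarrow> spec_open (a \<oplus> b) = spec_open a \<union> spec_open b"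
  by (auto simp: spec_open_def ideal_oplus_iff mv_prime_ideal_def)

lemma spec_open_zero: "spec_open \<zero> = {}"
  by (auto simp: spec_open_def mv_prime_ideal_def zero_in_ideal)

lemma spec_open_one: "spec_open (\<sim> \<zero>) = topspace (mv_spec A)"
  by (auto simp: spec_open_def topspace_mv_spec one_notin_prime)

lemma spec_open_osum: "set xs \<subseteq> carrier A \<Longrightarrow> spec_open (osum xs) = (\<Union>x\<in>set xs. spec_open x)"
  by (induction xs) (auto simp: spec_open_zero spec_open_oplus)

lemma openin_spec_open: "a \<in> carrier A \<Longrightarrow> openin (mv_spec A) (spec_open a)"
  unfolding mv_spec_def spec_open_def by (rule topology_generated_by_Basis) blast

text \<open>The generating sets are closed under intersection, by primeness and
  \<open>spec_open_meet\<close>, so the subbasis is a basis.\<close>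

lemma spec_open_basis:
  assumes "openin (mv_spec A) U" "P \<in> U"
  obtains a where "a \<in> carrier A" "P \<in> spec_open a" "spec_open a \<subseteq> U"
proof -
  have "generate_topology_on (spec_open ` carrier A) U"
    using assms(1) by (simp add: mv_spec_def spec_open_def[abs_def] openin_topology_generated_by_iff)
  then have "\<forall>P\<in>U. \<exists>a\<in>carrier A. P \<in> spec_open a \<and> spec_open a \<subseteq> U"
  proof induction
    case (Int U V)
    show ?case
    proof
      fix P assume "P \<in> U \<inter> V"
      then obtain a b where "a \<in> carrier A" "b \<in> carrier A" "P \<in> spec_open a" "P \<in> spec_open b"
        "spec_open a \<subseteq> U" "spec_open b \<subseteq> V"
        using Int.IH by blast
      then show "\<exists>c\<in>carrier A. P \<in> spec_open c \<and> spec_open c \<subseteq> U \<inter> V"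
        by (intro bexI[of _ "a \<sqinter> b"]) (auto simp: spec_open_meet)
    qed
  next
    case (UN \<U>)
    then show ?case by (meson UnionE Union_upper subset_trans)
  qed auto
  with assms(2) that show ?thesis by blast
qed

text \<open>Let \<open>B\<close> collect the elements whose basic set lies in a member of the cover.
  If \<open>a\<close> were outside the ideal generated by \<open>B\<close>, a prime containing that
  ideal but not \<open>a\<close> would be uncovered. So \<open>a\<close> is below a finite sum from
  \<open>B\<close>, which names a finite subcover.\<close>

lemma compactin_spec_open:
  assumes a: "a \<in> carrier A"
  shows "compactin (mv_spec A) (spec_open a)"
  unfolding compactin_def
proof (intro conjI allI impI)
  show "spec_open a \<subseteq> topspace (mv_spec A)" by (auto simp: spec_open_def topspace_mv_spec)
  fix \<U> assume \<U>: "(\<forall>U\<in>\<U>. openin (mv_spec A) U) \<and> spec_open a \<subseteq> \<Union>\<U>"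
  define B where "B = {b \<in> carrier A. \<exists>U\<in>\<U>. spec_open b \<subseteq> U}"
  have B: "B \<subseteq> carrier A" by (auto simp: B_def)
  have "a \<in> generated_ideal B"
  proof (rule ccontr)
    assume "a \<notin> generated_ideal B"
    then obtain P where P: "mv_prime_ideal A P" "generated_ideal B \<subseteq> P" "a \<notin> P"
      using prime_ideal_theorem[OF mv_ideal_generated_ideal[OF B] a] by blast
    then have "P \<in> spec_open a" by (simp add: spec_open_def)
    then obtain U where U: "U \<in> \<U>" "P \<in> U" using \<U> by blast
    moreover have "openin (mv_spec A) U" using \<U> U by blast
    ultimately obtain b where b: "b \<in> carrier A" "P \<in> spec_open b" "spec_open b \<subseteq> U"
      using spec_open_basis by blast
    then have "b \<in> B" using U unfolding B_def by blast
    then have "b \<in> P" using generated_ideal_superset[OF B] P(2) by blast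
    then show False using b(2) by (simp add: spec_open_def)
  qed
  then obtain xs where xs: "set xs \<subseteq> B" "a \<preceq> osum xs" by (auto simp: generated_ideal_def)
  have "\<forall>x\<in>set xs. \<exists>U\<in>\<U>. spec_open x \<subseteq> U" using xs(1) unfolding B_def by blast
  then obtain u where u: "\<And>x. x \<in> set xs \<Longrightarrow> u x \<in> \<U> \<and> spec_open x \<subseteq> u x" by metis
  have "spec_open a \<subseteq> spec_open (osum xs)"
    using a xs ideal_le by (auto simp: spec_open_def mv_prime_ideal_def)
  also have "\<dots> = (\<Union>x\<in>set xs. spec_open x)"
    using xs(1) B by (intro spec_open_osum) blast
  also have "\<dots> \<subseteq> \<Union>(u ` set xs)" using u by blast
  finally have "spec_open a \<subseteq> \<Union>(u ` set xs)" .
  moreover have "u ` set xs \<subseteq> \<U>" using u by blast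
  ultimately show "\<exists>\<F>. finite \<F> \<and> \<F> \<subseteq> \<U> \<and> spec_open a \<subseteq> \<Union>\<F>"
    by (intro exI[of _ "u ` set xs"]) simp
qed

text \<open>A compact open set is a finite union of basic sets, and \<open>spec_open_osum\<close>
  merges these into one.\<close>

theorem compact_opens_mv_spec: "compact_opens (mv_spec A) = spec_open ` carrier A"
proof
  show "spec_open ` carrier A \<subseteq> compact_opens (mv_spec A)"
    by (auto simp: compact_opens_def openin_spec_open compactin_spec_open)
  show "compact_opens (mv_spec A) \<subseteq> spec_open ` carrier A"
  proof
    fix U assume "U \<in> compact_opens (mv_spec A)"
    then have U: "openin (mv_spec A) U" "compactin (mv_spec A) U" by (simp_all add: compact_opens_def)
    define B where "B = {b \<in> carrier A. spec_open b \<subseteq> U}"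
    have "U \<subseteq> \<Union>(spec_open ` B)"
    proof
      fix P assume "P \<in> U"
      then obtain b where "b \<in> carrier A" "P \<in> spec_open b" "spec_open b \<subseteq> U"
        using spec_open_basis[OF U(1)] by blast
      then show "P \<in> \<Union>(spec_open ` B)" unfolding B_def by blast
    qed
    moreover have "\<forall>V\<in>spec_open ` B. openin (mv_spec A) V"
      using openin_spec_open unfolding B_def by blast
    ultimately obtain \<F> where "finite \<F>" "\<F> \<subseteq> spec_open ` B" "U \<subseteq> \<Union>\<F>"
      using compactinD[OF U(2), of "spec_open ` B"] by metis
    then obtain F where F: "finite F" "F \<subseteq> B" "U \<subseteq> \<Union>(spec_open ` F)"
      by (metis finite_subset_image)
    obtain xs where xs: "set xs = F" using finite_list[OF F(1)] by blast
    have FC: "F \<subseteq> carrier A" using F(2) unfolding B_def by blast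
    have "U = \<Union>(spec_open ` F)" using F unfolding B_def by blast
    then have "U = spec_open (osum xs)" using spec_open_osum[of xs] xs FC by simp
    moreover have "osum xs \<in> carrier A" using xs FC by simp
    ultimately show "U \<in> spec_open ` carrier A" by blast
  qed
qed

theorem spectral_space_mv_spec: "spectral_space (mv_spec A)"
proof -
  have "sober_space (mv_spec A)"
    unfolding sober_space_def
  proof (intro allI impI)
    fix C assume C: "irreducible_closedin (mv_spec A) C"
    then have clC: "closedin (mv_spec A) C" and CX: "C \<subseteq> topspace (mv_spec A)"
      by (simp_all add: irreducible_closedin_def closedin_subset)
    have closure_iff: "Q \<in> mv_spec A closure_of {P} \<longleftrightarrow> Q \<in> topspace (mv_spec A) \<and>
        (\<forall>a\<in>carrier A. Q \<in> spec_open a \<longrightarrow> P \<in> spec_open a)" for P Q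
    proof -
      have "(\<forall>U. Q \<in> U \<and> openin (mv_spec A) U \<longrightarrow> P \<in> U) \<longleftrightarrow>
          (\<forall>a\<in>carrier A. Q \<in> spec_open a \<longrightarrow> P \<in> spec_open a)"
        using openin_spec_open spec_open_basis by (metis subsetD)
      then show ?thesis by (simp add: in_closure_of)
    qed
    have C_iff: "Q \<in> C \<longleftrightarrow> Q \<in> topspace (mv_spec A) \<and>
        (\<forall>a\<in>carrier A. Q \<in> spec_open a \<longrightarrow> spec_open a \<inter> C \<noteq> {})" for Q
    proof
      assume *: "Q \<in> topspace (mv_spec A) \<and> (\<forall>a\<in>carrier A. Q \<in> spec_open a \<longrightarrow> spec_open a \<inter> C \<noteq> {})"
      show "Q \<in> C"
      proof (rule ccontr)
        assume "Q \<notin> C"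
        moreover have "openin (mv_spec A) (topspace (mv_spec A) - C)"
          by (rule openin_diff[OF openin_topspace clC])
        ultimately obtain a where "a \<in> carrier A" "Q \<in> spec_open a" "spec_open a \<subseteq> topspace (mv_spec A) - C"
          using spec_open_basis[of "topspace (mv_spec A) - C" Q] * by blast
        then show False using * by blast
      qed
    qed (use CX in blast)
    \<comment> \<open>The generic point of \<open>C\<close>: the elements that belong to every prime
      ideal in \<open>C\<close>.\<close>
    define P where "P = {a \<in> carrier A. spec_open a \<inter> C = {}}"
    have mem: "a \<in> P \<longleftrightarrow> spec_open a \<inter> C = {}" if "a \<in> carrier A" for a
      using that by (simp add: P_def)
    have ideal: "mv_ideal A P"
      unfolding mv_ideal_def
    proof (intro conjI ballI impI)
      show "P \<subseteq> carrier A" by (auto simp: P_def)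
      have "\<zero> \<in> P" by (simp add: P_def spec_open_zero)
      then show "P \<noteq> {}" by blast
      fix x y assume x: "x \<in> P"
      then have xC: "x \<in> carrier A" "spec_open x \<inter> C = {}" by (simp_all add: P_def)
      show "y \<in> P" if y: "y \<in> carrier A" "y \<preceq> x"
      proof -
        have "spec_open y \<subseteq> spec_open x"
          using y xC ideal_le by (auto simp: spec_open_def mv_prime_ideal_def)
        then show ?thesis using xC y unfolding P_def by blast
      qed
      show "x \<oplus> y \<in> P" if y: "y \<in> P"
      proof -
        have "y \<in> carrier A" "spec_open y \<inter> C = {}" using y by (simp_all add: P_def)
        then show ?thesis using xC by (simp add: P_def spec_open_oplus Int_Un_distrib2)
      qed
    qed
    have "mv_prime_ideal A P"
      unfolding mv_prime_ideal_def
    proof (intro conjI ballI impI ideal)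
      have "spec_open (\<sim> \<zero>) \<inter> C \<noteq> {}"
        using C CX unfolding spec_open_one irreducible_closedin_def by blast
      then have "\<sim> \<zero> \<notin> P" by (simp add: P_def)
      then show "P \<noteq> carrier A" by (metis neg_closed zero_closed)
      fix x y assume xy: "x \<in> carrier A" "y \<in> carrier A" "x \<sqinter> y \<in> P"
      then have disj: "spec_open x \<inter> spec_open y \<inter> C = {}"
        by (simp add: P_def spec_open_meet)
      have cl: "closedin (mv_spec A) (C - spec_open z)" if "z \<in> carrier A" for z
        using clC openin_spec_open[OF that] by (rule closedin_diff)
      \<comment> \<open>Primeness of \<open>P\<close> is irreducibility of \<open>C\<close>: no
        point of \<open>C\<close> lies in both basic sets, so removing each of them in turn splits
        \<open>C\<close> into two closed sets.\<close>
      have "C = (C - spec_open x) \<union> (C - spec_open y)" using disj by blast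
      then have "C = C - spec_open x \<or> C = C - spec_open y"
        using C cl[OF xy(1)] cl[OF xy(2)] unfolding irreducible_closedin_def by blast
      then show "x \<in> P \<or> y \<in> P" using xy unfolding P_def by blast
    qed
    then have P_spec: "P \<in> topspace (mv_spec A)" "P \<in> spec_open a \<longleftrightarrow> a \<notin> P" for a
      by (simp_all add: topspace_mv_spec spec_open_def)
    have "Q \<in> mv_spec A closure_of {P} \<longleftrightarrow> Q \<in> C" for Q
      unfolding closure_iff C_iff[of Q] using mem P_spec(2) by blast
    then have C_eq: "C = mv_spec A closure_of {P}" by blast
    show "\<exists>!P. P \<in> topspace (mv_spec A) \<and> C = mv_spec A closure_of {P}"
    proof (rule ex1I[of _ P])
      show "P \<in> topspace (mv_spec A) \<and> C = mv_spec A closure_of {P}"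
        using P_spec(1) C_eq by blast
      fix Q assume Q: "Q \<in> topspace (mv_spec A) \<and> C = mv_spec A closure_of {Q}"
      have "Q \<in> mv_spec A closure_of {P}" "P \<in> mv_spec A closure_of {Q}"
        using Q P_spec(1) C_eq closure_iff[of Q Q] closure_iff[of P P] by blast+
      then have "Q \<in> spec_open a \<longleftrightarrow> P \<in> spec_open a" if "a \<in> carrier A" for a
        using closure_iff that by blast
      then have "a \<in> Q \<longleftrightarrow> a \<in> P" if "a \<in> carrier A" for a
        using that Q P_spec(1) by (auto simp: spec_open_def topspace_mv_spec)
      moreover have "Q \<subseteq> carrier A" "P \<subseteq> carrier A"
        using Q P_spec(1) ideal_subset by (auto simp: topspace_mv_spec mv_prime_ideal_def)
      ultimately show "Q = P" by blast
    qed
  qed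
  moreover have "compact_space (mv_spec A)"
    using compactin_spec_open[of "\<sim> \<zero>"] by (simp add: compact_space_def spec_open_one)
  moreover have "openin (mv_spec A) U \<longleftrightarrow> (arbitrary union_of (\<lambda>U. U \<in> compact_opens (mv_spec A))) U" for U
    unfolding arbitrary_union_of_alt compact_opens_mv_spec
  proof
    assume "openin (mv_spec A) U"
    then show "\<forall>x\<in>U. \<exists>V. V \<in> spec_open ` carrier A \<and> x \<in> V \<and> V \<subseteq> U"
      by (metis imageI spec_open_basis)
  next
    assume "\<forall>x\<in>U. \<exists>V. V \<in> spec_open ` carrier A \<and> x \<in> V \<and> V \<subseteq> U"
    then show "openin (mv_spec A) U"
      by (subst openin_subopen) (metis imageE openin_spec_open)
  qed
  moreover have "U \<inter> V \<in> compact_opens (mv_spec A)"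
    if "U \<in> compact_opens (mv_spec A)" "V \<in> compact_opens (mv_spec A)" for U V
    using that unfolding compact_opens_mv_spec by (auto simp flip: spec_open_meet)
  ultimately show ?thesis unfolding spectral_space_def by blast
qed

end


section \<open>Spectra of free MV-algebras\<close>

text \<open>The hypothesis makes \<open>F i = F j\<close> equivalent to \<open>G i = G j\<close>, so
  sending \<open>F i\<close> to \<open>G i\<close> is independent of the chosen index and
  injective.\<close>

lemma anti_isomorphic_images:
  fixes F :: "'i \<Rightarrow> 'a set" and G :: "'i \<Rightarrow> 'b set"
  assumes FG: "\<And>i j. \<lbrakk>i \<in> I; j \<in> I\<rbrakk> \<Longrightarrow> F i \<subseteq> F j \<longleftrightarrow> G j \<subseteq> G i"
  shows "anti_isomorphic (F ` I) (G ` I)"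
proof -
  define r where "r U = (SOME i. i \<in> I \<and> F i = U)" for U
  have r: "r (F i) \<in> I" "F (r (F i)) = F i" if "i \<in> I" for i
    using someI[of "\<lambda>j. j \<in> I \<and> F j = F i" i] that by (auto simp: r_def)
  have G: "G (r (F i)) = G i" if "i \<in> I" for i
    using FG[of "r (F i)" i] FG[of i "r (F i)"] r[OF that] that by auto
  have "bij_betw (\<lambda>U. G (r U)) (F ` I) (G ` I)"
    unfolding bij_betw_def
  proof
    show "inj_on (\<lambda>U. G (r U)) (F ` I)"
    proof (rule inj_onI, elim imageE)
      fix U V i j assume *: "G (r U) = G (r V)" "U = F i" "i \<in> I" "V = F j" "j \<in> I"
      then have "G i = G j" using G by simp
      then show "U = V" using FG[of i j] FG[of j i] * by auto
    qed
    show "(\<lambda>U. G (r U)) ` F ` I = G ` I"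
      unfolding image_image by (rule image_cong[OF HOL.refl G])
  qed
  moreover have "\<forall>U\<in>F ` I. \<forall>V\<in>F ` I. U \<le> V \<longleftrightarrow> G (r V) \<le> G (r U)"
    using FG by (auto simp: G)
  ultimately show ?thesis unfolding anti_isomorphic_def by blast
qed

lemma anti_isomorphicE:
  fixes L :: "'a set set" and M :: "'b set set"
  assumes "anti_isomorphic L M"
  obtains \<phi> where "bij_betw \<phi> L M" "\<And>U V. \<lbrakk>U \<in> L; V \<in> L\<rbrakk> \<Longrightarrow> U \<subseteq> V \<longleftrightarrow> \<phi> V \<subseteq> \<phi> U"
proof -
  from assms obtain \<phi> where \<phi>: "bij_betw \<phi> L M \<and> (\<forall>x\<in>L. \<forall>y\<in>L. x \<le> y \<longleftrightarrow> \<phi> y \<le> \<phi> x)"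
    unfolding anti_isomorphic_def by (rule exE)
  show ?thesis
  proof (rule that)
    show "bij_betw \<phi> L M" using \<phi> by (rule conjunct1)
    show "U \<subseteq> V \<longleftrightarrow> \<phi> V \<subseteq> \<phi> U" if "U \<in> L" "V \<in> L" for U V
      using \<phi> that by simp
  qed
qed

theorem anti_isomorphic_free_mv: "anti_isomorphic (compact_opens (mv_spec (free_mv K))) (Cypol K)"
proof -
  interpret mv_algebra "free_mv K" by (rule mv_algebra_free_mv)
  let ?I = "{s. mv_vars s \<subseteq> K}"
  define F where "F s = spec_open (mv_term_rel K `` {s})" for s
  have "carrier (free_mv K) = (\<lambda>s. mv_term_rel K `` {s}) ` ?I"
    by (auto simp: free_mv_class_closed elim: free_mv_carrierE)
  then have KO: "compact_opens (mv_spec (free_mv K)) = F ` ?I"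
    unfolding compact_opens_mv_spec F_def by (simp only: image_image)
  have "F s \<subseteq> F t \<longleftrightarrow> zero_set K t \<subseteq> zero_set K s" if "s \<in> ?I" "t \<in> ?I" for s t
  proof -
    have st: "mv_vars s \<subseteq> K" "mv_vars t \<subseteq> K" using that by auto
    have "F s \<subseteq> F t \<longleftrightarrow> (\<forall>P. mv_prime_ideal (free_mv K) P \<longrightarrow> mv_term_rel K `` {t} \<in> P \<longrightarrow> mv_term_rel K `` {s} \<in> P)"
      unfolding F_def spec_open_def by blast
    also have "\<dots> \<longleftrightarrow> (\<forall>v. range v \<subseteq> {0..1} \<longrightarrow> mv_eval unit_mv v t = 0 \<longrightarrow> mv_eval unit_mv v s = 0)"
      by (rule free_mv_prime_ideals_iff[OF st])
    \<comment> \<open>Terms over \<open>K\<close> see only the values on \<open>K\<close>, so total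
      valuations may be restricted to \<open>K\<close>, and points of the cube extended by
      zero.\<close>
    also have "\<dots> \<longleftrightarrow> (\<forall>f\<in>K \<rightarrow>\<^sub>E {0..1}. mv_eval unit_mv f t = 0 \<longrightarrow> mv_eval unit_mv f s = 0)"
    proof
      assume *: "\<forall>v. range v \<subseteq> {0..1} \<longrightarrow> mv_eval unit_mv v t = 0 \<longrightarrow> mv_eval unit_mv v s = 0"
      show "\<forall>f\<in>K \<rightarrow>\<^sub>E {0..1}. mv_eval unit_mv f t = 0 \<longrightarrow> mv_eval unit_mv f s = 0"
      proof
        fix f :: "'a \<Rightarrow> real" assume f: "f \<in> K \<rightarrow>\<^sub>E {0..1}"
        define v where "v k = (if k \<in> K then f k else 0)" for k
        have "range v \<subseteq> {0..1}" using f by (auto simp: v_def PiE_iff)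
        moreover have "mv_eval unit_mv f u = mv_eval unit_mv v u" if "mv_vars u \<subseteq> K" for u
          using that by (intro mv_eval_cong) (auto simp: v_def)
        ultimately show "mv_eval unit_mv f t = 0 \<longrightarrow> mv_eval unit_mv f s = 0"
          using * st by simp
      qed
    next
      assume *: "\<forall>f\<in>K \<rightarrow>\<^sub>E {0..1}. mv_eval unit_mv f t = 0 \<longrightarrow> mv_eval unit_mv f s = 0"
      show "\<forall>v. range v \<subseteq> {0..1} \<longrightarrow> mv_eval unit_mv v t = 0 \<longrightarrow> mv_eval unit_mv v s = 0"
      proof (intro allI impI)
        fix v :: "'a \<Rightarrow> real" assume v: "range v \<subseteq> {0..1}" "mv_eval unit_mv v t = 0"
        have "restrict v K \<in> K \<rightarrow>\<^sub>E {0..1}"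
          unfolding restrict_PiE_iff using v(1) by blast
        moreover have "mv_eval unit_mv (restrict v K) u = mv_eval unit_mv v u" if "mv_vars u \<subseteq> K" for u
          using that by (intro mv_eval_cong) auto
        ultimately show "mv_eval unit_mv v s = 0" using * st v(2) by metis
      qed
    qed
    also have "\<dots> \<longleftrightarrow> zero_set K t \<subseteq> zero_set K s"
      unfolding zero_set_def by blast
    finally show ?thesis .
  qed
  then show ?thesis
    unfolding KO Cypol_eq_zero_sets by (rule anti_isomorphic_images)
qed

theorem theorem4p2:
  fixes X :: "'a topology"
  shows "(\<exists>K :: 'k set. X homeomorphic_space mv_spec (free_mv K)) \<longleftrightarrow> cylinder_based TYPE('k) X"
proof
  assume "\<exists>K :: 'k set. X homeomorphic_space mv_spec (free_mv K)"
  then obtain K :: "'k set" where hom: "X homeomorphic_space mv_spec (free_mv K)" by blast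
  let ?S = "mv_spec (free_mv K)"
  interpret mv_algebra "free_mv K" by (rule mv_algebra_free_mv)
  obtain f where f: "homeomorphic_map X ?S f" using hom homeomorphic_space by blast
  note bij = compact_opens_homeomorphic(1)[OF f] and le = compact_opens_homeomorphic(2)[OF f]
  obtain \<phi> where \<phi>: "bij_betw \<phi> (compact_opens ?S) (Cypol K)"
    "\<And>U V. \<lbrakk>U \<in> compact_opens ?S; V \<in> compact_opens ?S\<rbrakk> \<Longrightarrow> U \<subseteq> V \<longleftrightarrow> \<phi> V \<subseteq> \<phi> U"
    by (rule anti_isomorphicE[OF anti_isomorphic_free_mv[of K]]) simp
  have KO: "f ` U \<in> compact_opens ?S" if "U \<in> compact_opens X" for U
    using bij_betwE[OF bij] that by blast
  have "bij_betw (\<phi> \<circ> (`) f) (compact_opens X) (Cypol K)"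
    by (rule bij_betw_trans[OF bij \<phi>(1)])
  moreover have "U \<subseteq> V \<longleftrightarrow> \<phi> (f ` V) \<subseteq> \<phi> (f ` U)" if "U \<in> compact_opens X" "V \<in> compact_opens X" for U V
    using le[OF that] \<phi>(2)[OF KO[OF that(1)] KO[OF that(2)]] by (rule HOL.trans)
  ultimately have "anti_isomorphic (compact_opens X) (Cypol K)"
    unfolding anti_isomorphic_def by (intro exI[of _ "\<phi> \<circ> (`) f"]) simp
  then show "cylinder_based TYPE('k) X"
    using spectral_space_homeomorphic[OF hom spectral_space_mv_spec] 
    unfolding cylinder_based_def by (intro conjI exI)
next
  assume "cylinder_based TYPE('k) X"
  then obtain K :: "'k set" where X: "spectral_space X" "anti_isomorphic (compact_opens X) (Cypol K)"
    unfolding cylinder_based_def by blast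
  let ?S = "mv_spec (free_mv K)"
  interpret mv_algebra "free_mv K" by (rule mv_algebra_free_mv)
  obtain \<phi> where \<phi>: "bij_betw \<phi> (compact_opens X) (Cypol K)"
    "\<And>U V. \<lbrakk>U \<in> compact_opens X; V \<in> compact_opens X\<rbrakk> \<Longrightarrow> U \<subseteq> V \<longleftrightarrow> \<phi> V \<subseteq> \<phi> U"
    by (rule anti_isomorphicE[OF X(2)]) simp
  obtain \<psi> where \<psi>: "bij_betw \<psi> (compact_opens ?S) (Cypol K)"
    "\<And>U V. \<lbrakk>U \<in> compact_opens ?S; V \<in> compact_opens ?S\<rbrakk> \<Longrightarrow> U \<subseteq> V \<longleftrightarrow> \<psi> V \<subseteq> \<psi> U"
    by (rule anti_isomorphicE[OF anti_isomorphic_free_mv[of K]]) simp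
  \<comment> \<open>Two order-reversing bijections onto \<open>Cypol K\<close> compose, one of them
    inverted, to an order isomorphism between the lattices of compact open sets.\<close>
  define \<theta> where "\<theta> = inv_into (compact_opens ?S) \<psi> \<circ> \<phi>"
  have \<theta>: "bij_betw \<theta> (compact_opens X) (compact_opens ?S)"
    unfolding \<theta>_def by (rule bij_betw_trans[OF \<phi>(1) bij_betw_inv_into[OF \<psi>(1)]])
  have \<theta>K: "\<theta> U \<in> compact_opens ?S" if "U \<in> compact_opens X" for U
    using bij_betwE[OF \<theta>] that by blast
  have \<psi>\<theta>: "\<psi> (\<theta> U) = \<phi> U" if "U \<in> compact_opens X" for U
    using bij_betwE[OF \<phi>(1)] that by (simp add: \<theta>_def bij_betw_inv_into_right[OF \<psi>(1)])
  have "X homeomorphic_space ?S"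
  proof (rule spectral_spaces_homeomorphic[OF X(1) spectral_space_mv_spec \<theta>])
    fix U V assume "U \<in> compact_opens X" "V \<in> compact_opens X"
    then show "U \<subseteq> V \<longleftrightarrow> \<theta> U \<subseteq> \<theta> V"
      using \<phi>(2)[of U V] \<psi>(2)[of "\<theta> U" "\<theta> V"] \<theta>K \<psi>\<theta> by simp
  qed
  then show "\<exists>K :: 'k set. X homeomorphic_space mv_spec (free_mv K)" by blast
qed

end
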